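(* Let $a_1,\dots,a_6$ be non-negative integers, not all zero, such that $a_1+a_6\ge\max\{a_2+a_5,\ a_3+a_4\}$. Let $$\mathcal A=\max\{a_2+a_5,\ a_3+a_4,\ a_2+a_4-a_6+1,\ a_3+a_5-a_6+1,\ a_2+a_3-a_1+1,\ a_4+a_5-a_1+1\}.$$ Then the tetrahedral curve $C(a_1,\dots,a_6)$ is arithmetically Cohen-Macaulay if and only if one of the following conditions holds: (i) $a_1=0$ or $a_6=0$; (ii) $a_1+a_6-2<\mathcal A$; (iii) $a_1+a_6-2=a_2+a_5=a_3+a_4=\mathcal A$ and $a_2+a_3-a_6$ is even.
   Context: $K$ is a field and $R=K[x_1,x_2,x_3,x_4]$, $\mathfrak m=(x_1,x_2,x_3,x_4)$. For non-negative integers $a_1,\dots,a_6$, not all zero, the tetrahedral curve $C(a_1,\dots,a_6)$ is the curve in $\mathbb P^3$ defined by the ideal $$I=(x_1,x_2)^{a_1}\cap(x_1,x_3)^{a_2}\cap(x_1,x_4)^{a_3}\cap(x_2,x_3)^{a_4}\cap(x_2,x_4)^{a_5}\cap(x_3,x_4)^{a_6}$$ of $R$, where $\mathfrak p^0=R$. It is arithmetically Cohen-Macaulay if $R/I$ is a Cohen-Macaulay ring (equivalently $H^1_{\mathfrak m}(R/I)=0$). *)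

theory Defs
  imports
    "HOL-Algebra.Algebra"
    "HOL-Algebra.Algebraic_Closure_Type"
    "HOL-Library.Poly_Mapping"
    "HOL-Library.Numeral_Type"
    "HOL-Library.Extended_Nat"
begin

section \<open>Cohen-Macaulay rings\<close>

text \<open>
  The second condition is properness of the ideal generated by the sequence; the third says that
  the \<open>i\<close>-th entry is a non-zero-divisor on the quotient of \<open>A\<close> by the ideal generated by the
  preceding entries.
\<close>

definition regular_sequence :: "('a, 'b) ring_scheme \<Rightarrow> 'a list \<Rightarrow> bool" where
  "regular_sequence A fs \<longleftrightarrow>
     set fs \<subseteq> carrier A \<and>
     Idl\<^bsub>A\<^esub> (set fs) \<noteq> carrier A \<and>
     (\<forall>i<length fs. \<forall>g\<in>carrier A.
        fs ! i \<otimes>\<^bsub>A\<^esub> g \<in> Idl\<^bsub>A\<^esub> (set (take i fs)) \<longrightarrow> g \<in> Idl\<^bsub>A\<^esub> (set (take i fs)))"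

definition ideal_depth :: "('a, 'b) ring_scheme \<Rightarrow> 'a set \<Rightarrow> enat" where
  "ideal_depth A P = Sup {enat (length fs) |fs. regular_sequence A fs \<and> set fs \<subseteq> P}"

text \<open>Height (codimension) of a prime ideal, by strict chains of primes ending in it.\<close>

definition prime_height :: "('a, 'b) ring_scheme \<Rightarrow> 'a set \<Rightarrow> enat" where
  "prime_height A P = Sup {enat n |n. \<exists>Q :: nat \<Rightarrow> 'a set.
     (\<forall>i\<le>n. primeideal (Q i) A) \<and> (\<forall>i<n. Q i \<subset> Q (Suc i)) \<and> Q n = P}"

text \<open>
  For a maximal ideal \<open>P\<close> of a Noetherian ring, the depth of \<open>P\<close> on \<open>A\<close> is the depth of the local
  ring of \<open>A\<close> at \<open>P\<close>, and the height of \<open>P\<close> is the Krull dimension of that local ring.  So this is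
  the usual condition that every localization at a maximal ideal is a Cohen-Macaulay local ring,
  in the form used as the definition in Eisenbud's \<open>Commutative Algebra\<close>, Section 18.2.
\<close>

definition cohen_macaulay_ring :: "('a, 'b) ring_scheme \<Rightarrow> bool" where
  "cohen_macaulay_ring A \<longleftrightarrow>
     cring A \<and> noetherian_ring A \<and>
     (\<forall>P. maximalideal P A \<longrightarrow> ideal_depth A P = prime_height A P)"

section \<open>Tetrahedral curves\<close>

text \<open>
  Polynomials in four variables over \<open>'k\<close>: finitely supported functions from exponent vectors to
  coefficients.  The variables are indexed by the four elements \<open>1, 2, 3, 4\<close> of the type \<open>4\<close>
  (where \<open>4 = 0\<close>).
\<close>

type_synonym 'k poly4 = "(4 \<Rightarrow>\<^sub>0 nat) \<Rightarrow>\<^sub>0 'k"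

abbreviation poly4_ring :: "'k::field poly4 ring" where
  "poly4_ring \<equiv> ring_of_type_algebra"

definition pvar :: "4 \<Rightarrow> 'k::field poly4" where
  "pvar i = Poly_Mapping.single (Poly_Mapping.single i 1) 1"

text \<open>
  The power is taken in the semiring of ideals of the polynomial ring, whose multiplication is the
  product of ideals and whose unit is the whole ring; in particular exponent \<open>0\<close> gives the whole
  ring.
\<close>

definition line_power :: "4 \<Rightarrow> 4 \<Rightarrow> nat \<Rightarrow> 'k::field poly4 set" where
  "line_power i j a = (Idl\<^bsub>poly4_ring\<^esub> {pvar i, pvar j}) [^]\<^bsub>ideals_set poly4_ring\<^esub> a"

definition tetrahedral_ideal ::
    "nat \<Rightarrow> nat \<Rightarrow> nat \<Rightarrow> nat \<Rightarrow> nat \<Rightarrow> nat \<Rightarrow> 'k::field poly4 set" where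
  "tetrahedral_ideal a1 a2 a3 a4 a5 a6 =
     line_power 1 2 a1 \<inter> line_power 1 3 a2 \<inter> line_power 1 4 a3 \<inter>
     line_power 2 3 a4 \<inter> line_power 2 4 a5 \<inter> line_power 3 4 a6"

text \<open>A projective curve is represented by its defining ideal.\<close>

definition arithmetically_cohen_macaulay :: "'k::field poly4 set \<Rightarrow> bool" where
  "arithmetically_cohen_macaulay I \<longleftrightarrow> cohen_macaulay_ring (poly4_ring Quot I)"

end

theory Submission
  imports Defs
begin

text \<open>
  For a two-element set \<open>e = {i, j}\<close> of indices, an \<^emph>\<open>edge\<close>, let \<open>a e\<close> be the exponent belonging to
  \<open>e\<close> and \<open>J e = (x\<^sub>i, x\<^sub>j)\<close> to the power \<open>a e\<close>, so that \<open>I\<close> is the intersection of the six ideals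
  \<open>J e\<close>.  All of them are spanned by monomials: \<open>x\<close> to the power \<open>u\<close> lies in \<open>J e\<close> iff
  \<open>deg_in e u = u\<^sub>i + u\<^sub>j\<close> is at least \<open>a e\<close>.  Call an exponent vector \<open>u\<close> a \<^emph>\<open>gap\<close> at \<open>e\<close> if it lies outside
  \<open>J e\<close> and outside \<open>J (- e)\<close>, the ideal of the opposite edge, but inside the four other ideals.
  The geometric half of the proof is that \<open>R/I\<close> is Cohen-Macaulay iff there is no gap; this holds for
  arbitrary exponents.  In terms of local cohomology, the gaps are the degrees in which \<open>H\<^sup>1(R/I)\<close>
  does not vanish, but the proof is elementary.

  \<^emph>\<open>No gap implies Cohen-Macaulay.\<close>  A family \<open>w e\<close> of polynomials is, modulo the ideals \<open>J e\<close>, given by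
  one polynomial as soon as the coefficients of \<open>w e\<close> and \<open>w e'\<close> at each exponent outside both \<open>J e\<close>
  and \<open>J e'\<close> agree (\<open>glue_along_lines\<close>).  Let \<open>P\<close> be a maximal ideal containing \<open>I\<close>.  It contains two of
  the variables, so by a case of Zariski's lemma \<open>P\<close> contains for every \<open>k\<close> a nonzero polynomial \<open>y k\<close>
  in \<open>x\<^sub>k\<close> alone, and one may take it without constant term
  (\<open>maximal_ideal_contains_univariate_family\<close>).  Put \<open>f = (\<Sum>k. y k)\<close> and let \<open>g\<close> be the second elementary
  symmetric polynomial in the \<open>y k\<close>.  Modulo \<open>x\<^sub>i\<close> and \<open>x\<^sub>j\<close> they become \<open>y k + y l\<close> and \<open>y k * y l\<close> with
  \<open>{k, l} = - {i, j}\<close>, so \<open>f, g\<close> is regular on every \<open>R / J e\<close>.  If \<open>g u\<close> is a multiple of \<open>f\<close> modulo \<open>I\<close>,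
  then \<open>u = f * w e\<close> modulo \<open>J e\<close> for suitable \<open>w e\<close>, and the \<open>w e\<close> have to be glued.  If \<open>e\<close> and \<open>e'\<close>
  share an index, then \<open>f\<close> is a non-zero-divisor modulo \<open>J e + J e'\<close> and \<open>w e\<close>, \<open>w e'\<close> agree.  If they are
  opposite, then at an exponent outside both ideals there is, in the absence of gaps, a third edge whose
  ideal does not contain it either, and \<open>w e\<close> and \<open>w e'\<close> both agree with the third polynomial.  Hence \<open>f, g\<close>
  is a regular sequence and the depth of \<open>P\<close> is at least 2.  Since depth never exceeds height
  (\<open>ideal_depth_le_prime_height\<close>) and a chain of four primes above \<open>I\<close> is impossible, because three
  polynomials are algebraically dependent on a coordinate plane (\<open>no_long_prime_chain_over_line\<close>), depth and
  height are both 2.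

  \<^emph>\<open>A gap implies not Cohen-Macaulay.\<close>  A gap \<open>u\<close> can be raised until \<open>deg_in e u = a e - 1\<close> and
  \<open>deg_in (- e) u = a (- e) - 1\<close>.  Split a polynomial \<open>p\<close> without constant term as \<open>l p + r p\<close>, where \<open>l p\<close>
  collects the monomials involving the variables of \<open>e\<close>.  Then \<open>p\<close> goes to \<open>l p\<close> times the monomial with
  exponent \<open>u\<close> is a homomorphism from the ideal of the origin to \<open>R/I\<close> that is not multiplication by an
  element, and its existence excludes a regular sequence of length 2 in that ideal, which has height 2.

  \<^emph>\<open>Arithmetic.\<close>  By the domination hypothesis a gap can only occur at \<open>{1, 2}\<close> or at \<open>{3, 4}\<close>, and it is a
  solution of six linear inequalities in the coordinates of \<open>u\<close>.  After raising, it is determined by two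
  coordinates; eliminating one of them leaves bounds on the other, among them an interval for its
  double.  If \<open>a1\<close> and \<open>a6\<close> are positive, the bounds are compatible over the rationals iff the second
  condition of the theorem fails; the third condition says that then the interval consists of one odd
  number.
\<close>

alias lookup = Poly_Mapping.lookup
alias keys = Poly_Mapping.keys
alias mterm = Poly_Mapping.single

section \<open>Depth is at most height\<close>

lemma (in cring) ideal_adjoin:
  assumes "ideal J R" "x \<in> carrier R"
  shows "\<exists>K. ideal K R \<and> J \<subseteq> K \<and> x \<in> K \<and> (\<forall>z\<in>K. \<exists>j\<in>J. \<exists>r\<in>carrier R. z = j \<oplus> r \<otimes> x)"
proof -
  have I: "ideal (J <+> PIdl x) R"
    by (intro add_ideals assms cgenideal_ideal)
  have J0: "\<zero> \<in> J" by (rule additive_subgroup.zero_closed[OF ideal.axioms(1)[OF assms(1)]])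
  have c: "J \<subseteq> carrier R" using ideal.Icarr[OF assms(1)] by blast
  have "J \<subseteq> J <+> PIdl x"
  proof
    fix a assume "a \<in> J"
    then have "a = a \<oplus> \<zero> \<otimes> x" using c assms by auto
    then show "a \<in> J <+> PIdl x" using \<open>a \<in> J\<close>
      unfolding set_add_def' cgenideal_def by blast
  qed
  moreover have "x \<in> J <+> PIdl x"
  proof -
    have "x = \<zero> \<oplus> \<one> \<otimes> x" using assms by simp
    then show ?thesis using J0 unfolding set_add_def' cgenideal_def by blast
  qed
  moreover have "\<forall>z\<in>J <+> PIdl x. \<exists>j\<in>J. \<exists>r\<in>carrier R. z = j \<oplus> r \<otimes> x"
    unfolding set_add_def' cgenideal_def by blast
  ultimately show ?thesis using I by blast
qed

lemma (in noetherian_ring) maximal_ideal_with: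
  assumes "ideal J R" "\<Phi> J"
  obtains M where "ideal M R" "J \<subseteq> M" "\<Phi> M"
    "\<And>N. ideal N R \<Longrightarrow> M \<subseteq> N \<Longrightarrow> \<Phi> N \<Longrightarrow> N = M"
proof -
  define S where "S = {K. ideal K R \<and> J \<subseteq> K \<and> \<Phi> K}"
  have "\<exists>M\<in>S. \<forall>Y\<in>S. M \<subseteq> Y \<longrightarrow> Y = M"
  proof (rule subset_Zorn)
    fix C assume C: "subset.chain S C"
    show "\<exists>U\<in>S. \<forall>Y\<in>C. Y \<subseteq> U"
    proof (cases "C = {}")
      case True
      then show ?thesis using assms by (auto simp: S_def)
    next
      case False
      have "subset.chain {I. ideal I R} C"
        using C by (auto simp: S_def pred_on.chain_def)
      then have "\<Union>C \<in> C" using False ideal_chain_is_trivial by blast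
      then show ?thesis using C by (auto simp: pred_on.chain_def)
    qed
  qed
  then obtain M where M: "M \<in> S" "\<And>Y. Y \<in> S \<Longrightarrow> M \<subseteq> Y \<Longrightarrow> Y = M" by auto
  show ?thesis
  proof (rule that[of M])
    show "ideal M R" "J \<subseteq> M" "\<Phi> M" using M(1) by (auto simp: S_def)
    show "N = M" if "ideal N R" "M \<subseteq> N" "\<Phi> N" for N
      using M that by (auto simp: S_def)
  qed
qed

text \<open>
  An ideal that is maximal among those disjoint from \<open>T\<close> is prime: if it contains neither \<open>a\<close> nor \<open>b\<close>,
  then adjoining either of them yields an element of \<open>T\<close>, and the product of these two elements of
  \<open>T\<close> lies in the ideal as soon as \<open>a \<otimes> b\<close> does.
\<close>
lemma (in cring) prime_avoiding_multiplicative_set: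
  assumes noeth: "noetherian_ring R" and J: "ideal J R" and one: "\<one> \<in> T" and "T \<subseteq> carrier R"
    and T: "\<And>a b. a \<in> T \<Longrightarrow> b \<in> T \<Longrightarrow> a \<otimes> b \<in> T" and disj: "J \<inter> T = {}"
  obtains Q where "primeideal Q R" "J \<subseteq> Q" "Q \<inter> T = {}"
proof -
  interpret N: noetherian_ring R by fact
  obtain Q where Q: "ideal Q R" "J \<subseteq> Q" "Q \<inter> T = {}"
    and max: "\<And>N. ideal N R \<Longrightarrow> Q \<subseteq> N \<Longrightarrow> N \<inter> T = {} \<Longrightarrow> N = Q"
    using N.maximal_ideal_with[where \<Phi> = "\<lambda>K. K \<inter> T = {}", OF J disj] by metis
  interpret Q: ideal Q R by fact
  have "primeideal Q R"
  proof (rule primeidealI)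
    show "ideal Q R" "cring R" by (fact, rule is_cring)
    show "carrier R \<noteq> Q" using Q one by auto
    fix a b assume ab: "a \<in> carrier R" "b \<in> carrier R" "a \<otimes> b \<in> Q"
    show "a \<in> Q \<or> b \<in> Q"
    proof (rule ccontr)
      assume n: "\<not> (a \<in> Q \<or> b \<in> Q)"
      have *: "\<exists>q\<in>Q. \<exists>r\<in>carrier R. q \<oplus> r \<otimes> x \<in> T" if x: "x \<in> carrier R" "x \<notin> Q" for x
      proof -
        obtain K where K: "ideal K R" "Q \<subseteq> K" "x \<in> K" 
          "\<forall>z\<in>K. \<exists>j\<in>Q. \<exists>r\<in>carrier R. z = j \<oplus> r \<otimes> x"
          using ideal_adjoin[OF Q(1) x(1)] by blast
        have "K \<inter> T \<noteq> {}" using max[OF K(1,2)] K(3) x by auto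
        then show ?thesis using K(4) by fastforce
      qed
      obtain q r where q: "q \<in> Q" "r \<in> carrier R" "q \<oplus> r \<otimes> a \<in> T" using * n ab by blast
      obtain q' r' where q': "q' \<in> Q" "r' \<in> carrier R" "q' \<oplus> r' \<otimes> b \<in> T" using * n ab by blast
      have c: "q \<in> carrier R" "q' \<in> carrier R" using q q' Q.Icarr by auto
      have "(q \<oplus> r \<otimes> a) \<otimes> (q' \<oplus> r' \<otimes> b) = 
         (q' \<oplus> r' \<otimes> b) \<otimes> q \<oplus> (r \<otimes> a \<otimes> q' \<oplus> r \<otimes> r' \<otimes> (a \<otimes> b))"
        using ab q q' c by algebra
      also have "\<dots> \<in> Q"
        using ab q q' c by (meson Q.a_closed Q.I_l_closed m_closed a_closed)
      finally show False using T[OF q(3) q'(3)] Q(3) by auto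
    qed
  qed
  then show ?thesis using that Q by blast
qed

text \<open>
  A prime minimal over \<open>J\<close> consists of zero divisors modulo \<open>J\<close>, so \<open>P\<close>, which contains \<open>f\<close>, is not
  minimal.  Concretely, the products of an element outside \<open>P\<close> and a power of \<open>f\<close> avoid \<open>J\<close>, and a prime
  that avoids all these products lies in \<open>P\<close> and does not contain \<open>f\<close>.
\<close>
lemma (in cring) prime_below_nonzerodivisor:
  assumes noeth: "noetherian_ring R" and J: "ideal J R" and P: "primeideal P R" "J \<subseteq> P" "f \<in> P"
    and nzd: "\<And>g. g \<in> carrier R \<Longrightarrow> f \<otimes> g \<in> J \<Longrightarrow> g \<in> J"
  obtains Q where "primeideal Q R" "J \<subseteq> Q" "Q \<subset> P"
proof -
  interpret P: primeideal P R by fact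
  have f: "f \<in> carrier R" using P P.Icarr by blast
  define T where "T = {s \<otimes> f [^] n | s n. s \<in> carrier R - P \<and> (n::nat) \<in> UNIV}"
  have one: "\<one> \<in> carrier R - P" using P.I_notcarr P.one_imp_carrier by auto
  have nzd_pow: "g \<in> J" if "g \<in> carrier R" "f [^] n \<otimes> g \<in> J" for g and n :: nat
    using that
  proof (induction n)
    case (Suc n)
    have "f [^] Suc n \<otimes> g = f \<otimes> (f [^] n \<otimes> g)" 
      using Suc.prems(1) f by (simp add: m_assoc m_lcomm)
    then have "f \<otimes> (f [^] n \<otimes> g) \<in> J" using Suc.prems(2) by simp
    then have "f [^] n \<otimes> g \<in> J" using nzd[of "f [^] n \<otimes> g"] Suc.prems(1) f by simp
    then show ?case by (rule Suc.IH[OF Suc.prems(1)])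
  qed simp
  obtain Q where Q: "primeideal Q R" "J \<subseteq> Q" "Q \<inter> T = {}"
  proof (rule prime_avoiding_multiplicative_set[OF noeth J, of T])
    show "\<one> \<in> T" unfolding T_def using one by (intro CollectI exI[of _ \<one>] exI[of _ 0]) auto
    show "T \<subseteq> carrier R" unfolding T_def using f by auto
    show "a \<otimes> b \<in> T" if ab: "a \<in> T" "b \<in> T" for a b
    proof -
      obtain s n s' n' where *: "a = s \<otimes> f [^] (n::nat)" "b = s' \<otimes> f [^] (n'::nat)" "s \<in> carrier R - P"
        "s' \<in> carrier R - P" using ab unfolding T_def by blast
      have "a \<otimes> b = (s \<otimes> s') \<otimes> (f [^] n \<otimes> f [^] n')" using * f by (simp add: m_ac)
      also have "(s \<otimes> s') \<otimes> (f [^] n \<otimes> f [^] n') = (s \<otimes> s') \<otimes> f [^] (n + n')" using f by (simp add: nat_pow_mult)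
      finally have "a \<otimes> b = (s \<otimes> s') \<otimes> f [^] (n + n')" .
      moreover have "s \<otimes> s' \<in> carrier R - P" using * P.I_prime by blast
      ultimately show ?thesis unfolding T_def by blast
    qed
    show "J \<inter> T = {}"
    proof (rule ccontr)
      assume "J \<inter> T \<noteq> {}"
      then obtain s n where "s \<in> carrier R - P" "s \<otimes> f [^] (n::nat) \<in> J" unfolding T_def by blast
      then show False using nzd_pow[of s n] f P(2) by (auto simp: m_comm)
    qed
  qed
  have "Q \<subseteq> P"
  proof
    fix x assume x: "x \<in> Q"
    then have "x \<in> carrier R" using ideal.Icarr[OF primeideal.axioms(1)[OF Q(1)]] by blast
    moreover have "x \<otimes> f [^] (0::nat) \<in> T" if "x \<notin> P"
      unfolding T_def using that \<open>x \<in> carrier R\<close> by blast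
    ultimately show "x \<in> P" using x Q(3) by auto
  qed
  moreover have "f \<notin> Q" 
  proof 
    assume "f \<in> Q"
    moreover have "\<one> \<otimes> f [^] (1::nat) \<in> T" unfolding T_def using one by blast
    ultimately show False using Q(3) f by auto
  qed
  ultimately show ?thesis using that Q P by blast
qed

text \<open>
  Starting from \<open>P\<close> and removing the entries of a regular sequence from the last to the first, each
  step produces a strictly smaller prime that contains the remaining entries.
\<close>
theorem (in cring) ideal_depth_le_prime_height:
  assumes noeth: "noetherian_ring R" and P: "primeideal P R"
  shows "ideal_depth R P \<le> prime_height R P"
  unfolding ideal_depth_def
proof (rule Sup_least, clarify)
  fix fs assume fs: "regular_sequence R fs" "set fs \<subseteq> P"
  have fc: "set fs \<subseteq> carrier R" using fs by (simp add: regular_sequence_def)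
  \<comment> \<open>The chain is built downwards: after \<open>n\<close> steps its members with indices
      \<open>length fs - n, \<dots>, length fs\<close> are in place.\<close>
  have *: "\<exists>Q :: nat \<Rightarrow> 'a set. Q (length fs) = P \<and> (\<forall>i\<le>n. primeideal (Q (length fs - i)) R \<and>
      Idl (set (take (length fs - i) fs)) \<subseteq> Q (length fs - i)) \<and> 
      (\<forall>i<n. Q (length fs - Suc i) \<subset> Q (length fs - i))" if "n \<le> length fs" for n
    using that
  proof (induction n)
    case 0
    have "Idl (set fs) \<subseteq> P" using fs P by (simp add: genideal_minimal primeideal.axioms(1))
    then show ?case using P by (intro exI[of _ "\<lambda>_. P"]) auto
  next
    case (Suc n)
    then obtain Q where Q: "Q (length fs) = P" "\<And>i. i \<le> n \<Longrightarrow> primeideal (Q (length fs - i)) R" 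
      "\<And>i. i \<le> n \<Longrightarrow> Idl (set (take (length fs - i) fs)) \<subseteq> Q (length fs - i)"
      "\<And>i. i < n \<Longrightarrow> Q (length fs - Suc i) \<subset> Q (length fs - i)" by auto
    define m where "m = length fs - Suc n"
    have m: "m < length fs" "length fs - n = Suc m" using Suc.prems by (auto simp: m_def)
    have tk: "set (take i fs) \<subseteq> carrier R" for i using fc set_take_subset by fastforce
    obtain Q' where Q': "primeideal Q' R" "Idl (set (take m fs)) \<subseteq> Q'" "Q' \<subset> Q (Suc m)"
    proof (rule prime_below_nonzerodivisor[OF noeth genideal_ideal[OF tk]])
      show "primeideal (Q (Suc m)) R" using Q(2)[of n] m by simp
      have s: "Idl (set (take (Suc m) fs)) \<subseteq> Q (Suc m)" using Q(3)[of n] m by simp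
      have t: "set (take (Suc m) fs) \<subseteq> Idl (set (take (Suc m) fs))" using tk genideal_self by blast
      then show "Idl (set (take m fs)) \<subseteq> Q (Suc m)" 
        using s set_take_subset_set_take[of m "Suc m" fs] genideal_ideal[OF tk]
        by (meson dual_order.trans genideal_minimal le_SucI order_refl)
      show "fs ! m \<in> Q (Suc m)" using s t m by (auto simp: take_Suc_conv_app_nth)
      show "g \<in> Idl (set (take m fs))" if "g \<in> carrier R" "fs ! m \<otimes> g \<in> Idl (set (take m fs))" for g
        using fs(1) that m unfolding regular_sequence_def by blast
    qed blast
    have "length fs - i \<noteq> m" if "i \<le> n" for i using that m by linarith
    moreover have "length fs - Suc i \<noteq> m" if "i < n" for i using that m by linarith
    moreover have "length fs - Suc n = m" by (simp add: m_def)
    ultimately show ?case using Q Q' m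
      by (intro exI[of _ "Q(m := Q')"]) (auto simp: less_Suc_eq le_Suc_eq)
  qed
  obtain Q :: "nat \<Rightarrow> 'a set" where Q: "Q (length fs) = P" 
    "\<And>i. i \<le> length fs \<Longrightarrow> primeideal (Q (length fs - i)) R"
      "\<And>i. i < length fs \<Longrightarrow> Q (length fs - Suc i) \<subset> Q (length fs - i)"
    using *[OF order_refl] by blast
  have "primeideal (Q i) R" if "i \<le> length fs" for i 
    using Q(2)[of "length fs - i"] that by simp
  moreover have "Q i \<subset> Q (Suc i)" if "i < length fs" for i 
    using Q(3)[of "length fs - Suc i"] that by (simp add: Suc_diff_Suc)
  ultimately show "enat (length fs) \<le> prime_height R P"
    unfolding prime_height_def using Q(1) by (intro Sup_upper) blast
qed

section \<open>Ideals of a type-class ring\<close>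

lemma rta_simps [simp]:
  "carrier (ring_of_type_algebra :: 'a::comm_ring_1 ring) = UNIV"
  "x \<otimes>\<^bsub>(ring_of_type_algebra :: 'a ring)\<^esub> y = x * y"
  "x \<oplus>\<^bsub>(ring_of_type_algebra :: 'a ring)\<^esub> y = x + y"
  "\<one>\<^bsub>(ring_of_type_algebra :: 'a ring)\<^esub> = 1"
  "\<zero>\<^bsub>(ring_of_type_algebra :: 'a ring)\<^esub> = 0"
  by (simp_all add: ring_of_type_algebra_def)

lemma cring_rta: "cring (ring_of_type_algebra :: 'a::comm_ring_1 ring)"
  by (rule cring_from_type_algebra)

lemma a_inv_rta [simp]: "\<ominus>\<^bsub>(ring_of_type_algebra :: 'a::comm_ring_1 ring)\<^esub> x = - x"
proof -
  interpret cring "ring_of_type_algebra :: 'a ring" by (rule cring_rta)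
  show ?thesis by (rule minus_equality) auto
qed

lemma ideal_rta_iff:
  "ideal J (ring_of_type_algebra :: 'a::comm_ring_1 ring) \<longleftrightarrow>
    0 \<in> J \<and> (\<forall>a\<in>J. \<forall>b\<in>J. a + b \<in> J) \<and> (\<forall>r. \<forall>a\<in>J. r * a \<in> J)"
proof -
  interpret cring "ring_of_type_algebra :: 'a ring" by (rule cring_rta)
  show ?thesis
  proof
    assume "ideal J (ring_of_type_algebra :: 'a ring)"
    then interpret ideal J "ring_of_type_algebra :: 'a ring" .
    show "0 \<in> J \<and> (\<forall>a\<in>J. \<forall>b\<in>J. a + b \<in> J) \<and> (\<forall>r. \<forall>a\<in>J. r * a \<in> J)"
      using zero_closed a_closed I_l_closed by simp
  next
    assume J: "0 \<in> J \<and> (\<forall>a\<in>J. \<forall>b\<in>J. a + b \<in> J) \<and> (\<forall>r. \<forall>a\<in>J. r * a \<in> J)"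
    have "- a \<in> J" if "a \<in> J" for a using J that by (metis mult_minus1)
    then have "subgroup J (add_monoid (ring_of_type_algebra :: 'a ring))"
      using J by (intro add.subgroupI) (auto simp flip: a_inv_def)
    moreover have "a * r \<in> J" if "a \<in> J" for a r using J that by (metis mult.commute)
    ultimately show "ideal J (ring_of_type_algebra :: 'a ring)"
      using J by (intro idealI ring_axioms) auto
  qed
qed

section \<open>The polynomial ring is Noetherian\<close>
text \<open>
  Dickson's lemma: passing to subsequences one variable at a time makes all exponents weakly
  increasing.
\<close>
lemma dickson:
  fixes u :: "nat \<Rightarrow> ('n::finite \<Rightarrow>\<^sub>0 nat)"
  shows "\<exists>i j w. i < j \<and> u j = u i + w"
proof -
  have *: "\<exists>r :: nat \<Rightarrow> nat. strict_mono r \<and> (\<forall>k\<in>V. mono (\<lambda>n. lookup (u (r n)) k))" if "finite V" for V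
    using that
  proof (induction V rule: finite_induct)
    case empty
    show ?case by (rule exI[of _ id]) (simp add: strict_mono_def)
  next
    case (insert k V)
    then obtain r :: "nat \<Rightarrow> nat" where r: "strict_mono r" "\<forall>k\<in>V. mono (\<lambda>n. lookup (u (r n)) k)" by blast
    obtain s :: "nat \<Rightarrow> nat" where s: "strict_mono s" "monoseq (\<lambda>n. lookup (u (r (s n))) k)"
      using seq_monosub[of "\<lambda>n. lookup (u (r n)) k"] by (auto simp: o_def)
    define c where "c = (\<lambda>n. lookup (u (r (s n))) k)"
    \<comment> \<open>a decreasing sequence of naturals is eventually constant\<close>
    have "\<exists>N. \<forall>m\<ge>N. \<forall>n\<ge>m. c m \<le> c n"
    proof (cases "mono c")
      case True then show ?thesis by (auto simp: mono_def)
    next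
      case False
      then have d: "decseq c" using s(2) by (auto simp: c_def monoseq_iff)
      define v where "v = (LEAST v. v \<in> Set.range c)"
      have "v \<in> Set.range c" unfolding v_def by (rule LeastI[of _ "c 0"]) auto
      then obtain N where N: "v = c N" by auto
      have "c m = v" if "m \<ge> N" for m
        using decseqD[OF d that] N Least_le[of "\<lambda>v. v \<in> Set.range c" "c m"] by (auto simp: v_def)
      then show ?thesis by (auto intro!: exI[of _ N])
    qed
    then obtain N where N: "\<And>m n. N \<le> m \<Longrightarrow> m \<le> n \<Longrightarrow> c m \<le> c n" by blast
    define t where "t = (\<lambda>n. r (s (n + N)))"
    have "strict_mono t" using r(1) s(1) by (auto simp: t_def strict_mono_def)
    moreover have "mono (\<lambda>n. lookup (u (t n)) k)" 
      using N by (auto simp: mono_def t_def c_def)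
    moreover have "mono (\<lambda>n. lookup (u (t n)) l)" if "l \<in> V" for l
      using r(2) that strict_mono_mono[OF s(1)] by (auto simp: mono_def t_def)
    ultimately show ?case by blast
  qed
  obtain r :: "nat \<Rightarrow> nat" where r: "strict_mono r" "\<And>k. mono (\<lambda>n. lookup (u (r n)) k)"
    using *[of UNIV] by auto
  have "u (r 1) = u (r 0) + (u (r 1) - u (r 0))"
    using monoD[OF r(2), of 0 1] by (intro poly_mapping_eqI) (simp add: lookup_add lookup_minus)
  moreover have "r 0 < r 1" using r(1) by (simp add: strict_mono_def)
  ultimately show ?thesis by blast
qed

text \<open>
  The library orders exponent vectors lexicographically.  Together with Dickson's lemma, this
  compatibility with divisibility of monomials makes the order a well-order.
\<close>
lemma exponent_le_add:
  fixes u w :: "'n::{finite,linorder} \<Rightarrow>\<^sub>0 nat"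
  shows "u \<le> u + w"
proof -
  have "0 \<le> w"
  proof (cases "w = 0")
    case False
    then have ne: "keys w \<noteq> {}" by simp
    let ?k = "Min (keys w)"
    have "?k \<in> keys w" using ne by simp
    moreover have "lookup w l = 0" if "l < ?k" for l
      using that by (meson Min_le finite_keys in_keys_iff leD)
    ultimately have "0 < w"
      by (auto simp: less_poly_mapping.rep_eq less_fun_def in_keys_iff intro!: exI[of _ ?k])
    then show ?thesis by simp
  qed simp
  then show ?thesis using add_left_mono[of 0 w u] by simp
qed

lemma wf_exponent_less: "wf {(u, v :: 'n::{finite,linorder} \<Rightarrow>\<^sub>0 nat). u < v}"
proof (rule ccontr)
  assume "\<not> ?thesis"
  then obtain u :: "nat \<Rightarrow> ('n \<Rightarrow>\<^sub>0 nat)" where *: "\<And>i. u (Suc i) < u i"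
    unfolding wf_iff_no_infinite_down_chain by auto
  have d: "u j < u i" if "i < j" for i j
    using that by (induction j) (use * in \<open>auto simp: less_Suc_eq intro: less_trans\<close>)
  obtain i j w where "i < j" "u j = u i + w" using dickson[of u] by blast
  then show False using d[of i j] exponent_le_add[of "u i" w] by simp
qed

definition lead_exp :: "(('n::{finite,linorder} \<Rightarrow>\<^sub>0 nat) \<Rightarrow>\<^sub>0 'k::zero) \<Rightarrow> ('n \<Rightarrow>\<^sub>0 nat)" where
  "lead_exp p = Max (keys p)"

lemma lookup_single_times:
  fixes p :: "('n \<Rightarrow>\<^sub>0 nat) \<Rightarrow>\<^sub>0 'k::comm_semiring_1"
  shows "lookup (mterm w c * p) (w + u) = c * lookup p u"
  by (simp add: lookup_mult lookup_single when_mult mult_when)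

lemma cancel_lead_term:
  fixes f g :: "('n::{finite,linorder} \<Rightarrow>\<^sub>0 nat) \<Rightarrow>\<^sub>0 'k::field"
  assumes f: "f \<noteq> 0" and g: "g \<noteq> 0" and w: "lead_exp g = lead_exp f + w"
  shows "\<exists>r. g - r * f = 0 \<or> lead_exp (g - r * f) < lead_exp g"
proof -
  let ?u = "lead_exp f" and ?v = "lead_exp g"
  define c where "c = lookup g ?v / lookup f ?u"
  define h where "h = g - mterm w c * f"
  have ku: "?u \<in> keys f" "?v \<in> keys g" using f g by (auto simp: lead_exp_def)
  then have "lookup h ?v = 0"
    using w lookup_single_times[of w c f ?u] by (simp add: h_def c_def lookup_minus in_keys_iff add.commute)
  moreover have "x \<le> ?v" if "x \<in> keys h" for x
  proof -
    have "x \<in> keys g \<or> x \<in> keys (mterm w c * f)"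
      using that by (auto simp: h_def in_keys_iff lookup_minus)
    then consider "x \<in> keys g" | y where "y \<in> keys f" "x = w + y"
      using keys_mult[of "mterm w c" f] by (auto split: if_splits)
    then show ?thesis
    proof cases
      case 1 then show ?thesis by (simp add: lead_exp_def)
    next
      case 2
      then have "y \<le> ?u" by (simp add: lead_exp_def)
      then show ?thesis using 2 w by (simp add: add.commute add_left_mono)
    qed
  qed
  ultimately have "lead_exp h < ?v" if "h \<noteq> 0"
  proof -
    have "lead_exp h \<in> keys h" using that by (simp add: lead_exp_def)
    then show ?thesis using \<open>\<And>x. x \<in> keys h \<Longrightarrow> x \<le> ?v\<close> \<open>lookup h ?v = 0\<close>
      by (metis in_keys_iff order_le_less)
  qed
  then show ?thesis unfolding h_def by blast
qed

text \<open>
  Hilbert's basis theorem, by leading monomials.  If an ideal is not finitely generated, choose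
  successively an element outside the ideal generated by the previous ones, with the smallest possible
  leading exponent.  By Dickson's lemma one leading monomial divides a later one; cancelling it gives an
  element outside with a smaller leading exponent.
\<close>
theorem noetherian_polynomials:
  "noetherian_ring (ring_of_type_algebra :: (('n::{finite,linorder} \<Rightarrow>\<^sub>0 nat) \<Rightarrow>\<^sub>0 'k::field) ring)"
    (is "noetherian_ring ?R")
proof -
  interpret cring ?R by (rule cring_rta)
  show ?thesis
  proof (rule noetherian_ringI, rule ccontr)
    fix J assume J: "ideal J ?R" and "\<not> (\<exists>A\<subseteq>carrier ?R. finite A \<and> J = Idl\<^bsub>?R\<^esub> A)"
    then have nfg: "J \<noteq> Idl\<^bsub>?R\<^esub> A" if "finite A" for A using that by auto
    interpret J: ideal J ?R by fact
    define good where "good A h \<longleftrightarrow> h \<in> J - Idl\<^bsub>?R\<^esub> A \<and> 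
        (\<forall>h'\<in>J - Idl\<^bsub>?R\<^esub> A. \<not> lead_exp h' < lead_exp h)" for A h
    have ex: "\<exists>h. good A h" if A: "finite A" "A \<subseteq> J" for A
    proof -
      have "Idl\<^bsub>?R\<^esub> A \<subseteq> J" using A J by (simp add: genideal_minimal)
      then obtain h0 where "h0 \<in> J - Idl\<^bsub>?R\<^esub> A" using nfg[OF A(1)] by blast
      then show ?thesis
        using wfE_min[OF wf_inv_image[OF wf_exponent_less, of lead_exp], of h0 "J - Idl\<^bsub>?R\<^esub> A"] 
        unfolding good_def by (metis (mono_tags, lifting) case_prodI in_inv_image mem_Collect_eq)
    qed
    define nxt where "nxt A = (SOME h. good A h)" for A
    define S where "S = rec_nat {} (\<lambda>_ A. insert (nxt A) A)"
    have S0: "S 0 = {}" and SS: "S (Suc n) = insert (nxt (S n)) (S n)" for n by (simp_all add: S_def)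
    have S: "finite (S n) \<and> S n \<subseteq> J \<and> good (S n) (nxt (S n))" for n
    proof (induction n)
      case 0
      show ?case using someI_ex[OF ex[of "{}"]] by (simp add: S0 nxt_def)
    next
      case (Suc n)
      then have *: "finite (S (Suc n))" "S (Suc n) \<subseteq> J" by (auto simp: SS good_def)
      then show ?case using someI_ex[OF ex[OF *]] by (simp add: nxt_def)
    qed
    have S_mono: "S i \<subseteq> S j" if "i \<le> j" for i j
      using that by (rule lift_Suc_mono_le[rotated]) (auto simp: SS)
    let ?f = "\<lambda>n. nxt (S n)"
    obtain i j w where ij: "i < j" "lead_exp (?f j) = lead_exp (?f i) + w"
      using dickson[of "\<lambda>n. lead_exp (?f n)"] by blast
    have gI: "ideal (Idl\<^bsub>?R\<^esub> (S n)) ?R" for n by (rule genideal_ideal) simp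
    have nz: "?f n \<noteq> 0" for n
      using S[of n] gI[of n] unfolding good_def ideal_rta_iff by auto
    obtain r where r: "?f j - r * ?f i = 0 \<or> lead_exp (?f j - r * ?f i) < lead_exp (?f j)"
      using cancel_lead_term[OF nz nz ij(2)] by blast
    have fi: "?f i \<in> Idl\<^bsub>?R\<^esub> (S j)"
      using S_mono[of "Suc i" j] ij(1) genideal_self[of "S j"] by (auto simp: SS)
    have "?f i \<in> J" "?f j \<in> J" using S by (auto simp: good_def)
    then have "?f j + (- r) * ?f i \<in> J" using J unfolding ideal_rta_iff by blast
    moreover have "?f j - r * ?f i \<notin> Idl\<^bsub>?R\<^esub> (S j)"
    proof
      assume "?f j - r * ?f i \<in> Idl\<^bsub>?R\<^esub> (S j)"
      then have "(?f j - r * ?f i) + r * ?f i \<in> Idl\<^bsub>?R\<^esub> (S j)"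
        using fi gI[of j] unfolding ideal_rta_iff by blast
      then show False using S[of j] by (simp add: good_def)
    qed
    moreover have "0 \<in> Idl\<^bsub>?R\<^esub> (S j)" using gI[of j] unfolding ideal_rta_iff by blast
    ultimately show False using S[of j] r unfolding good_def by auto
  qed
qed

lemma noetherian_quotient:
  assumes "noetherian_ring R" "ideal I R"
  shows "noetherian_ring (R Quot I)"
proof -
  interpret R: noetherian_ring R by fact
  interpret I: ideal I R by fact
  interpret Q: ring "R Quot I" by (rule I.quotient_is_ring)
  interpret h: ring_hom_ring R "R Quot I" "(+>\<^bsub>R\<^esub>) I" by (rule I.rcos_ring_hom_ring)
  show ?thesis
  proof (rule Q.noetherian_ringI)
    fix J assume J: "ideal J (R Quot I)"
    obtain A where A: "A \<subseteq> carrier R" "finite A" "\<Union>J = Idl\<^bsub>R\<^esub> A"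
      using R.finetely_gen[OF R.quot_ideal_imp_ring_ideal[OF assms(2) J]] by metis
    let ?B = "(+>\<^bsub>R\<^esub>) I ` A"
    have B: "?B \<subseteq> carrier (R Quot I)" using A(1) h.hom_closed by blast
    have Jc: "J \<subseteq> carrier (R Quot I)" using ideal.Icarr[OF J] by auto
    note mem = R.canonical_proj_vimage_mem_iff[OF assms(2) Jc]
    note sub = R.canonical_proj_vimage_in_carrier[OF assms(2) Jc]
    have img: "(+>\<^bsub>R\<^esub>) I ` \<Union>J = J"
    proof
      show "(+>\<^bsub>R\<^esub>) I ` \<Union>J \<subseteq> J"
      proof (rule image_subsetI)
        fix r assume r: "r \<in> \<Union>J"
        show "I +>\<^bsub>R\<^esub> r \<in> J" by (rule iffD1[OF mem[OF subsetD[OF sub r]] r])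
      qed
      show "J \<subseteq> (+>\<^bsub>R\<^esub>) I ` \<Union>J"
      proof
        fix x assume x: "x \<in> J"
        then obtain r where "r \<in> carrier R" "x = I +>\<^bsub>R\<^esub> r"
          using subsetD[OF Jc x] unfolding FactRing_def A_RCOSETS_def'[of R I] by auto
        then show "x \<in> (+>\<^bsub>R\<^esub>) I ` \<Union>J" using iffD2[OF mem[of r]] x by (intro image_eqI[of _ _ r]) simp_all
      qed
    qed
    have "A \<subseteq> \<Union>J" unfolding A(3) by (rule R.genideal_self[OF A(1)])
    then have "?B \<subseteq> (+>\<^bsub>R\<^esub>) I ` \<Union>J" by (rule image_mono)
    then have "?B \<subseteq> J" unfolding img .
    then have 1: "Idl\<^bsub>R Quot I\<^esub> ?B \<subseteq> J" by (rule Q.genideal_minimal[OF J])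
    have "A \<subseteq> {r \<in> carrier R. I +>\<^bsub>R\<^esub> r \<in> Idl\<^bsub>R Quot I\<^esub> ?B}"
      using A(1) Q.genideal_self[OF B] by (auto simp: image_subset_iff)
    then have "\<Union>J \<subseteq> {r \<in> carrier R. I +>\<^bsub>R\<^esub> r \<in> Idl\<^bsub>R Quot I\<^esub> ?B}"
      unfolding A(3) by (intro R.genideal_minimal h.ideal_vimage Q.genideal_ideal B)
    then have "(+>\<^bsub>R\<^esub>) I ` \<Union>J \<subseteq> Idl\<^bsub>R Quot I\<^esub> ?B" by (intro image_subsetI) auto
    then have "J \<subseteq> Idl\<^bsub>R Quot I\<^esub> ?B" unfolding img .
    then show "\<exists>A\<subseteq>carrier (R Quot I). finite A \<and> J = Idl\<^bsub>R Quot I\<^esub> A"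
      using 1 A(2) B by (intro exI[of _ ?B]) auto
  qed
qed

section \<open>Monomial ideals and homogeneous parts\<close>

lemma poly_mapping_eq_sum_monom: "p = (\<Sum>u\<in>keys p. mterm u (lookup p u))"
  by (rule poly_mapping_eqI) (simp add: lookup_sum lookup_single when_def in_keys_iff)

lemma additive_closed_by_monomials:
  fixes p :: "'b \<Rightarrow>\<^sub>0 'a::comm_monoid_add"
  assumes "0 \<in> J" "\<And>p q. p \<in> J \<Longrightarrow> q \<in> J \<Longrightarrow> p + q \<in> J"
    and "\<And>u. u \<in> keys p \<Longrightarrow> mterm u (lookup p u) \<in> J"
  shows "p \<in> J"
proof -
  have "(\<Sum>u\<in>S. mterm u (lookup p u)) \<in> J" if "finite S" "S \<subseteq> keys p" for S
    using that
  proof (induction S rule: finite_induct)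
    case (insert u S)
    then show ?case using assms(2)[OF assms(3)[of u]] by simp
  qed (simp add: assms(1))
  from this[of "keys p"] show ?thesis by (simp flip: poly_mapping_eq_sum_monom)
qed

text \<open>
  The part of \<open>p\<close> supported on the exponents in \<open>H\<close>.  With \<open>H = {u. deg_in V u = 0}\<close> it is the
  substitution of 0 for the variables in \<open>V\<close>.
\<close>
definition restr :: "'b set \<Rightarrow> ('b \<Rightarrow>\<^sub>0 'a::comm_monoid_add) \<Rightarrow> ('b \<Rightarrow>\<^sub>0 'a)" where
  "restr H p = (\<Sum>u\<in>keys p \<inter> H. mterm u (lookup p u))"

lemma lookup_restr: "lookup (restr H p) u = (lookup p u when u \<in> H)"
  by (simp add: restr_def lookup_sum lookup_single when_def in_keys_iff)

lemma keys_restr [simp]: "keys (restr H p) = keys p \<inter> H"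
  by (auto simp: in_keys_iff lookup_restr)

lemma restr_add: "restr H (p + q) = restr H p + restr H q"
  by (rule poly_mapping_eqI) (simp add: lookup_restr lookup_add when_add_distrib)

lemma restr_diff: "restr H (p - q) = restr H p - restr H (q :: 'b \<Rightarrow>\<^sub>0 'a::ab_group_add)"
  by (rule poly_mapping_eqI) (simp add: lookup_restr lookup_minus when_diff_distrib)

lemma restr_zero [simp]: "restr H 0 = 0"
  by (rule poly_mapping_eqI) (simp add: lookup_restr)

lemma restr_eq_self: "keys p \<subseteq> H \<Longrightarrow> restr H p = p"
  by (rule poly_mapping_eqI) (auto simp: lookup_restr when_def in_keys_iff)

lemma restr_eq_0: "keys p \<inter> H = {} \<Longrightarrow> restr H p = 0"
  by (rule poly_mapping_eqI) (auto simp: lookup_restr when_def in_keys_iff)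

lemma restr_split: "restr H p + restr (- H) p = p"
  by (rule poly_mapping_eqI) (auto simp: lookup_restr lookup_add when_def)

definition monomial_ideal :: "'b set \<Rightarrow> ('b \<Rightarrow>\<^sub>0 'a::zero) set" where
  "monomial_ideal H = {p. keys p \<subseteq> H}"

definition up_closed :: "'b::monoid_add set \<Rightarrow> bool" where
  "up_closed H \<longleftrightarrow> (\<forall>u\<in>H. \<forall>w. u + w \<in> H)"

lemma monomial_ideal_0 [simp]: "0 \<in> monomial_ideal H"
  by (simp add: monomial_ideal_def)

lemma monomial_ideal_add: "p \<in> monomial_ideal H \<Longrightarrow> q \<in> monomial_ideal H \<Longrightarrow> p + q \<in> monomial_ideal H"
  using keys_add[of p q] by (auto simp: monomial_ideal_def)

lemma monomial_ideal_diff: 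
  "p \<in> monomial_ideal H \<Longrightarrow> q \<in> monomial_ideal H \<Longrightarrow> p - (q::'b \<Rightarrow>\<^sub>0 'a::ab_group_add) \<in> monomial_ideal H"
  by (simp add: monomial_ideal_def in_keys_iff lookup_minus subset_iff) (metis diff_zero)

lemma monomial_ideal_mult:
  fixes p q :: "'b::comm_monoid_add \<Rightarrow>\<^sub>0 'k::comm_semiring_0"
  assumes "up_closed H" "q \<in> monomial_ideal H"
  shows "p * q \<in> monomial_ideal H"
  unfolding monomial_ideal_def
proof (clarify)
  fix u assume "u \<in> keys (p * q)"
  then obtain a b where "u = a + b" "b \<in> keys q" using keys_mult[of p q] by blast
  moreover have "b \<in> H" using assms(2) calculation by (auto simp: monomial_ideal_def)
  ultimately show "u \<in> H" using assms(1) by (metis up_closed_def add.commute)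
qed

lemma ideal_monomial_ideal:
  assumes "up_closed H"
  shows "ideal (monomial_ideal H :: ('b::comm_monoid_add \<Rightarrow>\<^sub>0 'k::comm_ring_1) set) ring_of_type_algebra"
  unfolding ideal_rta_iff using assms by (auto intro: monomial_ideal_add monomial_ideal_mult)

lemma keys_multE:
  assumes "u \<in> keys (p * q)"
  obtains a b where "u = a + b" "a \<in> keys p" "b \<in> keys q"
  using assms keys_mult[of p q] by blast

text \<open>
  Weights are integers rather than naturals, so that the leading part for a weight is the lowest part for
  its negative.
\<close>
definition weight :: "('b::monoid_add \<Rightarrow> int) \<Rightarrow> bool" where
  "weight \<omega> \<longleftrightarrow> (\<forall>u v. \<omega> (u + v) = \<omega> u + \<omega> v)"

lemma homogeneous_times_part:
  fixes p q :: "'b::comm_monoid_add \<Rightarrow>\<^sub>0 'k::comm_ring_1"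
  assumes w: "weight \<omega>" and p: "\<And>u. u \<in> keys p \<Longrightarrow> \<omega> u = r"
  shows "restr {u. \<omega> u = r + s} (p * q) = p * restr {u. \<omega> u = s} q"
proof -
  let ?S = "{u. \<omega> u = s}"
  have "p * q = p * restr ?S q + p * restr (- ?S) q"
    by (simp add: restr_split flip: distrib_left)
  moreover have "restr {u. \<omega> u = r + s} (p * restr ?S q) = p * restr ?S q"
  proof (rule restr_eq_self, rule subsetI)
    fix u assume "u \<in> keys (p * restr ?S q)"
    then obtain a b where "u = a + b" "a \<in> keys p" "b \<in> keys (restr ?S q)" by (rule keys_multE)
    then show "u \<in> {u. \<omega> u = r + s}" using w p[of a] by (simp add: weight_def)
  qed
  moreover have "restr {u. \<omega> u = r + s} (p * restr (- ?S) q) = 0"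
  proof (rule restr_eq_0, rule equals0I)
    fix u assume u: "u \<in> keys (p * restr (- ?S) q) \<inter> {u. \<omega> u = r + s}"
    then obtain a b where "u = a + b" "a \<in> keys p" "b \<in> keys (restr (- ?S) q)" 
      by (auto elim: keys_multE)
    then show False using w p[of a] u by (simp add: weight_def)
  qed
  ultimately show ?thesis by (simp add: restr_add)
qed

lemma lowest_part_times:
  fixes p q :: "'b::comm_monoid_add \<Rightarrow>\<^sub>0 'k::comm_ring_1"
  assumes w: "weight \<omega>" and p: "\<And>u. u \<in> keys p \<Longrightarrow> r \<le> \<omega> u" and q: "\<And>u. u \<in> keys q \<Longrightarrow> s \<le> \<omega> u"
  shows "restr {u. \<omega> u = r + s} (p * q) = restr {u. \<omega> u = r} p * restr {u. \<omega> u = s} q"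
proof -
  let ?S = "{u. \<omega> u = r}"
  have "p * q = restr ?S p * q + restr (- ?S) p * q"
    by (simp add: restr_split flip: distrib_right)
  moreover have "restr {u. \<omega> u = r + s} (restr ?S p * q) = restr ?S p * restr {u. \<omega> u = s} q"
    by (rule homogeneous_times_part[OF w]) auto
  moreover have "restr {u. \<omega> u = r + s} (restr (- ?S) p * q) = 0"
  proof (rule restr_eq_0, rule equals0I)
    fix u assume u: "u \<in> keys (restr (- ?S) p * q) \<inter> {u. \<omega> u = r + s}"
    then obtain a b where "u = a + b" "a \<in> keys (restr (- ?S) p)" "b \<in> keys q" 
      by (auto elim: keys_multE)
    then show False using w p[of a] q[of b] u by (simp add: weight_def)
  qed
  ultimately show ?thesis by (simp add: restr_add)
qed

definition deg_in :: "'n::finite set \<Rightarrow> ('n \<Rightarrow>\<^sub>0 nat) \<Rightarrow> nat" where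
  "deg_in V u = (\<Sum>k\<in>V. lookup u k)"

lemma deg_in_add [simp]: "deg_in V (u + v) = deg_in V u + deg_in V v"
  by (simp add: deg_in_def lookup_add sum.distrib)

lemma deg_in_zero [simp]: "deg_in V 0 = 0"
  by (simp add: deg_in_def)

lemma weight_deg_in: "weight (\<lambda>u. int (deg_in V u))"
  by (simp add: weight_def)

lemma deg_in_pair: "i \<noteq> j \<Longrightarrow> deg_in {i, j} u = lookup u i + lookup u j"
  by (simp add: deg_in_def)

lemma up_closed_deg_in: "up_closed {u. a \<le> deg_in V u}"
  by (auto simp: up_closed_def)

lemma lowest_deg_in_times:
  fixes p q :: "('n::finite \<Rightarrow>\<^sub>0 nat) \<Rightarrow>\<^sub>0 'k::comm_ring_1"
  assumes "p \<in> monomial_ideal {u. r \<le> deg_in V u}" "q \<in> monomial_ideal {u. s \<le> deg_in V u}"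
  shows "restr {u. deg_in V u = r + s} (p * q) = restr {u. deg_in V u = r} p * restr {u. deg_in V u = s} q"
  using lowest_part_times[OF weight_deg_in, of p "int r" V q "int s"] assms
  by (auto simp: monomial_ideal_def simp flip: of_nat_add)

section \<open>Powers of the ideal of a line\<close>

lemma line_power_Suc:
  "line_power i j (Suc a) = ideal_prod poly4_ring (line_power i j a) (Idl\<^bsub>poly4_ring\<^esub> {pvar i, pvar j})"
  by (simp add: line_power_def nat_pow_def ideals_set_def)

lemma split_off_variable:
  fixes u :: "'n \<Rightarrow>\<^sub>0 nat"
  assumes "0 < lookup u k"
  obtains v where "u = v + mterm k 1"
proof
  show "u = (u - mterm k 1) + mterm k 1"
    using assms by (intro poly_mapping_eqI) (auto simp: lookup_add lookup_minus lookup_single when_def)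
qed

text \<open>
  A monomial of degree at least \<open>Suc a\<close> in the two variables is divisible by one of them, and the
  quotient has degree at least \<open>a\<close>.
\<close>
lemma line_power_eq:
  assumes "i \<noteq> j"
  shows "(line_power i j a :: 'k::field poly4 set) = monomial_ideal {u. a \<le> deg_in {i, j} u}"
proof (induction a)
  case 0
  show ?case by (simp add: line_power_def nat_pow_def ideals_set_def monomial_ideal_def)
next
  case (Suc a)
  let ?R = "poly4_ring :: 'k poly4 ring"
  let ?G = "Idl\<^bsub>?R\<^esub> {pvar i, pvar j}"
  let ?M = "\<lambda>a. monomial_ideal {u. a \<le> deg_in {i, j} u} :: 'k poly4 set"
  interpret cring ?R by (rule cring_rta)
  have M: "ideal (?M a) ?R" for a by (rule ideal_monomial_ideal[OF up_closed_deg_in])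
  have G: "ideal ?G ?R" by (rule genideal_ideal) simp
  have gens: "pvar i \<in> ?G" "pvar j \<in> ?G" using genideal_self[of "{pvar i, pvar j}"] by auto
  have GM: "?G \<subseteq> ?M 1"
    using assms by (intro genideal_minimal M) 
      (auto simp: monomial_ideal_def pvar_def deg_in_pair lookup_single when_def)
  have "ideal_prod ?R (?M a) ?G = ?M (Suc a)"
  proof (intro equalityI subsetI)
    fix p assume "p \<in> ideal_prod ?R (?M a) ?G"
    then show "p \<in> ?M (Suc a)"
    proof induction
      case (prod p q)
      then have "q \<in> ?M 1" using GM by auto
      show ?case unfolding monomial_ideal_def
      proof clarify
        fix u assume "u \<in> keys (p \<otimes>\<^bsub>?R\<^esub> q)"
        then obtain v w where "u = v + w" "v \<in> keys p" "w \<in> keys q" using keys_mult[of p q] by auto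
        moreover have "a \<le> deg_in {i, j} v" "1 \<le> deg_in {i, j} w"
          using prod \<open>q \<in> ?M 1\<close> calculation by (auto simp: monomial_ideal_def)
        ultimately show "Suc a \<le> deg_in {i, j} u" by simp
      qed
    next
      case (sum p q)
      then show ?case by (simp add: monomial_ideal_add)
    qed
  next
    fix p assume p: "p \<in> ?M (Suc a)"
    have I: "ideal (ideal_prod ?R (?M a) ?G) ?R" by (rule ideal_prod_is_ideal[OF M G])
    show "p \<in> ideal_prod ?R (?M a) ?G"
    proof (rule additive_closed_by_monomials)
      show "0 \<in> ideal_prod ?R (?M a) ?G" using I unfolding ideal_rta_iff by blast
      show "p + q \<in> ideal_prod ?R (?M a) ?G" 
        if "p \<in> ideal_prod ?R (?M a) ?G" "q \<in> ideal_prod ?R (?M a) ?G" for p q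
        using I that unfolding ideal_rta_iff by blast
      fix u assume "u \<in> keys p"
      then have u: "Suc a \<le> lookup u i + lookup u j"
        using p assms by (auto simp: monomial_ideal_def deg_in_pair)
      then have "0 < lookup u i \<or> 0 < lookup u j" by linarith
      then obtain k where k: "k \<in> {i, j}" "0 < lookup u k" by blast
      obtain v where v: "u = v + mterm k 1" using split_off_variable[OF k(2)] .
      have "mterm v (lookup p u) \<in> ?M a"
        using u k assms by (auto simp: v monomial_ideal_def deg_in_pair lookup_add lookup_single when_def)
      then have "mterm v (lookup p u) \<otimes>\<^bsub>?R\<^esub> pvar k \<in> ideal_prod ?R (?M a) ?G"
        using gens k by (intro ideal_prod.prod) auto
      then show "mterm u (lookup p u) \<in> ideal_prod ?R (?M a) ?G"
        by (simp add: v pvar_def mult_single)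
    qed
  qed
  then show ?case using Suc line_power_Suc by metis
qed

section \<open>Regular sequences modulo monomial ideals\<close>

text \<open>
  If membership in the monomial ideal depends only on the exponents of the variables in \<open>V\<close>, the quotient is
  a free module over the polynomials in the other variables.  So \<open>f\<close> is a non-zero-divisor as soon
  as its value at \<open>V = 0\<close> is nonzero: among the monomials of \<open>u\<close> outside the ideal, those of the lowest
  degree in \<open>V\<close> cannot cancel in \<open>f * u\<close>.
\<close>
lemma nonzerodivisor_mod_monomial_ideal:
  fixes f u :: "('n::{finite,linorder} \<Rightarrow>\<^sub>0 nat) \<Rightarrow>\<^sub>0 'k::field"
  assumes H: "up_closed H" and V: "\<And>u w. deg_in V w = 0 \<Longrightarrow> u + w \<in> H \<Longrightarrow> u \<in> H"
    and f: "restr {u. deg_in V u = 0} f \<noteq> 0" and fu: "f * u \<in> monomial_ideal H"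
  shows "u \<in> monomial_ideal H"
proof (rule ccontr)
  assume u: "u \<notin> monomial_ideal H"
  define b where "b = restr (- H) u"
  have kb: "keys b \<noteq> {}" using u by (auto simp: b_def monomial_ideal_def)
  define r where "r = Min (deg_in V ` keys b)"
  have "f * u = f * (restr H u + b)" by (simp add: b_def restr_split)
  then have "f * b = f * u - f * restr H u" by (simp add: distrib_left)
  also have "\<dots> \<in> monomial_ideal H"
    by (intro monomial_ideal_diff fu monomial_ideal_mult[OF H]) (simp add: monomial_ideal_def)
  finally have fb: "keys (f * b) \<subseteq> H" by (simp add: monomial_ideal_def)
  define f0 where "f0 = restr {u. deg_in V u = 0} f"
  define br where "br = restr {u. deg_in V u = r} b"
  have "b \<in> monomial_ideal {u. r \<le> deg_in V u}"
    by (auto simp: monomial_ideal_def r_def)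
  then have *: "restr {u. deg_in V u = r} (f * b) = f0 * br"
    using lowest_deg_in_times[of f 0 V b r] by (simp add: monomial_ideal_def f0_def br_def)
  have "r \<in> deg_in V ` keys b" unfolding r_def using kb by (intro Min_in) auto
  then have "keys br \<noteq> {}" by (auto simp: br_def)
  then have "br \<noteq> 0" by auto
  then have "f0 * br \<noteq> 0" using f by (simp add: f0_def)
  then obtain x where x: "x \<in> keys (f0 * br)" by fastforce
  then have "x \<in> keys (f * b)" using * by (metis IntD1 keys_restr)
  then have "x \<in> H" using fb by auto
  obtain w v where wv: "x = w + v" "w \<in> keys f0" "v \<in> keys br"
    using x by (rule keys_multE)
  then have "v + w \<in> H" "deg_in V w = 0" using \<open>x \<in> H\<close> by (simp_all add: f0_def add.commute)
  then have "v \<in> H" using V by blast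
  then show False using wv(3) by (simp add: br_def b_def)
qed

text \<open>
  The quotient by the power of \<open>(V)\<close> is filtered by degree in \<open>V\<close>, and each graded piece is a free module
  over the polynomials in the other variables.  So regularity at \<open>V = 0\<close> lifts degree by degree: the lowest
  part of the remaining error is a multiple of \<open>f0\<close> and can be removed.
\<close>
lemma regular_pair_mod_power:
  fixes f g :: "('n::{finite,linorder} \<Rightarrow>\<^sub>0 nat) \<Rightarrow>\<^sub>0 'k::field" and V :: "'n set"
  defines "f0 \<equiv> restr {u. deg_in V u = 0} f" and "g0 \<equiv> restr {u. deg_in V u = 0} g"
  assumes f0: "f0 \<noteq> 0" and reg: "\<And>u v. g0 * u = f0 * v \<Longrightarrow> f0 dvd u"
    and gu: "g * u - f * v \<in> monomial_ideal {u. a \<le> deg_in V u}"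
  shows "\<exists>w. u - f * w \<in> monomial_ideal {u. a \<le> deg_in V u}"
proof -
  let ?M = "\<lambda>r. monomial_ideal {u. r \<le> deg_in V u} :: (('n \<Rightarrow>\<^sub>0 nat) \<Rightarrow>\<^sub>0 'k) set"
  have up: "up_closed {u :: 'n \<Rightarrow>\<^sub>0 nat. r \<le> deg_in V u}" for r by (rule up_closed_deg_in)
  have "\<exists>w. u - f * w \<in> ?M r" if "r \<le> a" for r
    using that
  proof (induction r)
    case 0
    show ?case by (simp add: monomial_ideal_def)
  next
    case (Suc r)
    then obtain w where w: "u - f * w \<in> ?M r" by auto
    define u' where "u' = u - f * w"
    define v' where "v' = v - g * w"
    define j where "j = g * u' - f * v'"
    have "j = g * u - f * v" by (simp add: j_def u'_def v'_def algebra_simps)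
    then have j: "j \<in> ?M a" using gu by simp
    have u': "u' \<in> ?M r" using w by (simp add: u'_def)
    have fv: "f * v' = g * u' - j" by (simp add: j_def)
    have "j \<in> ?M r" using j Suc.prems by (auto simp: monomial_ideal_def)
    then have "f * v' \<in> ?M r"
      unfolding fv by (intro monomial_ideal_diff monomial_ideal_mult[OF up u'])
    then have v': "v' \<in> ?M r"
      by (rule nonzerodivisor_mod_monomial_ideal[OF up, where f = f and V = V, rotated 2]) 
        (use f0 in \<open>simp_all add: f0_def\<close>)
    let ?D = "\<lambda>r. {u :: 'n \<Rightarrow>\<^sub>0 nat. deg_in V u = r}"
    have "restr (?D r) (g * u') = g0 * restr (?D r) u'" "restr (?D r) (f * v') = f0 * restr (?D r) v'"
      using lowest_deg_in_times[of g 0 V u' r] u' lowest_deg_in_times[of f 0 V v' r] v' 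
      by (simp_all add: g0_def f0_def monomial_ideal_def)
    moreover have "restr (?D r) j = 0"
      using j Suc.prems by (intro restr_eq_0) (auto simp: monomial_ideal_def)
    ultimately have "g0 * restr (?D r) u' = f0 * restr (?D r) v'"
      by (simp add: j_def restr_diff)
    then obtain t where t: "restr (?D r) u' = f0 * t" using reg by (meson dvdE)
    \<comment> \<open>As \<open>f0\<close> has degree 0 in \<open>V\<close>, the cofactor may be replaced by its part of degree \<open>r\<close>.\<close>
    define s where "s = restr (?D r) t"
    have "restr {u. int (deg_in V u) = 0 + int r} (f0 * t) = f0 * restr {u. int (deg_in V u) = int r} t"
      by (rule homogeneous_times_part[OF weight_deg_in]) (simp add: f0_def)
    then have fs: "restr (?D r) u' = f0 * s"
      unfolding t[symmetric] s_def by (simp add: restr_eq_self)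
    have "u - f * (w + s) = (u' - restr (?D r) u') - (f - f0) * s"
      unfolding fs by (simp add: u'_def algebra_simps)
    also have "\<dots> \<in> ?M (Suc r)"
    proof (rule monomial_ideal_diff)
      show "u' - restr (?D r) u' \<in> ?M (Suc r)"
      proof -
        have "u' - restr (?D r) u' = restr (- ?D r) u'"
          by (metis restr_split add_diff_cancel_left')
        moreover have "Suc r \<le> deg_in V x" if "x \<in> keys (restr (- ?D r) u')" for x
        proof -
          have "deg_in V x \<noteq> r" "r \<le> deg_in V x" using that u' by (auto simp: monomial_ideal_def)
          then show ?thesis by simp
        qed
        ultimately show ?thesis by (simp add: monomial_ideal_def subset_iff)
      qed
      show "(f - f0) * s \<in> ?M (Suc r)"
        unfolding monomial_ideal_def
      proof clarify
        fix x assume "x \<in> keys ((f - f0) * s)"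
        then obtain y z where yz: "x = y + z" "y \<in> keys (f - f0)" "z \<in> keys s" by (rule keys_multE)
        have "deg_in V y \<noteq> 0"
          using yz(2) by (intro notI) (simp add: f0_def in_keys_iff lookup_minus lookup_restr)
        then show "Suc r \<le> deg_in V x" using yz(1,3) by (simp add: s_def)
      qed
    qed
    finally show ?case by blast
  qed
  then show ?thesis by blast
qed

section \<open>A regular pair made of univariate polynomials\<close>

definition univariate :: "'n \<Rightarrow> (('n \<Rightarrow>\<^sub>0 nat) \<Rightarrow>\<^sub>0 'k::zero) \<Rightarrow> bool" where
  "univariate l z \<longleftrightarrow> (\<forall>u\<in>keys z. \<exists>n. u = mterm l n)"

lemma deg_in_mterm: "deg_in V (mterm k n) = (if k \<in> V then n else 0)"
  by (simp add: deg_in_def lookup_single when_def)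

lemma in_keys_nonzero: "u \<in> keys p \<Longrightarrow> p \<noteq> 0"
  by auto

lemma nonzero_obtains_key:
  assumes "p \<noteq> 0"
  obtains u where "u \<in> keys p"
proof -
  have "\<exists>u. lookup p u \<noteq> 0" using assms by (metis lookup_zero poly_mapping_eqI)
  then show ?thesis using that by (auto simp: in_keys_iff)
qed

lemma univariate_division:
  fixes z v :: "('n::{finite,linorder} \<Rightarrow>\<^sub>0 nat) \<Rightarrow>\<^sub>0 'k::field"
  assumes z: "univariate l z" "z \<noteq> 0"
  shows "\<exists>q. \<forall>u\<in>keys (v - z * q). deg_in {l} u < Max (deg_in {l} ` keys z)"
proof -
  define d where "d = Max (deg_in {l} ` keys z)"
  define D where "D = {v :: ('n \<Rightarrow>\<^sub>0 nat) \<Rightarrow>\<^sub>0 'k. \<exists>q. \<forall>u\<in>keys (v - z * q). deg_in {l} u < d}"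
  have D0: "0 \<in> D" unfolding D_def by (auto intro!: exI[of _ 0])
  have Dadd: "v + w \<in> D" if vw: "v \<in> D" "w \<in> D" for v w
  proof -
    obtain q q' where "\<forall>u\<in>keys (v - z * q). deg_in {l} u < d" "\<forall>u\<in>keys (w - z * q'). deg_in {l} u < d"
      using vw unfolding D_def by blast
    moreover have eq: "v + w - z * (q + q') = (v - z * q) + (w - z * q')" by (simp add: algebra_simps)
    ultimately have "\<forall>u\<in>keys (v + w - z * (q + q')). deg_in {l} u < d"
      unfolding eq using keys_add[of "v - z * q" "w - z * q'"] by blast
    then show ?thesis unfolding D_def by blast
  qed
  have "deg_in {l} ` keys z \<noteq> {}" using z(2) by auto
  then have "d \<in> deg_in {l} ` keys z" unfolding d_def by (intro Max_in) auto
  then obtain w where w: "w \<in> keys z" "deg_in {l} w = d" by auto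
  then have "mterm l d \<in> keys z" using z(1) by (auto simp: univariate_def deg_in_mterm)
  then have c: "lookup z (mterm l d) \<noteq> 0" by (simp add: in_keys_iff)
  define c where "c = lookup z (mterm l d)"
  have z_le: "deg_in {l} u \<le> d" if "u \<in> keys z" for u
    using that by (simp add: d_def)
  have monomials: "mterm u a \<in> D" for u and a :: 'k
  proof (induction "deg_in {l} u" arbitrary: u a rule: less_induct)
    case less
    show ?case
    proof (cases "deg_in {l} u < d")
      case True
      then show ?thesis unfolding D_def by (auto intro!: exI[of _ 0] split: if_splits)
    next
      case False
      then have le: "d \<le> lookup u l" by (simp add: deg_in_def)
      define u' where "u' = u - mterm l d"
      have u: "u = mterm l d + u'"
        using le by (intro poly_mapping_eqI) (auto simp: u'_def lookup_add lookup_minus lookup_single when_def)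
      define m :: "('n \<Rightarrow>\<^sub>0 nat) \<Rightarrow>\<^sub>0 'k" where "m = mterm u' (a / c)"
      define r where "r = mterm u a - z * m"
      have lz: "lookup (z * m) (x + u') = lookup z x * (a / c)" for x
        using lookup_single_times[of u' "a / c" z x] by (simp add: m_def ac_simps)
      have deg_r: "deg_in {l} x < deg_in {l} u" if x: "x \<in> keys r" for x
      proof -
        have "lookup r u = 0" using lz[of "mterm l d"] c by (simp add: r_def lookup_minus u c_def)
        then have "x \<noteq> u" using x by auto
        then have "x \<in> keys (z * m)" using x by (auto simp: r_def in_keys_iff lookup_minus lookup_single when_def)
        then obtain y t where yt: "x = y + t" "y \<in> keys z" "t \<in> keys m" by (rule keys_multE)
        then have t: "t = u'" by (auto simp: m_def split: if_splits)
        obtain n where n: "y = mterm l n" using z(1) yt(2) by (auto simp: univariate_def)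
        have "n \<le> d" using z_le[OF yt(2)] by (simp add: n deg_in_mterm)
        moreover have "n \<noteq> d" using \<open>x \<noteq> u\<close> yt t n u by auto
        ultimately show ?thesis using yt t n u by (simp add: deg_in_mterm)
      qed
      have "r \<in> D" by (rule additive_closed_by_monomials[OF D0 Dadd]) (auto intro: less deg_r)
      then obtain q where "\<forall>x\<in>keys (r - z * q). deg_in {l} x < d" unfolding D_def by blast
      moreover have "r - z * q = mterm u a - z * (m + q)" by (simp add: r_def algebra_simps)
      ultimately show ?thesis unfolding D_def by auto
    qed
  qed
  have "v \<in> D" by (rule additive_closed_by_monomials[OF D0 Dadd monomials])
  then show ?thesis by (simp add: D_def d_def)
qed

text \<open>
  The polynomials form a free module over those in \<open>x\<^sub>l\<close>, with a basis on which multiplication by \<open>y\<close> acts;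
  so the remainder of \<open>v\<close> modulo \<open>z\<close> is annihilated by \<open>y\<close>.  In terms of degrees: \<open>y\<close> times the remainder is a
  multiple of \<open>z\<close> of smaller degree in \<open>x\<^sub>l\<close> than \<open>z\<close>.
\<close>
lemma univariate_dvd_cancel:
  fixes z v y :: "('n::{finite,linorder} \<Rightarrow>\<^sub>0 nat) \<Rightarrow>\<^sub>0 'k::field"
  assumes z: "univariate l z" "z \<noteq> 0" and y: "\<And>u. u \<in> keys y \<Longrightarrow> deg_in {l} u = 0" "y \<noteq> 0"
    and dvd: "z dvd y * v"
  shows "z dvd v"
proof -
  define d where "d = Max (deg_in {l} ` keys z)"
  obtain q where q: "\<And>u. u \<in> keys (v - z * q) \<Longrightarrow> deg_in {l} u < d"
    using univariate_division[OF z, of v] by (auto simp: d_def)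
  define r where "r = v - z * q"
  obtain t where t: "y * v = z * t" using dvd by (rule dvdE)
  define s where "s = t - y * q"
  have "y * r = y * v - z * (y * q)" by (simp add: r_def algebra_simps)
  then have yr: "y * r = z * s" by (simp add: t s_def right_diff_distrib)
  have "r = 0"
  proof (rule ccontr)
    assume "r \<noteq> 0"
    then have "s \<noteq> 0" using yr y(2) by auto
    define e where "e = Max (deg_in {l} ` keys s)"
    have "deg_in {l} ` keys z \<noteq> {}" "deg_in {l} ` keys s \<noteq> {}" using z(2) \<open>s \<noteq> 0\<close> by auto
    then have "d \<in> deg_in {l} ` keys z" "e \<in> deg_in {l} ` keys s"
      unfolding d_def e_def by (intro Max_in; simp)+
    then obtain w w' where ww: "w \<in> keys z" "d = deg_in {l} w" "w' \<in> keys s" "e = deg_in {l} w'" by blast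
    let ?\<omega> = "\<lambda>u :: 'n \<Rightarrow>\<^sub>0 nat. - int (deg_in {l} u)"
    have le: "deg_in {l} u \<le> d" if "u \<in> keys z" for u using that by (simp add: d_def)
    have le': "deg_in {l} u \<le> e" if "u \<in> keys s" for u using that by (simp add: e_def)
    have "restr {u. ?\<omega> u = - int d + - int e} (z * s) = 
        restr {u. ?\<omega> u = - int d} z * restr {u. ?\<omega> u = - int e} s"
      by (rule lowest_part_times) (auto simp: weight_def intro: le le')
    moreover have "restr {u. ?\<omega> u = - int d} z \<noteq> 0"
      by (rule in_keys_nonzero[of w]) (use ww in simp)
    moreover have "restr {u. ?\<omega> u = - int e} s \<noteq> 0"
      by (rule in_keys_nonzero[of w']) (use ww in simp)
    ultimately have "restr {u. ?\<omega> u = - int d + - int e} (z * s) \<noteq> 0" by simp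
    then obtain x where "x \<in> keys (restr {u. ?\<omega> u = - int d + - int e} (z * s))" by (rule nonzero_obtains_key)
    then have x: "x \<in> keys (z * s)" "?\<omega> x = - int d + - int e" by simp_all
    then have "x \<in> keys (y * r)" using yr by simp
    then obtain a b where "x = a + b" "a \<in> keys y" "b \<in> keys r" by (rule keys_multE)
    then have "deg_in {l} x < d" using y(1) q[of b] by (simp add: r_def)
    then show False using x(2) by simp
  qed
  then show ?thesis by (simp add: r_def)
qed

text \<open>
  Modulo \<open>y + z\<close> the product \<open>y z\<close> equals \<open>- z\<close> squared, so it suffices that \<open>z\<close> is a non-zero-divisor
  modulo \<open>y + z\<close>, equivalently that \<open>y + z\<close>, or \<open>y\<close>, is one modulo \<open>z\<close>.
\<close>
lemma univariate_sum_product_regular: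
  fixes y z :: "('n::{finite,linorder} \<Rightarrow>\<^sub>0 nat) \<Rightarrow>\<^sub>0 'k::field"
  assumes z: "univariate l z" "z \<noteq> 0" and y: "univariate k y" "y \<noteq> 0" and "k \<noteq> l"
    and eq: "y * z * u = (y + z) * v"
  shows "y + z dvd u"
proof -
  have cancel: "y + z dvd s" if "y + z dvd z * s" for s
  proof -
    obtain t where t: "z * s = (y + z) * t" using \<open>y + z dvd z * s\<close> by (rule dvdE)
    then have "z * (s - t) = y * t" by (simp add: algebra_simps)
    then have "z dvd y * t" by (metis dvd_triv_left)
    moreover have "deg_in {l} x = 0" if "x \<in> keys y" for x
      using y(1) that \<open>k \<noteq> l\<close> by (auto simp: univariate_def deg_in_mterm)
    ultimately have "z dvd t" using univariate_dvd_cancel[OF z] y(2) by blast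
    then obtain w where "t = z * w" by (rule dvdE)
    then have "z * s = z * ((y + z) * w)" using t by (simp add: ac_simps)
    then have "s = (y + z) * w" using z(2) by simp
    then show ?thesis by simp
  qed
  have "z * (z * u) = (y + z) * (z * u - v)" using eq by (simp add: algebra_simps)
  then have "y + z dvd z * (z * u)" by (metis dvd_triv_left)
  then show ?thesis using cancel by blast
qed

text \<open>
  The first two elementary symmetric polynomials of the family \<open>y\<close>.
\<close>
definition sum_vars :: "('n::finite \<Rightarrow> (('n \<Rightarrow>\<^sub>0 nat) \<Rightarrow>\<^sub>0 'k)) \<Rightarrow> (('n \<Rightarrow>\<^sub>0 nat) \<Rightarrow>\<^sub>0 'k::field)" where
  "sum_vars y = (\<Sum>k\<in>UNIV. y k)"

definition sum_pairs :: "('n::finite \<Rightarrow> (('n \<Rightarrow>\<^sub>0 nat) \<Rightarrow>\<^sub>0 'k)) \<Rightarrow> (('n \<Rightarrow>\<^sub>0 nat) \<Rightarrow>\<^sub>0 'k::field)" where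
  "sum_pairs y = (\<Sum>S | card S = 2. \<Prod>k\<in>S. y k)"

lemma restr_sum: "restr H (sum f A) = (\<Sum>x\<in>A. restr H (f x))"
  by (induction A rule: infinite_finite_induct) (auto simp: restr_add)

lemma restr_free_times:
  fixes p q :: "('n::finite \<Rightarrow>\<^sub>0 nat) \<Rightarrow>\<^sub>0 'k::comm_ring_1"
  shows "restr {u. deg_in V u = 0} (p * q) = restr {u. deg_in V u = 0} p * restr {u. deg_in V u = 0} q"
  using lowest_deg_in_times[of p 0 V q 0] by (simp add: monomial_ideal_def)

lemma restr_free_one: "restr {u. deg_in V u = 0} (1 :: ('n::finite \<Rightarrow>\<^sub>0 nat) \<Rightarrow>\<^sub>0 'k::comm_ring_1) = 1"
  by (rule restr_eq_self) simp

lemma restr_free_prod: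
  fixes f :: "'b \<Rightarrow> ('n::finite \<Rightarrow>\<^sub>0 nat) \<Rightarrow>\<^sub>0 'k::comm_ring_1"
  shows "restr {u. deg_in V u = 0} (prod f A) = (\<Prod>x\<in>A. restr {u. deg_in V u = 0} (f x))"
  by (induction A rule: infinite_finite_induct) (auto simp: restr_free_one restr_free_times)

text \<open>
  Every member vanishes at 0.  Therefore setting some variables to 0 deletes the
  corresponding members of the family and leaves the others unchanged.
\<close>
locale univariate_family =
  fixes y :: "'n::{finite,linorder} \<Rightarrow> (('n \<Rightarrow>\<^sub>0 nat) \<Rightarrow>\<^sub>0 'k::field)"
  assumes univ: "univariate k (y k)" and nz: "y k \<noteq> 0" and const: "0 \<notin> keys (y k)"
begin

lemma restr_free: "restr {u. deg_in V u = 0} (y k) = (if k \<in> V then 0 else y k)"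
proof (cases "k \<in> V")
  case True
  have "keys (y k) \<inter> {u. deg_in V u = 0} = {}"
  proof (rule equals0I)
    fix u assume u: "u \<in> keys (y k) \<inter> {u. deg_in V u = 0}"
    then obtain n where n: "u = mterm k n" using univ[of k] by (auto simp: univariate_def)
    then have "n = 0" using u True by (simp add: deg_in_mterm)
    then show False using u n const[of k] by simp
  qed
  then show ?thesis using True by (simp add: restr_eq_0)
next
  case False
  have "keys (y k) \<subseteq> {u. deg_in V u = 0}"
    using univ[of k] False by (auto simp: univariate_def deg_in_mterm)
  then show ?thesis using False by (simp add: restr_eq_self)
qed

lemma restr_free_sum_vars: "restr {u. deg_in V u = 0} (sum_vars y) = (\<Sum>k\<in>-V. y k)"
proof -
  have "(\<Sum>k\<in>UNIV. if k \<in> V then 0 else y k) = (\<Sum>k\<in>-V. y k)"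
    by (rule sum.mono_neutral_cong_right) auto
  then show ?thesis by (simp add: sum_vars_def restr_sum restr_free)
qed

lemma restr_free_sum_pairs:
  assumes "card (- V) = 2"
  shows "restr {u. deg_in V u = 0} (sum_pairs y) = (\<Prod>k\<in>-V. y k)"
proof -
  have "(\<Prod>k\<in>S. if k \<in> V then 0 else y k) = 0" if "card S = 2" "S \<noteq> - V" for S
  proof -
    have "\<not> S \<subseteq> - V" using card_subset_eq[of "- V" S] that assms by auto
    then show ?thesis by (intro prod_zero) auto
  qed
  then have "(\<Sum>S | card S = 2. \<Prod>k\<in>S. if k \<in> V then 0 else y k) = (\<Sum>S\<in>{-V}. \<Prod>k\<in>S. y k)"
    using assms by (intro sum.mono_neutral_cong_right) (auto intro!: prod.cong)
  then show ?thesis by (simp add: sum_pairs_def restr_sum restr_free_prod restr_free)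
qed

lemma sum_vars_nonzerodivisor:
  assumes H: "up_closed H" "\<And>u w. deg_in V w = 0 \<Longrightarrow> u + w \<in> H \<Longrightarrow> u \<in> H"
    and V: "- V = {k} \<or> (\<exists>l. k \<noteq> l \<and> - V = {k, l})" and fu: "sum_vars y * u \<in> monomial_ideal H"
  shows "u \<in> monomial_ideal H"
proof (rule nonzerodivisor_mod_monomial_ideal[OF H _ fu])
  have "(\<Sum>k\<in>-V. y k) \<noteq> 0"
    using V
  proof (elim disjE exE conjE)
    assume "- V = {k}" then show ?thesis using nz by simp
  next
    fix l assume kl: "k \<noteq> l" "- V = {k, l}"
    have "restr {u. deg_in {l} u = 0} (y k + y l) = y k" using kl by (simp add: restr_add restr_free)
    then have "y k + y l \<noteq> 0" using nz by (metis restr_zero)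
    then show ?thesis using kl by simp
  qed
  then show "restr {u. deg_in V u = 0} (sum_vars y) \<noteq> 0" by (simp add: restr_free_sum_vars)
qed

lemma sum_pairs_regular:
  assumes V: "k \<noteq> l" "- V = {k, l}"
    and gu: "sum_pairs y * u - sum_vars y * v \<in> monomial_ideal {u. a \<le> deg_in V u}"
  shows "\<exists>w. u - sum_vars y * w \<in> monomial_ideal {u. a \<le> deg_in V u}"
proof (rule regular_pair_mod_power[OF _ _ gu])
  have f0: "restr {u. deg_in V u = 0} (sum_vars y) = y k + y l"
    using V by (simp add: restr_free_sum_vars)
  have g0: "restr {u. deg_in V u = 0} (sum_pairs y) = y k * y l"
    using V by (simp add: restr_free_sum_pairs)
  have "restr {u. deg_in {l} u = 0} (y k + y l) = y k" using V by (simp add: restr_add restr_free)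
  then have "y k + y l \<noteq> 0" using nz by (metis restr_zero)
  then show "restr {u. deg_in V u = 0} (sum_vars y) \<noteq> 0" by (simp add: f0)
  show "restr {u. deg_in V u = 0} (sum_vars y) dvd u" 
    if "restr {u. deg_in V u = 0} (sum_pairs y) * u = restr {u. deg_in V u = 0} (sum_vars y) * v" for u v
    using univariate_sum_product_regular[OF univ nz univ nz V(1), of u v] that by (simp add: f0 g0)
qed

end

section \<open>Gluing along the lines\<close>

definition edge_ideal :: "4 set \<Rightarrow> nat \<Rightarrow> 'k::field poly4 set" where
  "edge_ideal e a = monomial_ideal {u. a \<le> deg_in e u}"

lemma card_Compl_edge:
  fixes e :: "4 set"
  assumes "card e = 2"
  shows "card (- e) = 2"
  using card_Diff_subset[of e UNIV] assms by (simp add: Compl_eq_Diff_UNIV)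

lemma adjacent_edges:
  fixes e e' :: "4 set"
  assumes "card e = 2" "card e' = 2" "e' \<noteq> e" "e' \<noteq> - e"
  obtains k where "- (e \<union> e') = {k}"
proof -
  have "e \<inter> e' \<noteq> {}"
  proof
    assume "e \<inter> e' = {}"
    then have "e' \<subseteq> - e" by blast
    then have "e' = - e" using card_subset_eq[of "- e" e'] assms card_Compl_edge by auto
    then show False using assms by simp
  qed
  moreover have "card (e \<inter> e') \<noteq> 2"
  proof
    assume "card (e \<inter> e') = 2"
    then have "e \<inter> e' = e" "e \<inter> e' = e'"
      using card_subset_eq[of e "e \<inter> e'"] card_subset_eq[of e' "e \<inter> e'"] assms by auto
    then show False using assms by simp
  qed
  moreover have "card (e \<inter> e') \<le> card e" by (intro card_mono) auto
  moreover have "card (e \<inter> e') \<noteq> 0" using calculation(1) by (simp add: card_eq_0_iff)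
  ultimately have "card (e \<inter> e') = 1" using assms by linarith
  then have "card (e \<union> e') = 3" using card_Un_Int[of e e'] assms by simp
  then have "card (- (e \<union> e')) = 1" using card_Diff_subset[of "e \<union> e'" UNIV] by (simp add: Compl_eq_Diff_UNIV)
  then show ?thesis using that by (auto simp: card_1_singleton_iff)
qed

lemma deg_in_eq_0_mono: "deg_in V w = 0 \<Longrightarrow> e \<subseteq> V \<Longrightarrow> deg_in e w = 0"
  by (auto simp: deg_in_def)

lemma up_closed_Un: "up_closed H \<Longrightarrow> up_closed H' \<Longrightarrow> up_closed (H \<union> H')"
  by (auto simp: up_closed_def)

text \<open>
  Since the ideals are monomial, pairwise agreement suffices: each coefficient of the
  glued polynomial is prescribed by any index whose ideal does not contain the monomial.
\<close>
lemma glue_along_lines: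
  fixes w :: "'e \<Rightarrow> 'b \<Rightarrow>\<^sub>0 'k::ab_group_add"
  assumes "finite E"
    and compat: "\<And>e e' c. e \<in> E \<Longrightarrow> e' \<in> E \<Longrightarrow> c \<notin> H e \<Longrightarrow> c \<notin> H e' \<Longrightarrow> lookup (w e) c = lookup (w e') c"
  shows "\<exists>s. \<forall>e\<in>E. s - w e \<in> monomial_ideal (H e)"
proof -
  define val where "val c = (if \<exists>e\<in>E. c \<notin> H e then lookup (w (SOME e. e \<in> E \<and> c \<notin> H e)) c else 0)" for c
  have val: "val c = lookup (w e) c" if e: "e \<in> E" "c \<notin> H e" for c e
  proof -
    let ?e = "SOME e. e \<in> E \<and> c \<notin> H e"
    have "?e \<in> E \<and> c \<notin> H ?e" by (rule someI[of _ e]) (use e in simp)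
    then show ?thesis using e compat[of ?e e c] by (auto simp: val_def)
  qed
  define S where "S = (\<Union>e\<in>E. keys (w e))"
  have fin: "finite S" using assms(1) by (simp add: S_def)
  have val0: "val c = 0" if "c \<notin> S" for c
  proof (cases "\<exists>e\<in>E. c \<notin> H e")
    case True
    then obtain e where "e \<in> E" "c \<notin> H e" by blast
    then show ?thesis using val that by (auto simp: S_def in_keys_iff)
  qed (simp add: val_def)
  define s where "s = (\<Sum>c\<in>S. mterm c (val c))"
  have s: "lookup s c = val c" for c
    using fin val0[of c] by (simp add: s_def lookup_sum lookup_single when_def)
  have "s - w e \<in> monomial_ideal (H e)" if "e \<in> E" for e
    unfolding monomial_ideal_def
  proof clarify
    fix c assume "c \<in> keys (s - w e)"
    then have "val c \<noteq> lookup (w e) c" by (simp add: in_keys_iff lookup_minus s)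
    then show "c \<in> H e" using val[OF that, of c] by blast
  qed
  then show ?thesis by blast
qed

context
  fixes a :: "4 set \<Rightarrow> nat" and I :: "'k::field poly4 set"
  defines "I \<equiv> {p. \<forall>e. card e = 2 \<longrightarrow> p \<in> edge_ideal e (a e)}"
begin

lemma sum_vars_nonzerodivisor_mod_lines:
  assumes y: "univariate_family y" and fu: "sum_vars y * u \<in> I"
  shows "u \<in> I"
  unfolding I_def
proof clarify
  fix e :: "4 set" assume e: "card e = 2"
  obtain k l where kl: "- e = {k, l}" "k \<noteq> l"
    using card_Compl_edge[OF e] by (auto simp: card_2_iff)
  have fe: "sum_vars y * u \<in> monomial_ideal {u. a e \<le> deg_in e u}"
    using fu e by (simp add: I_def edge_ideal_def)
  have "u \<in> monomial_ideal {u. a e \<le> deg_in e u}"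
    by (rule univariate_family.sum_vars_nonzerodivisor[OF y up_closed_deg_in _ _ fe, where V = e and k = k])
      (use kl in auto)
  then show "u \<in> edge_ideal e (a e)" by (simp add: edge_ideal_def)
qed

text \<open>
  Each edge \<open>e\<close> has its own quotient \<open>w e\<close> of \<open>u\<close> by the sum of the family.  Two quotients agree where both
  are determined: for edges with a common index by cancelling the sum modulo both ideals together, for
  opposite edges by comparison with a third edge.
\<close>
lemma sum_pairs_regular_mod_lines:
  assumes y: "univariate_family y"
    and no_gap: "\<And>e u. card e = 2 \<Longrightarrow> deg_in e u < a e \<Longrightarrow> deg_in (- e) u < a (- e) \<Longrightarrow> 
      \<exists>e'. card e' = 2 \<and> e' \<noteq> e \<and> e' \<noteq> - e \<and> deg_in e' u < a e'"
    and gu: "sum_pairs y * u - sum_vars y * v \<in> I"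
  shows "\<exists>w. u - sum_vars y * w \<in> I"
proof -
  interpret univariate_family y by fact
  define H where "H e = {u. a e \<le> deg_in e u}" for e
  let ?E = "{e :: 4 set. card e = 2}"
  have ex: "\<exists>w. u - sum_vars y * w \<in> monomial_ideal (H e)" if e: "e \<in> ?E" for e
  proof -
    obtain k l where kl: "- e = {k, l}" "k \<noteq> l"
      using card_Compl_edge[of e] e by (auto simp: card_2_iff)
    have "sum_pairs y * u - sum_vars y * v \<in> monomial_ideal {u. a e \<le> deg_in e u}"
      using gu e by (simp add: I_def edge_ideal_def)
    then show ?thesis using sum_pairs_regular[OF kl(2,1)] by (simp add: H_def)
  qed
  define w where "w e = (SOME w. u - sum_vars y * w \<in> monomial_ideal (H e))" for e
  have w: "u - sum_vars y * w e \<in> monomial_ideal (H e)" if "e \<in> ?E" for e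
    unfolding w_def by (rule someI_ex[OF ex[OF that]])
  have up: "up_closed (H e)" for e by (simp add: H_def up_closed_deg_in)
  have adj: "lookup (w e) c = lookup (w e') c" 
    if e: "e \<in> ?E" "e' \<in> ?E" "e' \<noteq> e" "e' \<noteq> - e" and c: "c \<notin> H e" "c \<notin> H e'" for e e' c
  proof -
    obtain k where k: "- (e \<union> e') = {k}" using adjacent_edges[of e e'] e by auto
    have "sum_vars y * (w e - w e') = (u - sum_vars y * w e') - (u - sum_vars y * w e)"
      by (simp add: algebra_simps)
    moreover have "u - sum_vars y * w e' \<in> monomial_ideal (H e \<union> H e')"
        "u - sum_vars y * w e \<in> monomial_ideal (H e \<union> H e')"
      using w[OF e(1)] w[OF e(2)] by (auto simp: monomial_ideal_def)
    ultimately have *: "sum_vars y * (w e - w e') \<in> monomial_ideal (H e \<union> H e')"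
      by (metis monomial_ideal_diff)
    have "w e - w e' \<in> monomial_ideal (H e \<union> H e')"
    proof (rule sum_vars_nonzerodivisor[OF up_closed_Un[OF up up] _ _ *, where V = "e \<union> e'" and k = k])
      fix u w :: "4 \<Rightarrow>\<^sub>0 nat" assume "deg_in (e \<union> e') w = 0" "u + w \<in> H e \<union> H e'"
      then show "u \<in> H e \<union> H e'"
        using deg_in_eq_0_mono[of "e \<union> e'" w e] deg_in_eq_0_mono[of "e \<union> e'" w e'] by (auto simp: H_def)
    qed (use k in simp)
    then have "c \<notin> keys (w e - w e')" using c by (auto simp: monomial_ideal_def)
    then show ?thesis by (simp add: in_keys_iff lookup_minus)
  qed
  have "\<exists>s. \<forall>e\<in>?E. s - w e \<in> monomial_ideal (H e)"
  proof (rule glue_along_lines)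
    fix e e' c assume e: "e \<in> ?E" "e' \<in> ?E" "c \<notin> H e" "c \<notin> H e'"
    show "lookup (w e) c = lookup (w e') c"
    proof (cases "e' = e \<or> e' \<noteq> - e")
      case True
      then show ?thesis using adj[OF e(1,2) _ _ e(3,4)] by auto
    next
      case False
      then obtain e'' where e'': "card e'' = 2" "e'' \<noteq> e" "e'' \<noteq> - e" "c \<notin> H e''"
        using no_gap[of e c] e by (auto simp: H_def not_le)
      have "lookup (w e) c = lookup (w e'') c"
        using adj[of e e'' c] e e'' by simp
      also have "\<dots> = lookup (w e') c"
        using adj[of e' e'' c] e e'' False by simp
      finally show ?thesis .
    qed
  qed simp
  then obtain s where s: "\<And>e. e \<in> ?E \<Longrightarrow> s - w e \<in> monomial_ideal (H e)" by blast
  have "u - sum_vars y * s \<in> monomial_ideal (H e)" if e: "e \<in> ?E" for e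
  proof -
    have "u - sum_vars y * s = (u - sum_vars y * w e) - sum_vars y * (s - w e)"
      by (simp add: algebra_simps)
    also have "\<dots> \<in> monomial_ideal (H e)"
      by (intro monomial_ideal_diff monomial_ideal_mult up w s e)
    finally show ?thesis .
  qed
  then have "u - sum_vars y * s \<in> I" by (simp add: I_def edge_ideal_def H_def)
  then show ?thesis by blast
qed

end

section \<open>Regular sequences and primes in a quotient ring\<close>

lemma (in ring) genideal_empty: "Idl {} = {\<zero>}"
  using genideal_minimal[OF zeroideal, of "{}"] genideal_ideal[of "{}"] additive_subgroup.zero_closed ideal.axioms(1)
  by blast

locale rta_quotient =
  fixes I :: "'a::comm_ring_1 set"
  assumes I: "ideal I (ring_of_type_algebra :: 'a ring)"
begin

abbreviation "R \<equiv> (ring_of_type_algebra :: 'a ring)"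
abbreviation "Q \<equiv> R Quot I"
abbreviation "proj \<equiv> (+>\<^bsub>R\<^esub>) I"

lemma cring_R: "cring R"
  by (rule cring_rta)

lemma cring_Q: "cring Q"
  using ideal.quotient_is_cring[OF I cring_R] .

lemma proj_hom: "ring_hom_cring R Q proj"
  by (rule ideal.rcos_ring_hom_cring[OF I cring_R])

lemma proj_carrier [simp]: "proj x \<in> carrier Q"
  using ring_hom_cring.axioms(3)[OF proj_hom] by (auto simp: ring_hom_cring_axioms_def ring_hom_def)

lemma proj_ops [simp]:
  "proj x \<otimes>\<^bsub>Q\<^esub> proj y = proj (x * y)" "proj x \<oplus>\<^bsub>Q\<^esub> proj y = proj (x + y)"
  "\<one>\<^bsub>Q\<^esub> = proj 1" "\<zero>\<^bsub>Q\<^esub> = proj 0"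
proof -
  interpret h: ring_hom_cring R Q proj by (rule proj_hom)
  show "proj x \<otimes>\<^bsub>Q\<^esub> proj y = proj (x * y)" "proj x \<oplus>\<^bsub>Q\<^esub> proj y = proj (x + y)"
    using h.hom_mult[of x y] h.hom_add[of x y] by simp_all
  show "\<one>\<^bsub>Q\<^esub> = proj 1" "\<zero>\<^bsub>Q\<^esub> = proj 0"
    using h.hom_one h.hom_zero by simp_all
qed

lemma minus_R: "x \<ominus>\<^bsub>R\<^esub> y = x - y"
  by (simp add: a_minus_def)

lemma proj_eq_iff: "proj x = proj y \<longleftrightarrow> x - y \<in> I"
proof -
  interpret cring R by (rule cring_R)
  show ?thesis using quotient_eq_iff_same_a_r_cos[OF I, of x y] by (simp add: minus_R)
qed

lemma carrier_Q: "carrier Q = Set.range proj"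
  by (auto simp: FactRing_def A_RCOSETS_def')

lemma mem_Idl_empty_iff: "proj x \<in> Idl\<^bsub>Q\<^esub> {} \<longleftrightarrow> x \<in> I"
proof -
  interpret Q: cring Q by (rule cring_Q)
  show ?thesis by (simp add: Q.genideal_empty proj_eq_iff)
qed

lemma mem_Idl_single_iff: "proj x \<in> Idl\<^bsub>Q\<^esub> {proj f} \<longleftrightarrow> (\<exists>v. x - f * v \<in> I)"
proof -
  interpret Q: cring Q by (rule cring_Q)
  have "Idl\<^bsub>Q\<^esub> {proj f} = PIdl\<^bsub>Q\<^esub> (proj f)"
    by (rule Q.cgenideal_eq_genideal[symmetric]) simp
  also have "\<dots> = {proj (v * f) | v. True}"
  proof -
    have "{x \<otimes>\<^bsub>Q\<^esub> proj f | x. x \<in> carrier Q} = (\<lambda>x. x \<otimes>\<^bsub>Q\<^esub> proj f) ` Set.range proj"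
      unfolding carrier_Q by blast
    then show ?thesis unfolding cgenideal_def by (auto simp: image_image)
  qed
  finally show ?thesis by (auto simp: proj_eq_iff ac_simps)
qed

lemma regular_sequence_pair_iff:
  "regular_sequence Q [proj f, proj g] \<longleftrightarrow> Idl\<^bsub>Q\<^esub> {proj f, proj g} \<noteq> carrier Q \<and>
    (\<forall>u. f * u \<in> I \<longrightarrow> u \<in> I) \<and> (\<forall>u v. g * u - f * v \<in> I \<longrightarrow> (\<exists>w. u - f * w \<in> I))"
  unfolding regular_sequence_def carrier_Q
  by (simp add: less_Suc_eq all_conj_distrib mem_Idl_empty_iff mem_Idl_single_iff)

definition vimage_ideal :: "'a set set \<Rightarrow> 'a set" where
  "vimage_ideal P = {x. proj x \<in> P}"

lemma ideal_vimage_ideal: "ideal P Q \<Longrightarrow> ideal (vimage_ideal P) R"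
  using ring_hom_ring.ideal_vimage[OF ideal.rcos_ring_hom_ring[OF I], of P] by (simp add: vimage_ideal_def)

lemma image_vimage_ideal: "P \<subseteq> carrier Q \<Longrightarrow> proj ` vimage_ideal P = P"
  unfolding carrier_Q by (auto simp: vimage_ideal_def)

lemma ideal_subset_carrier: "ideal P S \<Longrightarrow> P \<subseteq> carrier S"
  by (rule additive_subgroup.a_subset[OF ideal.axioms(1)])

lemma I_subset_vimage: "ideal P Q \<Longrightarrow> I \<subseteq> vimage_ideal P"
proof
  fix x assume P: "ideal P Q" and x: "x \<in> I"
  have "proj 0 \<in> P" using additive_subgroup.zero_closed[OF ideal.axioms(1)[OF P]] by simp
  moreover have "proj x = proj 0" using x by (simp add: proj_eq_iff)
  ultimately show "x \<in> vimage_ideal P" by (simp add: vimage_ideal_def)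
qed

lemma primeideal_vimage:
  assumes "primeideal P Q"
  shows "primeideal (vimage_ideal P) R"
proof -
  interpret P: primeideal P Q by fact
  show ?thesis
  proof (rule primeidealI)
    show "ideal (vimage_ideal P) R" by (rule ideal_vimage_ideal[OF P.is_ideal])
    show "cring R" by (rule cring_R)
    show "carrier R \<noteq> vimage_ideal P"
    proof
      assume "carrier R = vimage_ideal P"
      then have "\<one>\<^bsub>Q\<^esub> \<in> P" by (auto simp: vimage_ideal_def)
      then show False using P.one_imp_carrier P.I_notcarr by simp
    qed
    fix x y assume "x \<otimes>\<^bsub>R\<^esub> y \<in> vimage_ideal P"
    then have "proj x \<otimes>\<^bsub>Q\<^esub> proj y \<in> P" by (simp add: vimage_ideal_def)
    then show "x \<in> vimage_ideal P \<or> y \<in> vimage_ideal P"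
      using P.I_prime by (simp add: vimage_ideal_def del: proj_ops)
  qed
qed

lemma vimage_ideal_strict_mono: 
  assumes "P \<subset> P'" "P' \<subseteq> carrier Q"
  shows "vimage_ideal P \<subset> vimage_ideal P'"
proof -
  have "vimage_ideal P \<subseteq> vimage_ideal P'" using assms by (auto simp: vimage_ideal_def)
  moreover have "vimage_ideal P \<noteq> vimage_ideal P'"
  proof
    assume "vimage_ideal P = vimage_ideal P'"
    then have "proj ` vimage_ideal P = proj ` vimage_ideal P'" by (rule arg_cong)
    moreover have "P \<subseteq> carrier Q" using assms by (meson psubset_imp_subset subset_trans)
    ultimately have "P = P'" using assms(2) by (simp only: image_vimage_ideal)
    then show False using assms(1) by blast
  qed
  ultimately show ?thesis by blast
qed

lemma maximalideal_vimage:
  assumes "maximalideal P Q"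
  shows "maximalideal (vimage_ideal P) R"
proof -
  interpret P: maximalideal P Q by fact
  interpret QI: cring Q by (rule cring_Q)
  have prime: "primeideal (vimage_ideal P) R"
    by (rule primeideal_vimage[OF QI.maximalideal_prime[OF assms]])
  show ?thesis
  proof (rule maximalidealI)
    show "ideal (vimage_ideal P) R" "carrier R \<noteq> vimage_ideal P"
      using prime primeideal.axioms(1) primeideal.I_notcarr by blast+
    fix J assume J: "ideal J R" "vimage_ideal P \<subseteq> J" "J \<subseteq> carrier R"
    interpret RI: cring R by (rule cring_R)
    have J': "ideal (proj ` J) Q" by (rule RI.ring_ideal_imp_quot_ideal[OF I J(1)])
    have IJ: "I \<subseteq> J" using I_subset_vimage[OF P.is_ideal] J(2) by blast
    have lift_mem: "x \<in> J" if x: "proj x \<in> proj ` J" for x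
    proof -
      obtain j where "j \<in> J" "x - j \<in> I" using x by (auto simp: proj_eq_iff)
      then have "(x - j) + j \<in> J" using J(1) IJ unfolding ideal_rta_iff by blast
      then show ?thesis by simp
    qed
    have "proj ` vimage_ideal P \<subseteq> proj ` J" by (rule image_mono[OF J(2)])
    then have "P \<subseteq> proj ` J"
      unfolding image_vimage_ideal[OF ideal_subset_carrier[OF P.is_ideal]] .
    then consider "proj ` J = P" | "proj ` J = carrier Q"
      using P.I_maximal[OF J'] ideal_subset_carrier[OF J'] by blast
    then show "J = vimage_ideal P \<or> J = carrier R"
    proof cases
      case 1
      then have "J \<subseteq> vimage_ideal P" by (auto simp: vimage_ideal_def)
      then show ?thesis using J(2) by blast
    next
      case 2
      then have "x \<in> J" for x using lift_mem[of x] by simp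
      then show ?thesis by auto
    qed
  qed
qed

lemma primeideal_image:
  assumes P: "primeideal P R" and IP: "I \<subseteq> P"
  shows "primeideal (proj ` P) Q" "vimage_ideal (proj ` P) = P"
proof -
  interpret P: primeideal P R by fact
  have lift_mem: "x \<in> P" if x: "proj x \<in> proj ` P" for x
  proof -
    obtain j where "j \<in> P" "x - j \<in> I" using x by (auto simp: proj_eq_iff)
    then have "(x - j) + j \<in> P" using P.is_ideal IP unfolding ideal_rta_iff by blast
    then show ?thesis by simp
  qed
  show "vimage_ideal (proj ` P) = P"
  proof (intro equalityI subsetI)
    fix x assume "x \<in> vimage_ideal (proj ` P)"
    then show "x \<in> P" unfolding vimage_ideal_def by (intro lift_mem) (rule CollectD)
  next
    fix x assume "x \<in> P"
    then show "x \<in> vimage_ideal (proj ` P)" unfolding vimage_ideal_def by (intro CollectI imageI)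
  qed
  show "primeideal (proj ` P) Q"
  proof (rule primeidealI)
    show "ideal (proj ` P) Q" by (rule ring.ring_ideal_imp_quot_ideal[OF cring.axioms(1)[OF cring_R] I P.is_ideal])
    show "cring Q" by (rule cring_Q)
    show "carrier Q \<noteq> proj ` P"
    proof
      assume eq: "carrier Q = proj ` P"
      have "proj 1 \<in> carrier Q" by (rule proj_carrier)
      then have "proj 1 \<in> proj ` P" unfolding eq .
      then have "1 \<in> P" by (rule lift_mem)
      then show False using P.I_notcarr P.one_imp_carrier by simp
    qed
    fix x y assume xy: "x \<in> carrier Q" "y \<in> carrier Q" "x \<otimes>\<^bsub>Q\<^esub> y \<in> proj ` P"
    obtain x' y' where x': "x = proj x'" and y': "y = proj y'" using xy unfolding carrier_Q by blast
    have "proj (x' * y') \<in> proj ` P" using xy(3) unfolding x' y' proj_ops .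
    then have "x' * y' \<in> P" by (rule lift_mem)
    then have "x' \<in> P \<or> y' \<in> P" using P.I_prime[of x' y'] by simp
    then show "x \<in> proj ` P \<or> y \<in> proj ` P" unfolding x' y' by blast
  qed
qed

end

section \<open>Maximal ideals contain univariate polynomials\<close>

text \<open>
  Modulo \<open>w\<close> the element \<open>a\<close> is a unit, with inverse \<open>- t\<close>.
\<close>
lemma dvd_cancel_power_mod:
  fixes w a t :: "'a::comm_ring_1"
  assumes t: "w = 1 + t * a" and dvd: "w dvd a ^ n * c"
  shows "w dvd c"
  using dvd
proof (induction n)
  case (Suc n)
  have "a ^ n * c = w * (a ^ n * c) - t * (a ^ Suc n * c)"
    by (simp add: t algebra_simps)
  also have "w dvd \<dots>" using Suc.prems by (intro dvd_diff[OF dvd_triv_left dvd_mult])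
  finally show ?case by (rule Suc.IH)
qed simp

text \<open>
  Modulo \<open>w\<close> the leading coefficient of \<open>h\<close> is a unit, so a nonzero multiple of \<open>h\<close> has
  positive degree; hence the constant \<open>b\<close> can be a multiple of \<open>h\<close> only if it vanishes modulo \<open>w\<close>.
\<close>
lemma constant_combination_dvd:
  fixes h q v :: "'a::idom poly"
  assumes h: "0 < degree h" and w: "w = 1 + t * lead_coeff h"
    and eq: "h * q + smult w v = [:b:]"
  shows "w dvd b"
proof -
  have "w dvd b" if "\<forall>i\<ge>n. coeff q i = 0" "h * q + smult w v = [:b:]" for n
    using that
  proof (induction n arbitrary: q v)
    case 0
    then have "q = 0" by (intro poly_eqI) auto
    then have "coeff (smult w v) 0 = coeff [:b:] 0" using 0 by simp
    then show ?case by (metis coeff_pCons_0 coeff_smult dvd_triv_left)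
  next
    case (Suc n)
    define c where "c = coeff q n"
    show ?case
    proof (cases "c = 0")
      case True
      then have "\<forall>i\<ge>n. coeff q i = 0" using Suc.prems(1) by (metis c_def le_neq_implies_less Suc_leI)
      then show ?thesis using Suc by blast
    next
      case False
      have dq: "degree q = n"
      proof (rule antisym)
        show "degree q \<le> n" using Suc.prems(1) by (intro degree_le) auto
        show "n \<le> degree q" using False by (simp add: c_def le_degree)
      qed
      have "coeff (h * q + smult w v) (degree h + n) = 0"
        using h by (simp add: Suc.prems(2) coeff_pCons split: nat.split)
      then have "lead_coeff h * c = w * (- coeff v (degree h + n))"
        using coeff_mult_degree_sum[of h q] dq by (simp add: c_def eq_neg_iff_add_eq_0)
      then have "w dvd lead_coeff h ^ 1 * c" by simp
      then have "w dvd c" by (rule dvd_cancel_power_mod[OF w])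
      then obtain c' where c': "c = w * c'" by (rule dvdE)
      define q1 where "q1 = q - Polynomial.monom c n"
      have "coeff q1 i = 0" if "i \<ge> n" for i
        using Suc.prems(1) that by (cases "i = n") (simp_all add: q1_def c_def)
      moreover have "h * q1 + smult w (v + Polynomial.monom c' n * h) = [:b:]"
      proof -
        have "Polynomial.monom c n = smult w (Polynomial.monom c' n)" by (simp add: c' smult_monom)
        then show ?thesis using Suc.prems(2) by (simp add: q1_def algebra_simps smult_add_right)
      qed
      ultimately show ?thesis using Suc.IH by blast
    qed
  qed
  from this[of "Suc (degree q)"] show ?thesis using eq by (simp add: coeff_eq_0)
qed

text \<open>
  Zariski's lemma for the maximal ideals of \<open>K[y][z]\<close>, in the form that \<open>M\<close> contains a nonzero element of \<open>K[y]\<close>.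
  Otherwise take \<open>h\<close> in \<open>M\<close> of minimal degree in \<open>z\<close>, with leading coefficient \<open>a\<close>; by pseudo-division a
  multiple of each element of \<open>M\<close> by a power of \<open>a\<close> is a multiple of \<open>h\<close>.  The element \<open>w = 1 + y a\<close> of
  \<open>K[y]\<close> is coprime to \<open>a\<close> and not constant.  It is invertible modulo \<open>M\<close>, so a power of \<open>a\<close> is a
  combination of \<open>h\<close> and \<open>w\<close>; then \<open>w\<close> divides that power and is a unit.
\<close>
lemma maximal_ideal_contains_constant_polynomial:
  fixes M :: "'k::field poly poly set"
  assumes add: "\<And>p q. p \<in> M \<Longrightarrow> q \<in> M \<Longrightarrow> p + q \<in> M"
    and mult: "\<And>p q. q \<in> M \<Longrightarrow> p * q \<in> M"
    and proper: "1 \<notin> M" and max: "\<And>u. u \<notin> M \<Longrightarrow> \<exists>v. 1 - u * v \<in> M"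
  shows "\<exists>p. p \<noteq> 0 \<and> [:p:] \<in> M"
proof (rule ccontr)
  assume "\<not> (\<exists>p. p \<noteq> 0 \<and> [:p:] \<in> M)"
  then have none: "p = 0" if "[:p:] \<in> M" for p using that by blast
  have "\<exists>m\<in>M. m \<noteq> 0"
  proof -
    let ?x = "[:0, 1:] :: 'k poly"
    have "[:?x:] \<notin> M" using none[of ?x] by (intro notI) simp
    then obtain v where v: "1 - [:?x:] * v \<in> M" using max by blast
    have "1 - [:?x:] * v \<noteq> 0"
    proof
      assume "1 - [:?x:] * v = 0"
      then have "coeff 1 0 = coeff ([:?x:] * v) 0" by simp
      then have "(1 :: 'k poly) = ?x * coeff v 0" by simp
      then have "coeff (1 :: 'k poly) 0 = coeff (?x * coeff v 0) 0" by simp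
      then show False by simp
    qed
    then show ?thesis using v by blast
  qed
  then obtain m0 where "m0 \<in> M \<and> m0 \<noteq> 0" by blast
  then obtain h where h: "h \<in> M" "h \<noteq> 0" and hmin: "\<And>m. m \<in> M \<Longrightarrow> m \<noteq> 0 \<Longrightarrow> degree h \<le> degree m"
    using ex_has_least_nat[of "\<lambda>m. m \<in> M \<and> m \<noteq> 0" m0 degree] by blast
  have dh: "0 < degree h"
  proof (rule ccontr)
    assume "\<not> 0 < degree h"
    then obtain p where "h = [:p:]" by (metis degree_eq_zeroE neq0_conv)
    then show False using none[of p] h by simp
  qed
  define a where "a = lead_coeff h"
  have a: "a \<noteq> 0" using h by (simp add: a_def)
  have div: "\<exists>n q. smult (a ^ n) m = h * q" if m: "m \<in> M" for m
  proof -
    obtain q r where qr: "pseudo_divmod m h = (q, r)" by fastforce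
    define n where "n = Suc (degree m) - degree h"
    have eq: "smult (a ^ n) m = h * q + r" and r: "r = 0 \<or> degree r < degree h"
      using pseudo_divmod[OF h(2) qr] by (simp_all add: a_def n_def)
    have "r = smult (a ^ n) m - q * h" using eq by (simp add: mult.commute)
    also have "\<dots> = [:a ^ n:] * m + (- q) * h" by simp
    also have "\<dots> \<in> M" using m h by (intro add mult)
    finally have "r = 0" using r hmin by force
    then show ?thesis using eq by auto
  qed
  define w where "w = 1 + [:0, 1:] * a"
  have dw: "0 < degree w"
  proof -
    have "coeff w (Suc (degree a)) = lead_coeff a" by (simp add: w_def)
    then have "Suc (degree a) \<le> degree w" using a by (intro le_degree) simp
    then show ?thesis by simp
  qed
  then have "[:w:] \<notin> M" using none[of w] by (intro notI) simp
  then obtain v where "1 - [:w:] * v \<in> M" using max by blast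
  then obtain n q where "smult (a ^ n) (1 - [:w:] * v) = h * q" using div by blast
  then have "h * q + smult w (smult (a ^ n) v) = smult (a ^ n) 1" 
    by (simp add: smult_diff_right algebra_simps flip: \<open>smult (a ^ n) (1 - [:w:] * v) = h * q\<close>)
  then have eq: "h * q + smult w (smult (a ^ n) v) = [:a ^ n:]" by (simp add: one_pCons)
  have "w = 1 + [:0, 1:] * lead_coeff h" by (simp only: w_def a_def)
  then have "w dvd a ^ n" using eq by (rule constant_combination_dvd[OF dh])
  then have "w dvd a ^ n * 1" by simp
  then have "w dvd 1" by (rule dvd_cancel_power_mod[OF w_def])
  moreover have "w \<noteq> 0" using dw by auto
  ultimately show False using dw is_unit_iff_degree[of w] by simp
qed

text \<open>
  Evaluation at \<open>x\<close> of a polynomial with coefficients transported along \<open>f\<close>.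
\<close>
definition poly_eval :: "('a::comm_ring_1 \<Rightarrow> 'b::comm_ring_1) \<Rightarrow> 'b \<Rightarrow> 'a poly \<Rightarrow> 'b" where
  "poly_eval f x p = poly (map_poly f p) x"

lemma poly_eval_0 [simp]: "poly_eval f x 0 = 0"
  by (simp add: poly_eval_def)

lemma poly_eval_pCons: "f 0 = 0 \<Longrightarrow> poly_eval f x (pCons a p) = f a + x * poly_eval f x p"
  by (simp add: poly_eval_def map_poly_pCons)

lemma poly_eval_add:
  assumes "f 0 = 0" "\<And>a b. f (a + b) = f a + f b"
  shows "poly_eval f x (p + q) = poly_eval f x p + poly_eval f x q"
  by (induction p q rule: poly_induct2) (simp_all add: poly_eval_pCons assms algebra_simps)

lemma poly_eval_mult:
  assumes f: "f 0 = 0" "\<And>a b. f (a + b) = f a + f b" "\<And>a b. f (a * b) = f a * f b"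
  shows "poly_eval f x (p * q) = poly_eval f x p * poly_eval f x q"
proof (induction p)
  case (pCons a p)
  have "poly_eval f x (smult a q) = f a * poly_eval f x q" 
    by (induction q) (simp_all add: poly_eval_pCons f algebra_simps)
  then show ?case using pCons
    by (simp add: mult_pCons_left poly_eval_add[of f, OF f(1,2)] poly_eval_pCons f algebra_simps)
qed simp

lemma poly_eval_monom: "f 0 = 0 \<Longrightarrow> poly_eval f x (Polynomial.monom c n) = f c * x ^ n"
  by (simp add: poly_eval_def map_poly_monom poly_monom)

definition const4 :: "'k::field \<Rightarrow> 'k poly4" where "const4 c = mterm 0 c"

lemma const4_hom [simp]: "const4 0 = 0" "const4 1 = 1" 
  "const4 (a + b) = const4 a + const4 b" "const4 (a * b) = const4 a * const4 b"
  by (simp_all add: const4_def single_add mult_single)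

lemma pvar_power: "(pvar k :: 'k::field poly4) ^ n = mterm (mterm k n) 1"
  by (induction n) (simp_all add: pvar_def mult_single flip: single_add)

lemma lookup_pvar_times:
  "lookup (pvar k * (q :: 'k::field poly4)) (mterm k n) = (case n of 0 \<Rightarrow> 0 | Suc n \<Rightarrow> lookup q (mterm k n))"
proof (cases n)
  case 0
  have "0 \<notin> keys (pvar k * q)"
  proof
    assume "0 \<in> keys (pvar k * q)"
    then obtain a b where ab: "0 = a + b" "a \<in> keys (pvar k :: 'k poly4)" by (rule keys_multE)
    have "a = mterm k 1" using ab(2) by (simp add: pvar_def)
    then have "lookup (a + b) k \<noteq> 0" by (simp add: lookup_add)
    then show False by (simp flip: ab(1))
  qed
  then show ?thesis using 0 by (simp add: in_keys_iff)
next
  case (Suc m)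
  have "mterm k n = mterm k 1 + mterm k m" by (simp add: Suc flip: single_add)
  then show ?thesis using lookup_single_times[of "mterm k 1" 1 q "mterm k m"] by (simp add: pvar_def Suc)
qed

lemma mterm_Suc_nonzero [simp]: "mterm k (Suc n) \<noteq> 0"
  by (metis lookup_single_eq lookup_zero nat.distinct(1))

lemma lookup_poly_eval_pvar: "lookup (poly_eval const4 (pvar k) p) (mterm k n) = coeff p n"
proof (induction p arbitrary: n)
  case (pCons c p)
  then show ?case
    by (auto simp: poly_eval_pCons lookup_add lookup_pvar_times const4_def lookup_single when_def coeff_pCons
        split: nat.split)
qed simp

lemma univariate_pvar_times: "univariate k q \<Longrightarrow> univariate k (pvar k * (q :: 'k::field poly4))"
  unfolding univariate_def
proof
  fix u assume q: "\<forall>u\<in>keys q. \<exists>n. u = mterm k n" and "u \<in> keys (pvar k * q)"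
  then obtain a b where "u = a + b" "a \<in> keys (pvar k :: 'k poly4)" "b \<in> keys q" by (blast elim: keys_multE)
  then obtain n where "u = mterm k 1 + mterm k n" using q by (auto simp: pvar_def split: if_splits)
  then show "\<exists>n. u = mterm k n" by (auto simp flip: single_add)
qed

lemma univariate_poly_eval_pvar: "univariate k (poly_eval const4 (pvar k) p)"
proof (induction p)
  case (pCons c p)
  have "univariate k (const4 c)" by (auto simp: univariate_def const4_def intro!: exI[of _ 0] split: if_splits)
  then show ?case
    using univariate_pvar_times[OF pCons.IH] keys_add[of "const4 c" "pvar k * poly_eval const4 (pvar k) p"]
    unfolding univariate_def by (auto simp: poly_eval_pCons)
qed (simp add: univariate_def)

lemma maximalideal_rta_inverse:
  assumes P: "maximalideal P (ring_of_type_algebra :: 'a::comm_ring_1 ring)" and u: "u \<notin> P"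
  shows "\<exists>v. 1 - u * v \<in> P"
proof -
  let ?R = "ring_of_type_algebra :: 'a ring"
  interpret P: maximalideal P ?R by (rule P)
  obtain K where K: "ideal K ?R" "P \<subseteq> K" "u \<in> K" 
    and mem: "\<forall>z\<in>K. \<exists>p\<in>P. \<exists>r\<in>carrier ?R. z = p \<oplus>\<^bsub>?R\<^esub> r \<otimes>\<^bsub>?R\<^esub> u"
    using cring.ideal_adjoin[OF cring_rta P.is_ideal, of u] by auto
  have "K = UNIV" using P.I_maximal[OF K(1,2)] K(3) u by auto
  then obtain p r where "p \<in> P" "1 = p + r * u" using bspec[OF mem, of 1] by auto
  then have "1 - u * r = p" by (simp add: diff_eq_eq mult.commute)
  then show ?thesis using \<open>p \<in> P\<close> by blast
qed

lemma monomial_in_ideal: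
  assumes P: "ideal P (poly4_ring :: 'k::field poly4 ring)" and i: "pvar i \<in> P" and u: "0 < lookup u i"
  shows "mterm u c \<in> P"
proof -
  obtain v where "u = v + mterm i 1" using split_off_variable[OF u] .
  then have "mterm u c = mterm v c * pvar i" by (simp add: pvar_def mult_single)
  then show ?thesis using P i unfolding ideal_rta_iff by simp
qed

text \<open>
  Modulo the two variables in \<open>P\<close> every polynomial is one in \<open>x\<^sub>k\<close> and \<open>x\<^sub>l\<close>, so the polynomials \<open>F\<close> in
  \<open>K[y][z]\<close> with \<open>F(x\<^sub>k, x\<^sub>l)\<close> in \<open>P\<close> form a maximal ideal.
\<close>
lemma maximal_ideal_contains_univariate:
  fixes P :: "'k::field poly4 set"
  assumes P: "maximalideal P poly4_ring" and ij: "pvar i \<in> P" "pvar j \<in> P"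
    and UNIV: "UNIV = {i, j, k, l}" "k \<noteq> l"
  shows "\<exists>p. p \<noteq> 0 \<and> poly_eval const4 (pvar k) p \<in> P"
proof -
  interpret P: maximalideal P "poly4_ring :: 'k poly4 ring" by fact
  have PI: "0 \<in> P" "\<And>a b. a \<in> P \<Longrightarrow> b \<in> P \<Longrightarrow> a + b \<in> P" "\<And>r a. a \<in> P \<Longrightarrow> r * a \<in> P"
    using P.is_ideal unfolding ideal_rta_iff by blast+
  have Pdiff: "a - b \<in> P" if "a \<in> P" "b \<in> P" for a b
    using PI(2)[OF that(1) PI(3)[OF that(2), of "- 1"]] by simp
  define \<phi> where "\<phi> = poly_eval const4 (pvar k :: 'k poly4)"
  define \<psi> where "\<psi> = poly_eval \<phi> (pvar l)"
  have phi0: "\<phi> 0 = 0" by (simp add: \<phi>_def)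
  have phi_add: "\<phi> (a + b) = \<phi> a + \<phi> b" for a b
    unfolding \<phi>_def by (rule poly_eval_add) simp_all
  have phi_mult: "\<phi> (a * b) = \<phi> a * \<phi> b" for a b
    unfolding \<phi>_def by (rule poly_eval_mult) simp_all
  have psi_add: "\<psi> (a + b) = \<psi> a + \<psi> b" for a b
    unfolding \<psi>_def by (rule poly_eval_add[OF phi0 phi_add])
  have psi_mult: "\<psi> (a * b) = \<psi> a * \<psi> b" for a b
    unfolding \<psi>_def by (rule poly_eval_mult[OF phi0 phi_add phi_mult])
  have psi_const: "\<psi> [:p:] = \<phi> p" for p
    by (simp add: \<psi>_def poly_eval_pCons phi0)
  have psi_1: "\<psi> 1 = 1"
    using psi_const[of 1] by (simp add: one_pCons \<phi>_def poly_eval_pCons)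
  have psi_diff: "\<psi> (a - b) = \<psi> a - \<psi> b" for a b
    using psi_add[of "a - b" b] by simp
  define J where "J = {r. \<exists>F. r - \<psi> F \<in> P}"
  have surj: "r \<in> J" for r
  proof (rule additive_closed_by_monomials)
    show "0 \<in> J" using PI(1) unfolding J_def by (auto intro!: exI[of _ 0] simp: \<psi>_def)
    show "r + s \<in> J" if rs: "r \<in> J" "s \<in> J" for r s
    proof -
      obtain F G where "r - \<psi> F \<in> P" "s - \<psi> G \<in> P" using rs unfolding J_def by blast
      moreover have "r + s - \<psi> (F + G) = (r - \<psi> F) + (s - \<psi> G)" by (simp add: psi_add)
      ultimately show ?thesis using PI(2) unfolding J_def by (metis (mono_tags, lifting) mem_Collect_eq)
    qed
    fix u
    define c where "c = lookup r u"
    show "mterm u c \<in> J"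
    proof (cases "0 < lookup u i \<or> 0 < lookup u j")
      case True
      then have "mterm u c - \<psi> 0 \<in> P"
        using monomial_in_ideal[OF P.is_ideal ij(1)] monomial_in_ideal[OF P.is_ideal ij(2)] by (auto simp: \<psi>_def)
      then show ?thesis unfolding J_def by blast
    next
      case False
      have u: "u = mterm k (lookup u k) + mterm l (lookup u l)"
      proof (rule poly_mapping_eqI)
        fix x :: 4
        have "x \<in> {i, j, k, l}" using UNIV(1) by blast
        then show "lookup u x = lookup (mterm k (lookup u k) + mterm l (lookup u l)) x"
          using False UNIV(2) by (auto simp: lookup_add lookup_single when_def)
      qed
      have "\<psi> (Polynomial.monom (Polynomial.monom c (lookup u k)) (lookup u l)) = mterm u c"
        by (subst (3) u) (simp add: \<psi>_def \<phi>_def poly_eval_monom pvar_power const4_def mult_single)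
      then have "mterm u c - \<psi> (Polynomial.monom (Polynomial.monom c (lookup u k)) (lookup u l)) \<in> P"
        using PI(1) by simp
      then show ?thesis unfolding J_def by blast
    qed
  qed
  define M where "M = {F. \<psi> F \<in> P}"
  have "\<exists>p. p \<noteq> 0 \<and> [:p:] \<in> M"
  proof (rule maximal_ideal_contains_constant_polynomial)
    show "p + q \<in> M" if "p \<in> M" "q \<in> M" for p q using that PI(2) by (simp add: M_def psi_add)
    show "p * q \<in> M" if "q \<in> M" for p q using that PI(3) by (simp add: M_def psi_mult)
    show "1 \<notin> M" using P.I_notcarr P.one_imp_carrier by (auto simp: M_def psi_1)
    show "\<exists>v. 1 - u * v \<in> M" if u: "u \<notin> M" for u
    proof -
      obtain v where v: "1 - \<psi> u * v \<in> P" using maximalideal_rta_inverse[OF P, of "\<psi> u"] u by (auto simp: M_def)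
      obtain F where F: "v - \<psi> F \<in> P" using surj[of v] unfolding J_def by blast
      have "\<psi> (1 - u * F) = (1 - \<psi> u * v) + \<psi> u * (v - \<psi> F)"
        by (simp add: psi_diff psi_1 psi_mult algebra_simps)
      then have "1 - u * F \<in> M" using PI(2)[OF v PI(3)[OF F]] by (simp add: M_def)
      then show ?thesis by blast
    qed
  qed
  then show ?thesis by (auto simp: M_def psi_const \<phi>_def)
qed

text \<open>
  A polynomial in \<open>x\<^sub>k\<close> lying in \<open>P\<close> is multiplied by \<open>x\<^sub>k\<close> to remove its constant term.
\<close>
lemma maximal_ideal_contains_univariate_family:
  fixes P :: "'k::field poly4 set"
  assumes P: "maximalideal P poly4_ring" and ij: "i \<noteq> j" "pvar i \<in> P" "pvar j \<in> P"
  obtains y where "univariate_family y" "\<And>k. y k \<in> P"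
proof -
  interpret P: maximalideal P "poly4_ring :: 'k poly4 ring" by fact
  have "\<exists>p. p \<noteq> 0 \<and> poly_eval const4 (pvar k) p \<in> P" for k
  proof (cases "k = i \<or> k = j")
    case True
    have "poly_eval const4 (pvar k) [:0, 1:] = (pvar k :: 'k poly4)" by (simp add: poly_eval_pCons)
    then show ?thesis using True ij by (intro exI[of _ "[:0, 1:]"]) auto
  next
    case False
    then have "card {i, j, k} = 3" using ij by (auto simp: card_insert_if)
    then have "card (UNIV - {i, j, k}) = 1" using card_Diff_subset[of "{i, j, k}" UNIV] by simp
    then obtain l where l: "UNIV - {i, j, k} = {l}" by (auto simp: card_1_singleton_iff)
    have "UNIV = {i, j, k} \<union> (UNIV - {i, j, k})" by auto
    then have "UNIV = {i, j, k, l}" unfolding l by auto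
    moreover have "l \<in> UNIV - {i, j, k}" unfolding l by simp
    then have "k \<noteq> l" by auto
    ultimately show ?thesis by (rule maximal_ideal_contains_univariate[OF P ij(2,3)])
  qed
  then obtain p where p: "\<And>k. p k \<noteq> 0" "\<And>k. poly_eval const4 (pvar k) (p k) \<in> P" by metis
  define y where "y k = pvar k * poly_eval const4 (pvar k) (p k)" for k
  have "univariate_family y"
  proof
    fix k
    show "univariate k (y k)" unfolding y_def by (intro univariate_pvar_times univariate_poly_eval_pvar)
    have "lookup (y k) (mterm k 0) = 0" by (simp add: y_def lookup_pvar_times del: single_zero)
    then show "0 \<notin> keys (y k)" by (simp add: in_keys_iff)
    obtain n where "coeff (p k) n \<noteq> 0" using p(1)[of k] by (metis leading_coeff_0_iff)
    then have "lookup (y k) (mterm k (Suc n)) \<noteq> 0" by (simp add: y_def lookup_pvar_times lookup_poly_eval_pvar)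
    then show "y k \<noteq> 0" by auto
  qed
  moreover have "y k \<in> P" for k
    using P.I_l_closed[OF p(2)[of k], of "pvar k"] by (simp add: y_def)
  ultimately show ?thesis by (rule that)
qed

section \<open>Chains of primes over a line\<close>

text \<open>
  Gaussian elimination: one equation is used to eliminate one unknown.
\<close>
lemma underdetermined_system_solution:
  fixes m :: "'t \<Rightarrow> 'b \<Rightarrow> 'k::field"
  assumes "finite B" "finite T" "card B < card T"
  shows "\<exists>\<nu>. (\<exists>t\<in>T. \<nu> t \<noteq> 0) \<and> (\<forall>b\<in>B. (\<Sum>t\<in>T. \<nu> t * m t b) = 0)"
  using assms
proof (induction B arbitrary: T m rule: finite_induct)
  case empty
  then have "T \<noteq> {}" by auto
  then show ?case by (auto intro!: exI[of _ "\<lambda>_. 1"])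
next
  case (insert b B)
  show ?case
  proof (cases "\<forall>t\<in>T. m t b = 0")
    case True
    have "card B < card T" using insert by simp
    then obtain \<nu> where "\<exists>t\<in>T. \<nu> t \<noteq> 0" "\<forall>b\<in>B. (\<Sum>t\<in>T. \<nu> t * m t b) = 0"
      using insert.IH[OF insert.prems(1)] by blast
    then show ?thesis using True by (intro exI[of _ \<nu>]) simp
  next
    case False
    then obtain s where s: "s \<in> T" "m s b \<noteq> 0" by blast
    define S where "S = T - {s}"
    have T: "T = insert s S" "s \<notin> S" "finite S" using s insert.prems by (auto simp: S_def)
    have "card B < card S" using insert T by simp
    then obtain \<nu> where \<nu>: "\<exists>t\<in>S. \<nu> t \<noteq> 0" 
      "\<And>c. c \<in> B \<Longrightarrow> (\<Sum>t\<in>S. \<nu> t * (m t c - m t b / m s b * m s c)) = 0"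
      using insert.IH[OF T(3), of "\<lambda>t c. m t c - m t b / m s b * m s c"] by blast
    define L where "L = (\<Sum>t\<in>S. \<nu> t * (m t b / m s b))"
    define \<mu> where "\<mu> = \<nu>(s := - L)"
    have mu: "(\<Sum>t\<in>T. \<mu> t * m t c) = (\<Sum>t\<in>S. \<nu> t * m t c) - L * m s c" for c
    proof -
      have "(\<Sum>t\<in>S. \<mu> t * m t c) = (\<Sum>t\<in>S. \<nu> t * m t c)"
        using T(2) by (intro sum.cong) (auto simp: \<mu>_def)
      then show ?thesis using T by (simp add: \<mu>_def)
    qed
    have "(\<Sum>t\<in>T. \<mu> t * m t b) = 0"
      using s(2) by (simp add: mu L_def sum_distrib_right)
    moreover have "(\<Sum>t\<in>T. \<mu> t * m t c) = 0" if "c \<in> B" for c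
      using \<nu>(2)[OF that] by (simp add: mu L_def algebra_simps sum_subtractf sum_distrib_right sum_distrib_left)
    moreover have "\<exists>t\<in>T. \<mu> t \<noteq> 0" using \<nu>(1) T by (auto simp: \<mu>_def)
    ultimately show ?thesis by (intro exI[of _ \<mu>]) simp
  qed
qed

lemma keys_power_bound:
  fixes p :: "('n \<Rightarrow>\<^sub>0 nat) \<Rightarrow>\<^sub>0 'k::comm_ring_1"
  assumes "\<And>u. u \<in> keys p \<Longrightarrow> lookup u x \<le> d"
  shows "u \<in> keys (p ^ n) \<Longrightarrow> lookup u x \<le> n * d"
proof (induction n arbitrary: u)
  case (Suc n)
  then obtain v w where "u = v + w" "v \<in> keys p" "w \<in> keys (p ^ n)" by (auto elim: keys_multE)
  then show ?case using assms[of v] Suc.IH[of w] by (simp add: lookup_add)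
qed simp

lemma finite_box:
  fixes D :: nat
  assumes "UNIV = {i, j, k, l}"
  defines "B \<equiv> {u :: 4 \<Rightarrow>\<^sub>0 nat. deg_in {i, j} u = 0 \<and> (\<forall>x. lookup u x \<le> D)}"
  shows "finite B" "card B \<le> (D + 1)\<^sup>2"
proof -
  define f where "f u = (lookup u k, lookup u l)" for u :: "4 \<Rightarrow>\<^sub>0 nat"
  have inj: "inj_on f B"
  proof (rule inj_onI)
    fix u v assume uv: "u \<in> B" "v \<in> B" "f u = f v"
    show "u = v"
    proof (rule poly_mapping_eqI)
      fix x
      have "x \<in> {i, j, k, l}" using assms(1) by blast
      moreover have "lookup u i = 0" "lookup u j = 0" "lookup v i = 0" "lookup v j = 0"
        using uv by (auto simp: B_def deg_in_def)
      ultimately show "lookup u x = lookup v x" using uv(3) by (auto simp: f_def)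
    qed
  qed
  have sub: "f ` B \<subseteq> {..D} \<times> {..D}" by (auto simp: f_def B_def)
  show "finite B" using inj_on_finite[OF inj sub] by simp
  have "card B \<le> card ({..D} \<times> {..D})" using card_inj_on_le[OF inj sub] by simp
  then show "card B \<le> (D + 1)\<^sup>2" by (simp add: power2_eq_square)
qed

lemma sum_triple:
  "(\<Sum>t\<in>A \<times> B \<times> C. h t) = (\<Sum>a\<in>A. \<Sum>b\<in>B. \<Sum>c\<in>C. h (a, b, c))"
  by (simp add: sum.cartesian_product)

text \<open>
  The \<open>(N + 1)\<^sup>3\<close> products of powers up to \<open>N\<close> of the three polynomials reduce, modulo \<open>x\<^sub>i\<close> and \<open>x\<^sub>j\<close>, to
  polynomials in two variables of degree \<open>O(N)\<close> in each, a space of dimension \<open>O(N\<^sup>2)\<close>; so for large \<open>N\<close>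
  they are linearly dependent.
\<close>
lemma three_polynomials_dependent_on_line:
  fixes f g h :: "'k::field poly4"
  assumes UNIV: "UNIV = {i, j, k, l}"
  obtains N and \<nu> :: "nat \<Rightarrow> nat \<Rightarrow> nat \<Rightarrow> 'k" and a b c where "a \<le> N" "b \<le> N" "c \<le> N" "\<nu> a b c \<noteq> 0"
    "(\<Sum>a\<le>N. f ^ a * (\<Sum>b\<le>N. g ^ b * (\<Sum>c\<le>N. h ^ c * const4 (\<nu> a b c)))) \<in> 
      monomial_ideal {u. 1 \<le> deg_in {i, j} u}"
proof -
  define \<phi> :: "'k poly4 \<Rightarrow> 'k poly4" where "\<phi> = restr {u. deg_in {i, j} u = 0}"
  have phi_mult: "\<phi> (p * q) = \<phi> p * \<phi> q" for p q :: "'k poly4" by (simp add: \<phi>_def restr_free_times)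
  have phi_power: "\<phi> (p ^ n) = \<phi> p ^ n" for p :: "'k poly4" and n
    by (induction n) (simp_all add: phi_mult, simp add: \<phi>_def restr_free_one)
  have phi_const: "\<phi> (const4 c) = const4 c" for c :: 'k
    unfolding \<phi>_def const4_def by (rule restr_eq_self) auto
  have phi_sum: "\<phi> (sum F A) = (\<Sum>x\<in>A. \<phi> (F x))" for F :: "'x \<Rightarrow> 'k poly4" and A
    by (simp add: \<phi>_def restr_sum)
  have "finite ((\<lambda>(u, x). lookup u x) ` ((keys f \<union> keys g \<union> keys h) \<times> (UNIV :: 4 set)))" by simp
  then obtain d where "\<forall>n\<in>(\<lambda>(u, x). lookup u x) ` ((keys f \<union> keys g \<union> keys h) \<times> (UNIV :: 4 set)). n \<le> d"
    by (meson finite_nat_set_iff_bounded_le)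
  then have d: "lookup u x \<le> d" if "u \<in> keys f \<union> keys g \<union> keys h" for u x
    using that by force
  \<comment> \<open>This \<open>N\<close> makes \<open>(D + 1)\<^sup>2 \<le> 9 (d + 1)\<^sup>2 (N + 1)\<^sup>2\<close> smaller than \<open>(N + 1)\<^sup>3\<close>.\<close>
  define N where "N = 9 * (d + 1)\<^sup>2"
  define D where "D = 3 * N * d"
  define B where "B = {u :: 4 \<Rightarrow>\<^sub>0 nat. deg_in {i, j} u = 0 \<and> (\<forall>x. lookup u x \<le> D)}"
  let ?T = "{..N} \<times> {..N} \<times> {..N}"
  have "card B \<le> (D + 1)\<^sup>2" "finite B" using finite_box[OF UNIV] by (simp_all add: B_def)
  moreover have "(D + 1)\<^sup>2 < (N + 1) ^ 3"
  proof -
    have "D + 1 \<le> 3 * (d + 1) * (N + 1)" by (simp add: D_def algebra_simps)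
    then have "(D + 1)\<^sup>2 \<le> (3 * (d + 1) * (N + 1))\<^sup>2" by (rule power_mono) simp
    also have "\<dots> = (9 * (d + 1)\<^sup>2) * (N + 1)\<^sup>2"
      by (simp only: power_mult_distrib) simp
    also have "\<dots> = N * (N + 1)\<^sup>2" by (simp only: N_def)
    also have "\<dots> < (N + 1) * (N + 1)\<^sup>2" by simp
    finally show ?thesis by (simp only: power3_eq_cube power2_eq_square mult.assoc)
  qed
  moreover have "card ?T = (N + 1) ^ 3" by (simp add: card_cartesian_product power3_eq_cube)
  ultimately have "finite B" "card B < card ?T" by simp_all
  define m where "m t u = (case t of (a, b, c) \<Rightarrow> lookup (\<phi> f ^ a * (\<phi> g ^ b * \<phi> h ^ c)) u)" for t u
  obtain \<mu> where \<mu>: "\<exists>t\<in>?T. \<mu> t \<noteq> 0" "\<forall>u\<in>B. (\<Sum>t\<in>?T. \<mu> t * m t u) = 0"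
    using underdetermined_system_solution[OF \<open>finite B\<close> _ \<open>card B < card ?T\<close>, of m] by auto
  then obtain a b c where abc: "a \<le> N" "b \<le> N" "c \<le> N" "\<mu> (a, b, c) \<noteq> 0" by auto
  have supp: "m t u = 0" if t: "t \<in> ?T" and u: "u \<notin> B" for t u
  proof (rule ccontr)
    assume nz: "m t u \<noteq> 0"
    obtain a b c where abc: "t = (a, b, c)" "a \<le> N" "b \<le> N" "c \<le> N" using t by auto
    have "u \<in> keys (\<phi> (f ^ a * (g ^ b * h ^ c)))"
      using nz by (simp add: m_def abc in_keys_iff phi_mult phi_power)
    then have uk: "u \<in> keys (f ^ a * (g ^ b * h ^ c))" and u0: "deg_in {i, j} u = 0"
      by (simp_all add: \<phi>_def)
    obtain v w where vw: "u = v + w" "v \<in> keys (f ^ a)" "w \<in> keys (g ^ b * h ^ c)" 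
      using uk by (rule keys_multE)
    obtain x y where xy: "w = x + y" "x \<in> keys (g ^ b)" "y \<in> keys (h ^ c)" 
      using vw(3) by (rule keys_multE)
    have "lookup u z \<le> D" for z
    proof -
      have "lookup v z \<le> a * d" "lookup x z \<le> b * d" "lookup y z \<le> c * d"
        using keys_power_bound[OF _ vw(2), of z d] keys_power_bound[OF _ xy(2), of z d] 
          keys_power_bound[OF _ xy(3), of z d] d by auto
      moreover have "a * d \<le> N * d" "b * d \<le> N * d" "c * d \<le> N * d" 
        using abc by (simp_all only: mult_le_mono1)
      ultimately show ?thesis unfolding vw(1) xy(1) lookup_add D_def by linarith
    qed
    then show False using u u0 by (simp add: B_def)
  qed
  define S where "S = (\<Sum>a\<le>N. f ^ a * (\<Sum>b\<le>N. g ^ b * (\<Sum>c\<le>N. h ^ c * const4 (\<mu> (a, b, c)))))"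
  have "lookup (\<phi> S) u = 0" for u
  proof -
    have const: "lookup (const4 r * q) u = r * lookup q u" for r and q :: "'k poly4"
      using lookup_single_times[of 0 r q u] by (simp add: const4_def)
    have "S = (\<Sum>a\<le>N. \<Sum>b\<le>N. \<Sum>c\<le>N. const4 (\<mu> (a, b, c)) * (f ^ a * (g ^ b * h ^ c)))"
      by (simp add: S_def sum_distrib_left ac_simps)
    then have "lookup (\<phi> S) u = (\<Sum>a\<le>N. \<Sum>b\<le>N. \<Sum>c\<le>N. \<mu> (a, b, c) * m (a, b, c) u)"
      by (simp add: phi_sum phi_mult phi_power phi_const lookup_sum const m_def)
    also have "\<dots> = (\<Sum>t\<in>?T. \<mu> t * m t u)" by (simp add: sum_triple)
    also have "\<dots> = 0" using \<mu>(2) supp by (cases "u \<in> B") auto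
    finally show ?thesis .
  qed
  then have "\<phi> S = 0" by (intro poly_mapping_eqI) simp
  then have "keys (\<phi> S) = {}" by simp
  then have "keys S \<inter> {u. deg_in {i, j} u = 0} = {}" by (simp only: \<phi>_def keys_restr)
  then have "S \<in> monomial_ideal {u. 1 \<le> deg_in {i, j} u}"
    by (auto simp: monomial_ideal_def Suc_le_eq)
  then show ?thesis using that[of a N b c "\<lambda>a b c. \<mu> (a, b, c)"] abc by (simp add: S_def)
qed

text \<open>
  As \<open>f\<close> is not in \<open>Q\<close>, the power \<open>f ^ n\<close> can be cancelled from the sum, and modulo \<open>Q'\<close>, which contains \<open>f\<close>, only
  the term \<open>G n\<close> of the quotient survives.
\<close>
lemma lowest_coefficient_in_larger_prime:
  fixes Q Q' :: "'a::comm_ring_1 set"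
  assumes Q: "primeideal Q ring_of_type_algebra" "f \<notin> Q" and Q': "ideal Q' ring_of_type_algebra" "Q \<subseteq> Q'" "f \<in> Q'"
    and "(\<Sum>a\<le>N. f ^ a * G a) \<in> Q" "n \<le> N" "\<And>a. a < n \<Longrightarrow> G a = 0"
  shows "G n \<in> Q'"
  using assms(6-)
proof (induction N arbitrary: G n)
  case 0
  then show ?case using Q'(2) by auto
next
  case (Suc N)
  define H where "H = (\<Sum>a\<le>N. f ^ a * G (Suc a))"
  have sum: "(\<Sum>a\<le>Suc N. f ^ a * G a) = G 0 + f * H"
    by (simp add: sum.atMost_Suc_shift H_def sum_distrib_left ac_simps del: sum.atMost_Suc)
  show ?case
  proof (cases n)
    case 0
    have "G 0 + f * H \<in> Q'" using Suc.prems(1) Q'(2) sum by auto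
    moreover have "- H * f \<in> Q'" using Q' unfolding ideal_rta_iff by blast
    ultimately have "(G 0 + f * H) + (- H * f) \<in> Q'" using Q'(1) unfolding ideal_rta_iff by blast
    then show ?thesis using 0 by (simp add: mult.commute)
  next
    case (Suc n')
    then have "f * H \<in> Q" using Suc.prems sum by simp
    then have "H \<in> Q" using primeideal.I_prime[OF Q(1), of f H] Q(2) by simp
    then show ?thesis using Suc.IH[of "\<lambda>a. G (Suc a)" n'] Suc Suc.prems by (simp add: H_def)
  qed
qed

lemma least_index:
  fixes P :: "nat \<Rightarrow> bool"
  assumes "P a" "a \<le> N"
  obtains m where "m \<le> N" "P m" "\<And>x. x < m \<Longrightarrow> \<not> P x"
proof (rule that[of "LEAST x. P x"])
  show "(LEAST x. P x) \<le> N" using Least_le[of P a] assms by simp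
  show "P (LEAST x. P x)" using assms(1) by (rule LeastI)
qed (rule not_less_Least)

text \<open>
  Choose one element in each step of the chain and take an algebraic relation between the three.  Going up
  the chain, each step replaces the relation by its lowest coefficient with respect to one of the
  elements; after three steps a nonzero constant lies in the largest prime.
\<close>
lemma no_long_prime_chain_over_line:
  fixes Q :: "nat \<Rightarrow> 'k::field poly4 set"
  assumes Q: "\<And>n. n \<le> 3 \<Longrightarrow> primeideal (Q n) poly4_ring" and strict: "\<And>n. n < 3 \<Longrightarrow> Q n \<subset> Q (Suc n)"
    and ij: "i \<noteq> j" "pvar i \<in> Q 0" "pvar j \<in> Q 0"
  shows False
proof -
  obtain k l where UNIV: "UNIV = {i, j, k, l}"
  proof -
    have "card (UNIV - {i, j}) = 2" using card_Diff_subset[of "{i, j}" UNIV] ij(1) by simp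
    then obtain k l where kl: "UNIV - {i, j} = {k, l}" by (auto simp: card_2_iff)
    have "UNIV = {i, j} \<union> (UNIV - {i, j})" by auto
    then have "UNIV = {i, j, k, l}" unfolding kl by auto
    then show ?thesis by (rule that)
  qed
  have ideal: "ideal (Q n) poly4_ring" if "n \<le> 3" for n using Q[OF that] by (rule primeideal.axioms(1))
  obtain f g h where f: "f \<in> Q 1" "f \<notin> Q 0" and g: "g \<in> Q 2" "g \<notin> Q 1" and h: "h \<in> Q 3" "h \<notin> Q 2"
    using strict[of 0] strict[of 1] strict[of 2] by (auto simp: numeral_2_eq_2 numeral_3_eq_3)
  obtain N \<nu> a b c where abc: "a \<le> N" "b \<le> N" "c \<le> N" "\<nu> a b c \<noteq> (0 :: 'k)"
    and rel: "(\<Sum>a\<le>N. f ^ a * (\<Sum>b\<le>N. g ^ b * (\<Sum>c\<le>N. h ^ c * const4 (\<nu> a b c)))) \<in> 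
      monomial_ideal {u. 1 \<le> deg_in {i, j} u}"
    by (rule three_polynomials_dependent_on_line[OF UNIV, of f g h])
  have M: "p \<in> Q 0" if p: "p \<in> monomial_ideal {u. 1 \<le> deg_in {i, j} u}" for p
  proof (rule additive_closed_by_monomials)
    show "0 \<in> Q 0" "\<And>p q. p \<in> Q 0 \<Longrightarrow> q \<in> Q 0 \<Longrightarrow> p + q \<in> Q 0"
      using ideal[of 0] unfolding ideal_rta_iff by auto
    fix u assume "u \<in> keys p"
    then have "1 \<le> lookup u i + lookup u j" using p ij(1) by (auto simp: monomial_ideal_def deg_in_pair)
    then have "0 < lookup u i \<or> 0 < lookup u j" by linarith
    then show "mterm u (lookup p u) \<in> Q 0"
      using monomial_in_ideal[OF ideal ij(2)] monomial_in_ideal[OF ideal ij(3)] by auto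
  qed
  obtain a0 where a0: "a0 \<le> N" "\<exists>b\<le>N. \<exists>c\<le>N. \<nu> a0 b c \<noteq> 0" 
      and a0': "\<And>a. a < a0 \<Longrightarrow> \<not> (\<exists>b\<le>N. \<exists>c\<le>N. \<nu> a b c \<noteq> 0)"
    by (rule least_index[of "\<lambda>a. \<exists>b\<le>N. \<exists>c\<le>N. \<nu> a b c \<noteq> 0" a N]) (use abc in blast)+
  have a0_least: "\<nu> a b c = 0" if "a < a0" "b \<le> N" "c \<le> N" for a b c
    using a0'[OF that(1)] that(2,3) by blast
  obtain b1 where b1: "b1 \<le> N" "\<exists>c\<le>N. \<nu> a0 b1 c \<noteq> 0" using a0(2) by blast
  obtain b0 where b0: "b0 \<le> N" "\<exists>c\<le>N. \<nu> a0 b0 c \<noteq> 0" and b0': "\<And>b. b < b0 \<Longrightarrow> \<not> (\<exists>c\<le>N. \<nu> a0 b c \<noteq> 0)"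
    by (rule least_index[of "\<lambda>b. \<exists>c\<le>N. \<nu> a0 b c \<noteq> 0" b1 N]) (use b1 in blast)+
  have b0_least: "\<nu> a0 b c = 0" if "b < b0" "c \<le> N" for b c
    using b0'[OF that(1)] that(2) by blast
  obtain c1 where c1: "c1 \<le> N" "\<nu> a0 b0 c1 \<noteq> 0" using b0(2) by blast
  obtain c0 where c0: "c0 \<le> N" "\<nu> a0 b0 c0 \<noteq> 0" and c0': "\<And>c. c < c0 \<Longrightarrow> \<not> \<nu> a0 b0 c \<noteq> 0"
    by (rule least_index[of "\<lambda>c. \<nu> a0 b0 c \<noteq> 0" c1 N]) (use c1 in blast)+
  have c0_least: "\<nu> a0 b0 c = 0" if "c < c0" for c
    using c0'[OF that] by blast
  have 1: "(\<Sum>b\<le>N. g ^ b * (\<Sum>c\<le>N. h ^ c * const4 (\<nu> a0 b c))) \<in> Q 1"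
    using lowest_coefficient_in_larger_prime[where Q = "Q 0" and Q' = "Q 1" and f = f 
        and G = "\<lambda>a. (\<Sum>b\<le>N. g ^ b * (\<Sum>c\<le>N. h ^ c * const4 (\<nu> a b c)))", OF Q f(2) ideal _ f(1) M[OF rel] a0(1)]
      strict[of 0] a0_least by auto
  have 2: "(\<Sum>c\<le>N. h ^ c * const4 (\<nu> a0 b0 c)) \<in> Q 2"
    using lowest_coefficient_in_larger_prime[where Q = "Q 1" and Q' = "Q 2" and f = g 
        and G = "\<lambda>b. (\<Sum>c\<le>N. h ^ c * const4 (\<nu> a0 b c))", OF Q g(2) ideal _ g(1) 1, of b0]
      strict[of 1] b0 b0_least by (auto simp: numeral_2_eq_2)
  have "const4 (\<nu> a0 b0 c0) \<in> Q 3"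
    using lowest_coefficient_in_larger_prime[where Q = "Q 2" and Q' = "Q 3" and f = h 
        and G = "\<lambda>c. const4 (\<nu> a0 b0 c)", OF Q h(2) ideal _ h(1) 2, of c0]
      strict[of 2] c0 c0_least by (auto simp: numeral_3_eq_3)
  then have "const4 (inverse (\<nu> a0 b0 c0)) * const4 (\<nu> a0 b0 c0) \<in> Q 3"
    using ideal[of 3] unfolding ideal_rta_iff by blast
  then have "1 \<in> Q 3" using c0 by (simp flip: const4_hom(4))
  then show False using primeideal.I_notcarr[OF Q[of 3]] ideal.one_imp_carrier[OF ideal[of 3]] by simp
qed

section \<open>Cohen-Macaulayness without gaps\<close>

definition lines_ideal :: "(4 set \<Rightarrow> nat) \<Rightarrow> 'k::field poly4 set" where
  "lines_ideal a = {p. \<forall>e. card e = 2 \<longrightarrow> p \<in> edge_ideal e (a e)}"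

definition gap :: "(4 set \<Rightarrow> nat) \<Rightarrow> 4 set \<Rightarrow> (4 \<Rightarrow>\<^sub>0 nat) \<Rightarrow> bool" where
  "gap a e u \<longleftrightarrow> card e = 2 \<and> deg_in e u < a e \<and> deg_in (- e) u < a (- e) \<and>
     (\<forall>e'. card e' = 2 \<and> e' \<noteq> e \<and> e' \<noteq> - e \<longrightarrow> a e' \<le> deg_in e' u)"

lemma lines_ideal_eq_monomial_ideal:
  "lines_ideal a = monomial_ideal {u. \<forall>e. card e = 2 \<longrightarrow> a e \<le> deg_in e u}"
  by (auto simp: lines_ideal_def edge_ideal_def monomial_ideal_def)

lemma ideal_lines_ideal: "ideal (lines_ideal a :: 'k::field poly4 set) poly4_ring"
  unfolding lines_ideal_eq_monomial_ideal
  by (rule ideal_monomial_ideal) (auto simp: up_closed_def intro: trans_le_add1)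

lemma pvar_power_in_edge_ideal:
  assumes "x \<in> e"
  shows "(pvar x :: 'k::field poly4) ^ n \<in> edge_ideal e n"
  using assms by (simp add: pvar_power edge_ideal_def monomial_ideal_def deg_in_mterm)

lemma edge_ideal_mult: "q \<in> edge_ideal e n \<Longrightarrow> p * q \<in> edge_ideal e n"
  unfolding edge_ideal_def by (rule monomial_ideal_mult[OF up_closed_deg_in])

text \<open>
  The ideal \<open>I\<close> contains all products of one element from each \<open>J e\<close>, so \<open>P\<close> contains some \<open>J e\<close> and with it
  powers of both variables of \<open>e\<close>.
\<close>
lemma prime_over_lines_contains_line:
  fixes P :: "'k::field poly4 set"
  assumes P: "primeideal P poly4_ring" and sub: "lines_ideal a \<subseteq> P"
  obtains i j where "i \<noteq> j" "pvar i \<in> P" "pvar j \<in> P"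
proof -
  interpret P: primeideal P "poly4_ring :: 'k poly4 ring" by fact
  have one: "1 \<notin> P" using P.I_notcarr P.one_imp_carrier by auto
  have prime: "p \<in> P \<or> q \<in> P" if "p * q \<in> P" for p q using P.I_prime[of p q] that by simp
  have power: "p ^ n \<notin> P" if "p \<notin> P" for p n
    by (induction n) (use one prime that in auto)
  have "\<exists>i j. i \<noteq> j \<and> pvar i \<in> P \<and> pvar j \<in> P"
  proof (rule ccontr)
    assume none: "\<not> (\<exists>i j. i \<noteq> j \<and> pvar i \<in> P \<and> pvar j \<in> P)"
    let ?E = "{e :: 4 set. card e = 2}"
    have ex: "\<exists>p. p \<in> edge_ideal e (a e) \<and> p \<notin> P" if e: "e \<in> ?E" for e
    proof -
      obtain i j where ij: "e = {i, j}" "i \<noteq> j" using e by (auto simp: card_2_iff)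
      then obtain x where "x \<in> e" "pvar x \<notin> P" using none by blast
      then show ?thesis using pvar_power_in_edge_ideal power by blast
    qed
    define p where "p e = (SOME p. p \<in> edge_ideal e (a e) \<and> p \<notin> P)" for e
    have p: "p e \<in> edge_ideal e (a e) \<and> p e \<notin> P" if "e \<in> ?E" for e
      unfolding p_def by (rule someI_ex[OF ex[OF that]])
    have prod: "prod p A \<notin> P" if "finite A" "A \<subseteq> ?E" for A
      using that
    proof (induction A rule: finite_induct)
      case (insert e A)
      then have "p e \<notin> P" "prod p A \<notin> P" using p by auto
      then show ?case using prime insert by auto
    qed (simp add: one)
    have "prod p ?E \<in> edge_ideal e (a e)" if e: "card e = 2" for e
    proof -
      have "prod p ?E = prod p (?E - {e}) * p e"
        using e by (simp add: prod.remove[of ?E e p] mult.commute)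
      then show ?thesis using edge_ideal_mult[of "p e" e "a e"] p[of e] e by simp
    qed
    then have "prod p ?E \<in> P" using sub by (auto simp: lines_ideal_def)
    then show False using prod[of ?E] by simp
  qed
  then obtain i j where "i \<noteq> j" "pvar i \<in> P" "pvar j \<in> P" by (elim exE conjE)
  then show ?thesis by (rule that)
qed

lemma sum_vars_in_ideal:
  fixes P :: "'k::field poly4 set"
  assumes P: "ideal P poly4_ring" and y: "\<And>k. y k \<in> P"
  shows "sum_vars y \<in> P" "sum_pairs y \<in> P"
proof -
  have PI: "0 \<in> P" "\<And>a b. a \<in> P \<Longrightarrow> b \<in> P \<Longrightarrow> a + b \<in> P" "\<And>r a. a \<in> P \<Longrightarrow> r * a \<in> P"
    using P unfolding ideal_rta_iff by blast+
  have sum: "sum f A \<in> P" if "\<And>x. x \<in> A \<Longrightarrow> f x \<in> P" for f :: "'x \<Rightarrow> 'k poly4" and A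
    using that by (induction A rule: infinite_finite_induct) (simp_all add: PI(1,2))
  show "sum_vars y \<in> P" unfolding sum_vars_def by (rule sum) (rule y)
  show "sum_pairs y \<in> P" unfolding sum_pairs_def
  proof (rule sum)
    fix S :: "4 set" assume "S \<in> {S. card S = 2}"
    then obtain k l where "S = {k, l}" "k \<noteq> l" by (auto simp: card_2_iff)
    then have "prod y S = y k * y l" by simp
    then show "prod y S \<in> P" using PI(3)[OF y[of l], of "y k"] by simp
  qed
qed

lemma prime_height_le_2:
  assumes P: "primeideal P (poly4_ring Quot (lines_ideal a :: 'k::field poly4 set))"
  shows "prime_height (poly4_ring Quot (lines_ideal a :: 'k poly4 set)) P \<le> 2"
proof -
  interpret A: rta_quotient "lines_ideal a :: 'k poly4 set"
    by (rule rta_quotient.intro[OF ideal_lines_ideal])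
  show ?thesis
    unfolding prime_height_def
  proof (rule Sup_least, clarify)
    fix n and Q :: "nat \<Rightarrow> 'k poly4 set set"
    assume Q: "\<forall>i\<le>n. primeideal (Q i) A.Q" "\<forall>i<n. Q i \<subset> Q (Suc i)" "P = Q n"
    show "enat n \<le> 2"
    proof (rule ccontr)
      assume "\<not> enat n \<le> 2"
      then have n: "3 \<le> n" by (metis enat_numeral enat_ord_simps(1) not_less_eq_eq numeral_2_eq_2 numeral_3_eq_3)
      define V where "V i = A.vimage_ideal (Q i)" for i
      have V: "primeideal (V i) poly4_ring" if "i \<le> 3" for i
        unfolding V_def using Q(1) that n by (intro A.primeideal_vimage) auto
      have strict: "V i \<subset> V (Suc i)" if "i < 3" for i
        unfolding V_def using Q that n
        by (intro A.vimage_ideal_strict_mono A.ideal_subset_carrier primeideal.axioms(1)) auto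
      have sub: "lines_ideal a \<subseteq> V 0"
        unfolding V_def using Q(1) by (intro A.I_subset_vimage primeideal.axioms(1)) auto
      have "primeideal (V 0) poly4_ring" by (rule V) simp
      then obtain i j where ij: "i \<noteq> j" "pvar i \<in> V 0" "pvar j \<in> V 0"
        using sub by (rule prime_over_lines_contains_line)
      show False by (rule no_long_prime_chain_over_line[where Q = V, OF V strict ij])
    qed
  qed
qed

lemma ideal_depth_ge_2:
  assumes P: "maximalideal P (poly4_ring Quot (lines_ideal a :: 'k::field poly4 set))"
    and no_gap: "\<And>e u. \<not> gap a e u"
  shows "2 \<le> ideal_depth (poly4_ring Quot (lines_ideal a :: 'k poly4 set)) P"
proof -
  let ?I = "lines_ideal a :: 'k poly4 set"
  interpret A: rta_quotient ?I
    by (rule rta_quotient.intro[OF ideal_lines_ideal])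
  interpret P: maximalideal P A.Q by fact
  have V: "maximalideal (A.vimage_ideal P) poly4_ring" by (rule A.maximalideal_vimage[OF P])
  have V': "primeideal (A.vimage_ideal P) poly4_ring"
    by (rule cring.maximalideal_prime[OF A.cring_R V])
  have sub: "?I \<subseteq> A.vimage_ideal P" by (rule A.I_subset_vimage[OF P.is_ideal])
  obtain i j where ij: "i \<noteq> j" "pvar i \<in> A.vimage_ideal P" "pvar j \<in> A.vimage_ideal P"
    by (rule prime_over_lines_contains_line[OF V' sub])
  obtain y where y: "univariate_family y" "\<And>k. y k \<in> A.vimage_ideal P"
    by (rule maximal_ideal_contains_univariate_family[OF V ij]) blast
  have fg: "A.proj (sum_vars y) \<in> P" "A.proj (sum_pairs y) \<in> P"
    using sum_vars_in_ideal[OF maximalideal.axioms(1)[OF V], of y] y(2) by (auto simp: A.vimage_ideal_def)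
  have "regular_sequence A.Q [A.proj (sum_vars y), A.proj (sum_pairs y)]"
    unfolding A.regular_sequence_pair_iff
  proof (intro conjI allI impI)
    have Idl_P: "Idl\<^bsub>A.Q\<^esub> {A.proj (sum_vars y), A.proj (sum_pairs y)} \<subseteq> P"
      using fg by (intro ring.genideal_minimal[OF cring.axioms(1)[OF A.cring_Q] P.is_ideal]) auto
    show "Idl\<^bsub>A.Q\<^esub> {A.proj (sum_vars y), A.proj (sum_pairs y)} \<noteq> carrier A.Q"
    proof
      assume eq: "Idl\<^bsub>A.Q\<^esub> {A.proj (sum_vars y), A.proj (sum_pairs y)} = carrier A.Q"
      have "carrier A.Q = P"
        by (rule equalityI[OF Idl_P[unfolded eq] A.ideal_subset_carrier[OF P.is_ideal]])
      then show False using P.I_notcarr by simp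
    qed
    show "u \<in> ?I" if "sum_vars y * u \<in> ?I" for u
      using sum_vars_nonzerodivisor_mod_lines[OF y(1), of u a] that by (simp add: lines_ideal_def)
    show "\<exists>w. u - sum_vars y * w \<in> ?I" if uv: "sum_pairs y * u - sum_vars y * v \<in> ?I" for u v
    proof -
      have "\<exists>e'. card e' = 2 \<and> e' \<noteq> e \<and> e' \<noteq> - e \<and> deg_in e' u < a e'"
        if "card e = 2" "deg_in e u < a e" "deg_in (- e) u < a (- e)" for e u
        using no_gap[of e u] that unfolding gap_def by (meson not_le)
      then show ?thesis
        using sum_pairs_regular_mod_lines[OF y(1), of a u v] uv unfolding lines_ideal_def by blast
    qed
  qed
  then have "enat (length [A.proj (sum_vars y), A.proj (sum_pairs y)]) \<le> ideal_depth A.Q P"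
    unfolding ideal_depth_def using fg by (intro Sup_upper CollectI exI conjI) auto
  then show ?thesis by (simp add: numeral_eq_enat eval_nat_numeral)
qed

theorem no_gap_imp_cohen_macaulay:
  assumes "\<And>e u. \<not> gap a e u"
  shows "cohen_macaulay_ring (poly4_ring Quot (lines_ideal a :: 'k::field poly4 set))"
proof -
  let ?I = "lines_ideal a :: 'k poly4 set"
  interpret A: rta_quotient ?I
    by (rule rta_quotient.intro[OF ideal_lines_ideal])
  have noeth: "noetherian_ring A.Q"
    by (rule noetherian_quotient[OF noetherian_polynomials ideal_lines_ideal])
  show ?thesis
    unfolding cohen_macaulay_ring_def
  proof (intro conjI allI impI A.cring_Q noeth)
    fix P assume P: "maximalideal P A.Q"
    have prime: "primeideal P A.Q" by (rule cring.maximalideal_prime[OF A.cring_Q P])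
    have "2 \<le> ideal_depth A.Q P" using P assms by (rule ideal_depth_ge_2)
    moreover have "ideal_depth A.Q P \<le> prime_height A.Q P"
      by (rule cring.ideal_depth_le_prime_height[OF A.cring_Q noeth prime])
    moreover have "prime_height A.Q P \<le> 2" by (rule prime_height_le_2[OF prime])
    ultimately show "ideal_depth A.Q P = prime_height A.Q P" by (meson order_antisym order_trans)
  qed
qed

section \<open>A gap destroys Cohen-Macaulayness\<close>
text \<open>
  The prime ideal generated by the variables with index in \<open>V\<close>.
\<close>
definition coord_prime :: "4 set \<Rightarrow> 'k::field poly4 set" where
  "coord_prime V = monomial_ideal {u. 1 \<le> deg_in V u}"

lemma coord_prime_iff: "p \<in> coord_prime V \<longleftrightarrow> restr {u. deg_in V u = 0} p = 0"
proof
  assume "p \<in> coord_prime V"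
  then show "restr {u. deg_in V u = 0} p = 0"
    by (intro restr_eq_0) (auto simp: coord_prime_def monomial_ideal_def)
next
  assume "restr {u. deg_in V u = 0} p = 0"
  then have "keys (restr {u. deg_in V u = 0} p) = {}" by simp
  then have "keys p \<inter> {u. deg_in V u = 0} = {}" by (simp only: keys_restr)
  then show "p \<in> coord_prime V" by (auto simp: coord_prime_def monomial_ideal_def Suc_le_eq)
qed

lemma primeideal_coord_prime: "primeideal (coord_prime V :: 'k::field poly4 set) poly4_ring"
proof (rule primeidealI)
  show "ideal (coord_prime V :: 'k poly4 set) poly4_ring"
    unfolding coord_prime_def by (rule ideal_monomial_ideal[OF up_closed_deg_in])
  show "cring (poly4_ring :: 'k poly4 ring)" by (rule cring_rta)
  have "1 \<notin> (coord_prime V :: 'k poly4 set)" by (simp add: coord_prime_iff restr_free_one)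
  then show "carrier poly4_ring \<noteq> (coord_prime V :: 'k poly4 set)" by auto
  fix p q :: "'k poly4" assume "p \<otimes>\<^bsub>poly4_ring\<^esub> q \<in> coord_prime V"
  then show "p \<in> coord_prime V \<or> q \<in> coord_prime V" by (simp add: coord_prime_iff restr_free_times)
qed

lemma pvar_in_coord_prime_iff: "(pvar x :: 'k::field poly4) \<in> coord_prime V \<longleftrightarrow> x \<in> V"
  by (simp add: coord_prime_def monomial_ideal_def pvar_def deg_in_mterm)

lemma coord_prime_mono: 
  assumes "V \<subset> W"
  shows "(coord_prime V :: 'k::field poly4 set) \<subset> coord_prime W"
proof -
  have "deg_in V u \<le> deg_in W u" for u
    unfolding deg_in_def using assms by (intro sum_mono2) auto
  then have "coord_prime V \<subseteq> (coord_prime W :: 'k poly4 set)"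
    unfolding coord_prime_def monomial_ideal_def by (auto intro: order_trans)
  moreover obtain x where "x \<in> W" "x \<notin> V" using assms by blast
  then have "(pvar x :: 'k poly4) \<in> coord_prime W" "(pvar x :: 'k poly4) \<notin> coord_prime V"
    by (simp_all add: pvar_in_coord_prime_iff)
  ultimately show ?thesis by blast
qed

lemma deg_in_Compl: "deg_in UNIV u = deg_in e u + deg_in (- e) u"
  unfolding deg_in_def using sum.union_disjoint[of e "- e" "lookup u"] by (simp add: Compl_partition)

text \<open>
  Multiplication by the monomial \<open>x\<close> of the gap kills all products of a polynomial in the variables of \<open>- e\<close>
  without constant term and a polynomial whose terms all involve \<open>e\<close>.  Hence \<open>\<phi> p = x * l p\<close> satisfies
  \<open>g * \<phi> f = f * \<phi> g\<close> modulo \<open>I\<close>, and regularity of \<open>f, g\<close> yields \<open>s\<close> with \<open>\<phi> p = p * s\<close> for all \<open>p\<close>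
  without constant term.  For a variable of \<open>e\<close> this forces the coefficient of \<open>s\<close> at \<open>u\<close> to be 1, for a variable
  of \<open>- e\<close> it forces it to be 0.
\<close>
lemma gap_no_regular_pair:
  fixes f g :: "'k::field poly4"
  assumes gap: "gap a e u" and eq: "deg_in e u + 1 = a e" "deg_in (- e) u + 1 = a (- e)"
    and f: "f \<in> coord_prime UNIV" and g: "g \<in> coord_prime UNIV"
    and nzd: "\<And>p. f * p \<in> lines_ideal a \<Longrightarrow> p \<in> lines_ideal a"
    and reg: "\<And>p q. g * p - f * q \<in> lines_ideal a \<Longrightarrow> \<exists>w. p - f * w \<in> lines_ideal a"
  shows False
proof -
  let ?I = "lines_ideal a :: 'k poly4 set"
  have I: "0 \<in> ?I" "p \<in> ?I \<Longrightarrow> q \<in> ?I \<Longrightarrow> p + q \<in> ?I" "q \<in> ?I \<Longrightarrow> p * q \<in> ?I" for p q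
    using ideal_lines_ideal[of a] unfolding ideal_rta_iff by blast+
  have Idiff: "p - q \<in> ?I" if "p \<in> ?I" "q \<in> ?I" for p q
    using I(2)[OF that(1) I(3)[OF that(2), of "- 1"]] by simp
  define x where "x = (mterm u 1 :: 'k poly4)"
  define l :: "'k poly4 \<Rightarrow> 'k poly4" where "l = restr (- {v. deg_in e v = 0})"
  define r :: "'k poly4 \<Rightarrow> 'k poly4" where "r = restr {v. deg_in e v = 0}"
  have lr: "p = l p + r p" for p unfolding l_def r_def by (metis restr_split add.commute)
  have xI: "x * (r p * l q) \<in> ?I" if p: "p \<in> coord_prime UNIV" for p q
    unfolding lines_ideal_eq_monomial_ideal monomial_ideal_def
  proof clarify
    fix v and e' :: "4 set" assume v: "v \<in> keys (x * (r p * l q))" and e': "card e' = 2"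
    obtain w where w: "v = u + w" "w \<in> keys (r p * l q)"
      using v by (auto simp: x_def elim: keys_multE split: if_splits)
    obtain s t where st: "w = s + t" "s \<in> keys (r p)" "t \<in> keys (l q)" using w(2) by (rule keys_multE)
    have "1 \<le> deg_in UNIV s" "deg_in e s = 0"
      using st(2) p by (auto simp: r_def coord_prime_def monomial_ideal_def)
    then have s: "1 \<le> deg_in (- e) s" using deg_in_Compl[of s e] by simp
    have t: "1 \<le> deg_in e t" using st(3) by (simp add: l_def)
    consider "e' = e" | "e' = - e" | "a e' \<le> deg_in e' u" using gap e' unfolding gap_def by blast
    then show "a e' \<le> deg_in e' v"
      using eq s t by cases (simp_all add: w(1) st(1))
  qed
  have "g * (x * l f) - f * (x * l g) = x * (r g * l f) - x * (r f * l g)"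
  proof -
    have "g * (x * l f) - f * (x * l g) = (l g + r g) * (x * l f) - (l f + r f) * (x * l g)"
      using lr[of g] lr[of f] by simp
    then show ?thesis by (simp add: algebra_simps)
  qed
  also have "\<dots> \<in> ?I" by (intro Idiff xI f g)
  finally obtain s where s: "x * l f - f * s \<in> ?I" using reg by blast
  have mult: "x * l p - p * s \<in> ?I" if p: "p \<in> coord_prime UNIV" for p
  proof (rule nzd)
    have "f * (x * l p - p * s) = p * (x * l f - f * s) + (f * (x * l p) - p * (x * l f))"
      by (simp add: algebra_simps)
    also have "f * (x * l p) - p * (x * l f) = (l f + r f) * (x * l p) - (l p + r p) * (x * l f)"
      using lr[of f] lr[of p] by simp
    also have "\<dots> = x * (r f * l p) - x * (r p * l f)" by (simp add: algebra_simps)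
    also have "p * (x * l f - f * s) + (x * (r f * l p) - x * (r p * l f)) \<in> ?I"
      by (intro I(2) I(3)[OF s] Idiff xI f p)
    finally show "f * (x * l p - p * s) \<in> ?I" .
  qed
  have pvar_U: "(pvar z :: 'k poly4) \<in> coord_prime UNIV" for z by (simp add: pvar_in_coord_prime_iff)
  have card: "card e = 2" "card (- e) = 2" using gap card_Compl_edge by (auto simp: gap_def)
  have lp: "l (pvar z) = (if z \<in> e then pvar z else 0)" for z
    unfolding l_def pvar_def
    by (auto intro!: restr_eq_self restr_eq_0 simp: deg_in_mterm)
  have shift: "lookup (pvar z * p) (mterm z 1 + u) = lookup p u" for z and p :: "'k poly4"
    using lookup_single_times[of "mterm z 1" 1 p u] by (simp add: pvar_def)
  obtain i where i: "i \<in> e" using card(1) by (metis card.empty ex_in_conv zero_neq_numeral)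
  obtain k where k: "k \<in> - e" using card(2) by (metis card.empty ex_in_conv zero_neq_numeral)
  have notin: "mterm i 1 + u \<notin> keys p" "mterm k 1 + u \<notin> keys p" if p: "p \<in> ?I" for p
  proof -
    have *: "a e' \<le> deg_in e' v" if "v \<in> keys p" "card e' = 2" for v e'
      using p that unfolding lines_ideal_eq_monomial_ideal monomial_ideal_def by blast
    show "mterm i 1 + u \<notin> keys p" 
      using *[of "mterm i 1 + u" "- e"] card i eq(2) by (auto simp: deg_in_mterm)
    show "mterm k 1 + u \<notin> keys p" 
      using *[of "mterm k 1 + u" e] card k eq(1) by (auto simp: deg_in_mterm)
  qed
  have "pvar i * (x - s) \<in> ?I"
    using mult[OF pvar_U, of i] i by (simp add: lp algebra_simps)
  then have "mterm i 1 + u \<notin> keys (pvar i * (x - s))" by (rule notin(1))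
  then have "lookup (x - s) u = 0" by (simp only: in_keys_iff shift not_not)
  then have "lookup s u = 1" by (simp add: x_def lookup_minus)
  have "pvar k * (- s) \<in> ?I"
    using mult[OF pvar_U, of k] k by (simp add: lp)
  then have "mterm k 1 + u \<notin> keys (pvar k * (- s))" by (rule notin(2))
  then have "lookup (- s) u = 0" by (simp only: in_keys_iff shift not_not)
  then show False using \<open>lookup s u = 1\<close> by simp
qed

text \<open>
  Raising one exponent in \<open>e\<close> and one in \<open>- e\<close> cannot leave the four other ideals.
\<close>
lemma gap_saturate:
  assumes "gap a e u"
  obtains v where "gap a e v" "deg_in e v + 1 = a e" "deg_in (- e) v + 1 = a (- e)"
proof -
  have card: "card e = 2" "card (- e) = 2" using assms card_Compl_edge by (auto simp: gap_def)
  obtain i where i: "i \<in> e" using card(1) by (metis card.empty ex_in_conv zero_neq_numeral)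
  obtain k where k: "k \<in> - e" using card(2) by (metis card.empty ex_in_conv zero_neq_numeral)
  define v where "v = u + (mterm i (a e - 1 - deg_in e u) + mterm k (a (- e) - 1 - deg_in (- e) u))"
  have eq: "deg_in e v + 1 = a e" "deg_in (- e) v + 1 = a (- e)"
    using assms i k by (auto simp: v_def gap_def deg_in_mterm)
  have mono: "deg_in e' u \<le> deg_in e' v" for e' by (simp add: v_def)
  have "gap a e v"
    unfolding gap_def
  proof (intro conjI allI impI)
    fix e' assume "card e' = 2 \<and> e' \<noteq> e \<and> e' \<noteq> - e"
    then have "a e' \<le> deg_in e' u" using assms by (simp add: gap_def)
    then show "a e' \<le> deg_in e' v" using mono by (rule order_trans)
  qed (use card eq in simp_all)
  then show ?thesis using eq by (rule that)
qed

text \<open>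
  The failure occurs at the origin: the three primes generated by the variables in \<open>e\<close>, by these and one more
  variable, and by all variables show that the height is at least 2.
\<close>
theorem gap_imp_not_cohen_macaulay:
  assumes "gap a e u"
  shows "\<not> cohen_macaulay_ring (poly4_ring Quot (lines_ideal a :: 'k::field poly4 set))"
proof
  let ?I = "lines_ideal a :: 'k poly4 set"
  interpret A: rta_quotient ?I
    by (rule rta_quotient.intro[OF ideal_lines_ideal])
  interpret Q: cring A.Q by (rule A.cring_Q)
  assume CM: "cohen_macaulay_ring A.Q"
  obtain v where v: "gap a e v" "deg_in e v + 1 = a e" "deg_in (- e) v + 1 = a (- e)"
    using assms by (rule gap_saturate)
  have card: "card e = 2" "card (- e) = 2" using assms card_Compl_edge by (auto simp: gap_def)
  obtain k l where kl: "- e = {k, l}" "k \<noteq> l" using card(2) by (auto simp: card_2_iff)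
  have sub_e: "?I \<subseteq> coord_prime e"
  proof
    fix p assume "p \<in> ?I"
    then have "p \<in> edge_ideal e (a e)" using card(1) by (simp add: lines_ideal_def)
    then show "p \<in> coord_prime e" using v(2) by (auto simp: edge_ideal_def coord_prime_def monomial_ideal_def)
  qed
  have "k \<in> - e" "l \<in> - e" unfolding kl(1) by simp_all
  then have "k \<notin> e" "l \<notin> insert k e" using kl(2) by simp_all
  then have ek: "e \<subset> insert k e" "insert k e \<subset> UNIV"
    by (simp_all only: psubset_insert_iff psubset_eq) auto
  define V where "V n = (if n = 0 then e else if n = 1 then insert k e else UNIV)" for n :: nat
  have V_sub: "?I \<subseteq> coord_prime (V n)" for n
  proof -
    have "e = V n \<or> e \<subset> V n" using ek by (auto simp: V_def)
    then show ?thesis using sub_e coord_prime_mono[of e "V n", where 'k = 'k] by blast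
  qed
  define C where "C n = A.proj ` coord_prime (V n)" for n
  have C: "primeideal (C n) A.Q" "A.vimage_ideal (C n) = coord_prime (V n)" for n
    unfolding C_def by (rule A.primeideal_image[OF primeideal_coord_prime V_sub])+
  have C_strict: "C n \<subset> C (Suc n)" if "n < 2" for n
  proof -
    have "V n \<subset> V (Suc n)" using that ek by (auto simp: V_def less_2_cases_iff)
    then have "coord_prime (V n) \<subset> (coord_prime (V (Suc n)) :: 'k poly4 set)" by (rule coord_prime_mono)
    moreover from this have "C n \<subseteq> C (Suc n)" unfolding C_def by blast
    moreover have "C n \<noteq> C (Suc n)"
    proof
      assume "C n = C (Suc n)"
      then have "coord_prime (V n) = (coord_prime (V (Suc n)) :: 'k poly4 set)"
        using C(2)[of n] C(2)[of "Suc n"] by simp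
      then show False using calculation(1) by simp
    qed
    ultimately show ?thesis by (simp add: psubset_eq)
  qed
  define P where "P = C 2"
  have PV: "A.vimage_ideal P = coord_prime UNIV" unfolding P_def C(2) by (simp add: V_def)
  have max: "maximalideal P A.Q"
  proof (rule maximalidealI)
    show P_ideal: "ideal P A.Q" unfolding P_def by (rule primeideal.axioms(1)[OF C(1)])
    show "carrier A.Q \<noteq> P" unfolding P_def by (rule primeideal.I_notcarr[OF C(1)])
    fix J assume J: "ideal J A.Q" "P \<subseteq> J" "J \<subseteq> carrier A.Q"
    have VJ: "ideal (A.vimage_ideal J) poly4_ring" by (rule A.ideal_vimage_ideal[OF J(1)])
    have sub: "coord_prime UNIV \<subseteq> A.vimage_ideal J"
      using J(2) unfolding PV[symmetric] by (auto simp: A.vimage_ideal_def)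
    show "J = P \<or> J = carrier A.Q"
    proof (cases "A.vimage_ideal J \<subseteq> coord_prime UNIV")
      case True
      then have "A.vimage_ideal J = A.vimage_ideal P" using sub PV by blast
      then have "A.proj ` A.vimage_ideal J = A.proj ` A.vimage_ideal P" by (rule arg_cong)
      then have "J = P" 
        unfolding A.image_vimage_ideal[OF J(3)] A.image_vimage_ideal[OF A.ideal_subset_carrier[OF P_ideal]] .
      then show ?thesis ..
    next
      case False
      then obtain p where p: "p \<in> A.vimage_ideal J" "p \<notin> coord_prime UNIV" by blast
      then have "\<exists>z\<in>keys p. deg_in UNIV z = 0"
        by (auto simp: coord_prime_def monomial_ideal_def Suc_le_eq)
      then obtain z where z: "z \<in> keys p" "deg_in UNIV z = 0" by blast
      have "z = 0" using z(2) by (intro poly_mapping_eqI) (simp add: deg_in_def)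
      define c where "c = lookup p 0"
      have c: "c \<noteq> 0" using z \<open>z = 0\<close> by (simp add: c_def in_keys_iff)
      have "p - const4 c \<in> coord_prime UNIV"
        unfolding coord_prime_def monomial_ideal_def
      proof clarify
        fix v assume "v \<in> keys (p - const4 c)"
        then have "v \<noteq> 0" by (auto simp: in_keys_iff lookup_minus const4_def c_def)
        then obtain t where "lookup v t \<noteq> 0" by (metis lookup_zero poly_mapping_eqI)
        then show "1 \<le> deg_in UNIV v" by (auto simp: deg_in_def Suc_le_eq intro!: sum_pos2[of _ t])
      qed
      then have "p - const4 c \<in> A.vimage_ideal J" using sub by blast
      then have "p + (- 1) * (p - const4 c) \<in> A.vimage_ideal J"
        using VJ p(1) unfolding ideal_rta_iff by blast
      then have "const4 (inverse c) * const4 c \<in> A.vimage_ideal J"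
        using VJ unfolding ideal_rta_iff by simp
      then have "1 \<in> A.vimage_ideal J" using c by (simp flip: const4_hom(4))
      then have "\<one>\<^bsub>A.Q\<^esub> \<in> J" by (simp add: A.vimage_ideal_def)
      then show ?thesis using ideal.one_imp_carrier[OF J(1)] by blast
    qed
  qed
  have "enat 2 \<le> prime_height A.Q P"
    unfolding prime_height_def using C(1) C_strict
    by (intro Sup_upper CollectI exI[of _ 2] conjI exI[of _ C]) (auto simp: P_def)
  also have "\<dots> = ideal_depth A.Q P" using CM max by (simp add: cohen_macaulay_ring_def)
  finally have depth: "enat 2 \<le> ideal_depth A.Q P" .
  have "\<exists>fs. regular_sequence A.Q fs \<and> set fs \<subseteq> P \<and> 2 \<le> length fs"
  proof (rule ccontr)
    assume "\<not> ?thesis"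
    then have "ideal_depth A.Q P \<le> enat 1"
      unfolding ideal_depth_def by (intro Sup_least) force
    then have "enat 2 \<le> enat 1" using depth by (rule order_trans[rotated])
    then show False by simp
  qed
  then obtain fs where fs: "regular_sequence A.Q fs" "set fs \<subseteq> P" "2 \<le> length fs" by blast
  have "fs ! 0 \<in> P" "fs ! 1 \<in> P" using fs(2,3) by (auto intro!: subsetD[OF fs(2)] nth_mem)
  then obtain f g where f: "fs ! 0 = A.proj f" "f \<in> coord_prime UNIV" 
      and g: "fs ! 1 = A.proj g" "g \<in> coord_prime UNIV"
    by (auto simp: P_def C_def V_def)
  have reg: "h \<in> Idl\<^bsub>A.Q\<^esub> (set (take i fs))"
    if "i < length fs" "h \<in> carrier A.Q" "fs ! i \<otimes>\<^bsub>A.Q\<^esub> h \<in> Idl\<^bsub>A.Q\<^esub> (set (take i fs))" for i h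
    using fs(1) that unfolding regular_sequence_def by blast
  show False
  proof (rule gap_no_regular_pair[OF v f(2) g(2)])
    show "p \<in> ?I" if "f * p \<in> ?I" for p
      using reg[of 0 "A.proj p"] that fs(3) by (cases "fs = []") (simp_all add: f A.mem_Idl_empty_iff)
    have take1: "take (Suc 0) fs = [A.proj f]"
      using fs(3) f(1) by (cases fs) auto
    show "\<exists>w. p - f * w \<in> ?I" if "g * p - f * q \<in> ?I" for p q
    proof -
      have "A.proj (g * p) \<in> Idl\<^bsub>A.Q\<^esub> {A.proj f}" using that unfolding A.mem_Idl_single_iff by blast
      then have "A.proj p \<in> Idl\<^bsub>A.Q\<^esub> {A.proj f}"
        using reg[of 1 "A.proj p"] fs(3) g(1) by (simp add: take1)
      then show ?thesis unfolding A.mem_Idl_single_iff .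
    qed
  qed
qed

section \<open>The inequalities for a gap\<close>
text \<open>
  The least integer \<open>h\<close> with \<open>L \<le> 2 h\<close> satisfies \<open>2 h \<le> U\<close>, unless \<open>L = U\<close> is odd.
\<close>
lemma integer_rounding:
  fixes L U :: int and l1 l2 l3 u1 u2 u3 :: int
  assumes "l1 \<le> u1" "l1 \<le> u2" "l1 \<le> u3" "l2 \<le> u1" "l2 \<le> u2" "l2 \<le> u3" "l3 \<le> u1" "l3 \<le> u2" "l3 \<le> u3"
    "l1 + l1 \<le> U" "l2 + l2 \<le> U" "l3 + l3 \<le> U" "L \<le> u1 + u1" "L \<le> u2 + u2" "L \<le> u3 + u3"
    "L < U \<or> L = U \<and> even L"
  obtains y where "l1 \<le> y" "l2 \<le> y" "l3 \<le> y" "y \<le> u1" "y \<le> u2" "y \<le> u3" "L \<le> 2 * y" "2 * y \<le> U"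
proof -
  define h where "h = (L + 1) div 2"
  have h: "L \<le> 2 * h" "2 * h \<le> L + 1" "even L \<Longrightarrow> 2 * h = L" unfolding h_def by presburger+
  have "2 * h \<le> U"
    using assms(16)
  proof
    assume "L < U" then show ?thesis using h(2) by linarith
  next
    assume LU: "L = U \<and> even L"
    then have "2 * h = L" using h(3) by blast
    then show ?thesis using LU by simp
  qed
  moreover have "h \<le> u1" "h \<le> u2" "h \<le> u3" using h(2) assms(13-15) by linarith+
  ultimately have h': "2 * h \<le> U" "h \<le> u1" "h \<le> u2" "h \<le> u3" by simp_all
  define y where "y = max (max l1 l2) (max l3 h)"
  have "l1 \<le> y" "l2 \<le> y" "l3 \<le> y" "h \<le> y" by (simp_all add: y_def)
  moreover have "y \<le> u1" "y \<le> u2" "y \<le> u3" using assms(1-9) h' by (simp_all add: y_def)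
  moreover have "l1 \<le> U div 2" "l2 \<le> U div 2" "l3 \<le> U div 2" "h \<le> U div 2"
    using assms(10-12) h'(1) by linarith+
  then have "y \<le> U div 2" by (simp add: y_def)
  then have "2 * y \<le> U" by linarith
  ultimately show ?thesis using h(1) by - (rule that[of y]; linarith)
qed

text \<open>
  For the construction of a solution put \<open>c1 = x\<close>, \<open>c2 = a1 - 1 - x\<close>, \<open>c3 = y\<close>, \<open>c4 = a6 - 1 - y\<close>.  The
  inequalities become lower and upper bounds for \<open>x\<close> that depend on \<open>y\<close>; they are compatible iff \<open>y\<close> satisfies
  the bounds obtained below from \<open>integer_rounding\<close>.  The bounds \<open>L\<close> and \<open>U\<close> for \<open>2 y\<close> come from combining
  \<open>x + y \<ge> a2\<close> with \<open>y - x \<ge> a4 - a1 + 1\<close>, and \<open>x + y \<le> s - a5\<close> with \<open>x - y \<ge> a3 - a6 + 1\<close>.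
\<close>
lemma obstruction_arithmetic:
  fixes a1 a2 a3 a4 a5 a6 :: nat and A :: int
  assumes A_eq: "A = Max {int a2 + int a5, int a3 + int a4,
                 int a2 + int a4 - int a6 + 1, int a3 + int a5 - int a6 + 1,
                 int a2 + int a3 - int a1 + 1, int a4 + int a5 - int a1 + 1}"
  shows "(\<exists>c1 c2 c3 c4. c1 + c2 < a1 \<and> c3 + c4 < a6 \<and> a2 \<le> c1 + c3 \<and> a3 \<le> c1 + c4 \<and> a4 \<le> c2 + c3 \<and> a5 \<le> c2 + c4) \<longleftrightarrow>
    \<not> ((a1 = 0 \<or> a6 = 0) \<or>
         int a1 + int a6 - 2 < A \<or>
         (int a1 + int a6 - 2 = int a2 + int a5 \<and>
          int a2 + int a5 = int a3 + int a4 \<and>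
          int a3 + int a4 = A \<and>
          even (int a2 + int a3 - int a6)))" (is "?L \<longleftrightarrow> \<not> ?R")
proof -
  define s where "s = int a1 + int a6 - 2"
  have A_le: "A \<le> s \<longleftrightarrow> int a2 + int a5 \<le> s \<and> int a3 + int a4 \<le> s \<and> int a2 + int a4 - int a6 + 1 \<le> s \<and>
      int a3 + int a5 - int a6 + 1 \<le> s \<and> int a2 + int a3 - int a1 + 1 \<le> s \<and> int a4 + int a5 - int a1 + 1 \<le> s"
    unfolding A_eq
    by (subst Max_le_iff) (simp_all only: finite.intros insert_not_empty not_False_eq_True ball_simps simp_thms)
  have A_ge: "int a2 + int a5 \<le> A" unfolding A_eq by (rule Max_ge) simp_all
  show ?thesis
  proof
    assume ?L
    then obtain c1 c2 c3 c4 where c: "c1 + c2 < a1" "c3 + c4 < a6" "a2 \<le> c1 + c3" "a3 \<le> c1 + c4" 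
      "a4 \<le> c2 + c3" "a5 \<le> c2 + c4" by blast
    have "A \<le> s" unfolding A_le using c unfolding s_def by (intro conjI; linarith)
    moreover have "odd (int a2 + int a3 - int a6)" 
      if "s = int a2 + int a5" "int a2 + int a5 = int a3 + int a4"
    proof -
      have "int a2 + int a3 - int a6 = 2 * int c1 - 1" using that c unfolding s_def by linarith
      then show ?thesis by simp
    qed
    ultimately show "\<not> ?R" using c unfolding s_def by auto
  next
    assume R: "\<not> ?R"
    then have pos: "1 \<le> a1" "1 \<le> a6" and As: "A \<le> s" by (auto simp: s_def)
    have le: "int a2 + int a5 \<le> s" "int a3 + int a4 \<le> s" "int a2 + int a4 - int a6 + 1 \<le> s"
        "int a3 + int a5 - int a6 + 1 \<le> s" "int a2 + int a3 - int a1 + 1 \<le> s" "int a4 + int a5 - int a1 + 1 \<le> s"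
      using As[unfolded A_le] by simp_all
    define L where "L = int a2 + int a4 - int a1 + 1"
    define U where "U = s - int a5 - int a3 + int a6 - 1"
    have parity: "L < U \<or> L = U \<and> even L"
    proof (rule ccontr)
      assume n: "\<not> ?thesis"
      have "U - L = (s - (int a2 + int a5)) + (s - (int a3 + int a4))" by (simp add: U_def L_def s_def)
      then have "s = int a2 + int a5" "s = int a3 + int a4" "odd L" using n le by linarith+
      moreover have "L = int a2 - int a3 + int a6 - 1" using \<open>s = int a3 + int a4\<close> by (simp add: L_def s_def)
      ultimately have "even (int a2 + int a3 - int a6)" by simp
      then show False using R A_ge As \<open>s = int a2 + int a5\<close> \<open>s = int a3 + int a4\<close> by (simp add: s_def)
    qed
    have bounds: "0 \<le> int a6 - 1" "0 \<le> s - int a5" "0 \<le> s - int a3"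
      "int a4 - int a1 + 1 \<le> int a6 - 1" "int a4 - int a1 + 1 \<le> s - int a5" "int a4 - int a1 + 1 \<le> s - int a3"
      "int a2 - int a1 + 1 \<le> int a6 - 1" "int a2 - int a1 + 1 \<le> s - int a5" "int a2 - int a1 + 1 \<le> s - int a3"
      "0 + 0 \<le> U" "(int a4 - int a1 + 1) + (int a4 - int a1 + 1) \<le> U" 
      "(int a2 - int a1 + 1) + (int a2 - int a1 + 1) \<le> U" "L \<le> (int a6 - 1) + (int a6 - 1)" 
      "L \<le> (s - int a5) + (s - int a5)" "L \<le> (s - int a3) + (s - int a3)"
      using pos le unfolding L_def U_def s_def by linarith+
    obtain y where "0 \<le> y" "int a4 - int a1 + 1 \<le> y" "int a2 - int a1 + 1 \<le> y"
        "y \<le> int a6 - 1" "y \<le> s - int a5" "y \<le> s - int a3" "L \<le> 2 * y" "2 * y \<le> U"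
      by (rule integer_rounding[OF bounds parity])
    note y = this[unfolded L_def U_def s_def]
    define x where "x = max 0 (max (int a2 - y) (int a3 - int a6 + 1 + y))"
    have x_le: "x \<le> b" if "0 \<le> b" "int a2 - y \<le> b" "int a3 - int a6 + 1 + y \<le> b" for b
      using that by (simp add: x_def)
    have x_ge: "0 \<le> x" "int a2 - y \<le> x" "int a3 - int a6 + 1 + y \<le> x"
      by (simp_all add: x_def)
    have "x \<le> int a1 - 1" "x \<le> int a1 + int a6 - 2 - int a5 - y" "x \<le> int a1 - 1 - int a4 + y"
      by (rule x_le; use y pos le[unfolded s_def] in linarith)+
    then have x: "0 \<le> x" "int a2 \<le> x + y" "int a3 \<le> x + (int a6 - 1 - y)" "x \<le> int a1 - 1" 
      "int a4 \<le> (int a1 - 1 - x) + y" "int a5 \<le> (int a1 - 1 - x) + (int a6 - 1 - y)"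
      using x_ge by linarith+
    obtain c1 where c1: "x = int c1" using x(1) zero_le_imp_eq_int by blast
    obtain c3 where c3: "y = int c3" using y(1) zero_le_imp_eq_int by blast
    have "0 \<le> int a1 - 1 - x" using x by linarith
    then obtain c2 where c2: "int a1 - 1 - x = int c2" using zero_le_imp_eq_int by blast
    have "0 \<le> int a6 - 1 - y" using y by linarith
    then obtain c4 where c4: "int a6 - 1 - y = int c4" using zero_le_imp_eq_int by blast
    have "c1 + c2 < a1 \<and> c3 + c4 < a6 \<and> a2 \<le> c1 + c3 \<and> a3 \<le> c1 + c4 \<and> a4 \<le> c2 + c3 \<and> a5 \<le> c2 + c4"
      using x(2,3,5,6) c2 c4 unfolding c1 c3 by (intro conjI; linarith)
    then show ?L by blast
  qed
qed

section \<open>The six edges of the tetrahedron\<close>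

lemma UNIV_4: "(UNIV :: 4 set) = {1, 2, 3, 4}"
proof -
  have "card {1, 2, 3, 4 :: 4} = card (UNIV :: 4 set)" by (simp add: card_insert_if)
  then show ?thesis using card_subset_eq[of "UNIV :: 4 set" "{1, 2, 3, 4}"] by simp
qed

lemma card_2_iff_4:
  "card e = 2 \<longleftrightarrow> e \<in> {{1, 2}, {1, 3}, {1, 4}, {2, 3}, {2, 4}, {3, 4 :: 4}}" (is "?L \<longleftrightarrow> ?R")
proof
  assume ?L
  then obtain x y where xy: "e = {x, y}" "x \<noteq> y" by (auto simp: card_2_iff)
  have "x \<in> {1, 2, 3, 4}" "y \<in> {1, 2, 3, 4}" using UNIV_4 by auto
  then show ?R using xy by (elim insertE emptyE; simp add: insert_commute)
next
  assume ?R
  then show ?L by (elim insertE emptyE; simp)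
qed

lemma Compl_4:
  "- {1, 2} = {3, 4 :: 4}" "- {1, 3} = {2, 4 :: 4}" "- {1, 4} = {2, 3 :: 4}"
  "- {2, 3} = {1, 4 :: 4}" "- {2, 4} = {1, 3 :: 4}" "- {3, 4} = {1, 2 :: 4}"
  unfolding Compl_eq_Diff_UNIV UNIV_4 by (simp_all add: insert_Diff_if insert_commute)

lemma edges_distinct_4:
  "{1, 2} \<noteq> {1, 3 :: 4}" "{1, 2} \<noteq> {1, 4 :: 4}" "{1, 2} \<noteq> {2, 3 :: 4}" "{1, 2} \<noteq> {2, 4 :: 4}" "{1, 2} \<noteq> {3, 4 :: 4}"
  "{1, 3} \<noteq> {1, 4 :: 4}" "{1, 3} \<noteq> {2, 3 :: 4}" "{1, 3} \<noteq> {2, 4 :: 4}" "{1, 3} \<noteq> {3, 4 :: 4}"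
  "{1, 4} \<noteq> {2, 3 :: 4}" "{1, 4} \<noteq> {2, 4 :: 4}" "{1, 4} \<noteq> {3, 4 :: 4}"
  "{2, 3} \<noteq> {2, 4 :: 4}" "{2, 3} \<noteq> {3, 4 :: 4}" "{2, 4} \<noteq> {3, 4 :: 4}"
  by (simp_all add: doubleton_eq_iff)

definition edge_exponent :: "nat \<Rightarrow> nat \<Rightarrow> nat \<Rightarrow> nat \<Rightarrow> nat \<Rightarrow> nat \<Rightarrow> 4 set \<Rightarrow> nat" where
  "edge_exponent a1 a2 a3 a4 a5 a6 e =
     (if e = {1, 2} then a1 else if e = {1, 3} then a2 else if e = {1, 4} then a3
      else if e = {2, 3} then a4 else if e = {2, 4} then a5 else a6)"

lemma edge_exponent_simps [simp]:
  "edge_exponent a1 a2 a3 a4 a5 a6 {1, 2} = a1"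
  "edge_exponent a1 a2 a3 a4 a5 a6 {1, 3} = a2"
  "edge_exponent a1 a2 a3 a4 a5 a6 {1, 4} = a3"
  "edge_exponent a1 a2 a3 a4 a5 a6 {2, 3} = a4"
  "edge_exponent a1 a2 a3 a4 a5 a6 {2, 4} = a5"
  "edge_exponent a1 a2 a3 a4 a5 a6 {3, 4} = a6"
  unfolding edge_exponent_def
  by (simp_all only: edges_distinct_4 edges_distinct_4[symmetric] if_True if_False simp_thms)

lemma all_edges_4:
  "(\<forall>e. card e = 2 \<longrightarrow> F e) \<longleftrightarrow> F {1, 2} \<and> F {1, 3} \<and> F {1, 4} \<and> F {2, 3} \<and> F {2, 4} \<and> F {3, 4 :: 4}"
  unfolding card_2_iff_4 by blast

lemma tetrahedral_ideal_eq:
  "(tetrahedral_ideal a1 a2 a3 a4 a5 a6 :: 'k::field poly4 set) = lines_ideal (edge_exponent a1 a2 a3 a4 a5 a6)"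
  unfolding lines_ideal_def all_edges_4 tetrahedral_ideal_def edge_ideal_def
  by (subst line_power_eq, simp)+ auto

text \<open>
  A gap at another pair of opposite edges, say \<open>{1, 3}\<close> and \<open>{2, 4}\<close>, has total degree both below \<open>a2 + a5\<close>
  and at least \<open>a1 + a6\<close>.
\<close>
lemma gap_iff_4:
  assumes dominant: "a1 + a6 \<ge> max (a2 + a5) (a3 + a4)"
  shows "(\<exists>e u. gap (edge_exponent a1 a2 a3 a4 a5 a6) e u) \<longleftrightarrow>
    (\<exists>c1 c2 c3 c4. c1 + c2 < a1 \<and> c3 + c4 < a6 \<and> a2 \<le> c1 + c3 \<and> a3 \<le> c1 + c4 \<and> a4 \<le> c2 + c3 \<and> a5 \<le> c2 + c4)"
    (is "?L \<longleftrightarrow> ?R")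
proof
  let ?a = "edge_exponent a1 a2 a3 a4 a5 a6"
  assume ?L
  then obtain e u where g: "gap ?a e u" by blast
  define c where "c = lookup u"
  have deg: "deg_in {1, 2} u = c 1 + c 2" "deg_in {1, 3} u = c 1 + c 3" "deg_in {1, 4} u = c 1 + c 4"
    "deg_in {2, 3} u = c 2 + c 3" "deg_in {2, 4} u = c 2 + c 4" "deg_in {3, 4} u = c 3 + c 4"
    by (simp_all add: deg_in_pair c_def)
  have "card e = 2" using g by (simp add: gap_def)
  then have e: "e \<in> {{1, 2}, {1, 3}, {1, 4}, {2, 3}, {2, 4}, {3, 4}}" by (simp only: card_2_iff_4)
  have lt: "deg_in e u < ?a e" "deg_in (- e) u < ?a (- e)"
    and le: "\<forall>e'. card e' = 2 \<longrightarrow> e' \<noteq> e \<longrightarrow> e' \<noteq> - e \<longrightarrow> ?a e' \<le> deg_in e' u"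
    using g by (simp_all add: gap_def)
  note le' = le[unfolded all_edges_4]
  have main: "c 1 + c 2 < a1 \<and> c 3 + c 4 < a6 \<and> a2 \<le> c 1 + c 3 \<and> a3 \<le> c 1 + c 4 \<and> a4 \<le> c 2 + c 3 \<and> a5 \<le> c 2 + c 4"
  proof -
    consider "e = {1, 2}" | "e = {3, 4}" | "e = {1, 3}" | "e = {2, 4}" | "e = {1, 4}" | "e = {2, 3}"
      using e by blast
    then show ?thesis
    proof cases
      case 1
      then show ?thesis using lt le' by (simp add: Compl_4 deg edges_distinct_4 edges_distinct_4[symmetric])
    next
      case 2
      then show ?thesis using lt le' by (simp add: Compl_4 deg edges_distinct_4 edges_distinct_4[symmetric])
    next
      case 3
      then show ?thesis using lt le' dominant
        by (simp add: Compl_4 deg edges_distinct_4 edges_distinct_4[symmetric])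
    next
      case 4
      then show ?thesis using lt le' dominant
        by (simp add: Compl_4 deg edges_distinct_4 edges_distinct_4[symmetric])
    next
      case 5
      then show ?thesis using lt le' dominant
        by (simp add: Compl_4 deg edges_distinct_4 edges_distinct_4[symmetric])
    next
      case 6
      then show ?thesis using lt le' dominant
        by (simp add: Compl_4 deg edges_distinct_4 edges_distinct_4[symmetric])
    qed
  qed
  then show ?R by blast
next
  let ?a = "edge_exponent a1 a2 a3 a4 a5 a6"
  assume ?R
  then obtain c1 c2 c3 c4 where c: "c1 + c2 < a1" "c3 + c4 < a6" "a2 \<le> c1 + c3" "a3 \<le> c1 + c4" 
    "a4 \<le> c2 + c3" "a5 \<le> c2 + c4" by blast
  define u :: "4 \<Rightarrow>\<^sub>0 nat" where "u = mterm 1 c1 + mterm 2 c2 + mterm 3 c3 + mterm 4 c4"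
  have deg: "deg_in {1, 2} u = c1 + c2" "deg_in {1, 3} u = c1 + c3" "deg_in {1, 4} u = c1 + c4"
    "deg_in {2, 3} u = c2 + c3" "deg_in {2, 4} u = c2 + c4" "deg_in {3, 4} u = c3 + c4"
    by (simp_all add: u_def deg_in_mterm)
  have other: "\<forall>e'. card e' = 2 \<longrightarrow> e' \<noteq> {1, 2} \<longrightarrow> e' \<noteq> - {1, 2} \<longrightarrow> ?a e' \<le> deg_in e' u"
    unfolding all_edges_4 using c by (simp add: Compl_4 deg)
  have "gap ?a {1, 2} u"
    unfolding gap_def
  proof (intro conjI allI impI)
    show "card {1, 2 :: 4} = 2" by simp
    show "deg_in {1, 2} u < ?a {1, 2}" "deg_in (- {1, 2}) u < ?a (- {1, 2})"
      using c by (simp_all add: Compl_4 deg)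
    show "?a e' \<le> deg_in e' u" if "card e' = 2 \<and> e' \<noteq> {1, 2} \<and> e' \<noteq> - {1, 2}" for e'
      using other that by blast
  qed
  then show ?L by blast
qed

theorem theorem3p2:
  fixes a1 a2 a3 a4 a5 a6 :: nat and A :: int
  assumes not_all_zero: "\<not> (a1 = 0 \<and> a2 = 0 \<and> a3 = 0 \<and> a4 = 0 \<and> a5 = 0 \<and> a6 = 0)"
    and dominant: "a1 + a6 \<ge> max (a2 + a5) (a3 + a4)"
    and A_eq: "A = Max {int a2 + int a5, int a3 + int a4,
                 int a2 + int a4 - int a6 + 1, int a3 + int a5 - int a6 + 1,
                 int a2 + int a3 - int a1 + 1, int a4 + int a5 - int a1 + 1}"
  shows "arithmetically_cohen_macaulay
           (tetrahedral_ideal a1 a2 a3 a4 a5 a6 :: 'k::field poly4 set) \<longleftrightarrow>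
         (a1 = 0 \<or> a6 = 0) \<or>
         int a1 + int a6 - 2 < A \<or>
         (int a1 + int a6 - 2 = int a2 + int a5 \<and>
          int a2 + int a5 = int a3 + int a4 \<and>
          int a3 + int a4 = A \<and>
          even (int a2 + int a3 - int a6))"
proof -
  let ?a = "edge_exponent a1 a2 a3 a4 a5 a6"
  have "arithmetically_cohen_macaulay (tetrahedral_ideal a1 a2 a3 a4 a5 a6 :: 'k poly4 set) \<longleftrightarrow>
      \<not> (\<exists>e u. gap ?a e u)"
    unfolding arithmetically_cohen_macaulay_def tetrahedral_ideal_eq
    using no_gap_imp_cohen_macaulay[of ?a] gap_imp_not_cohen_macaulay[of ?a] by auto
  then show ?thesis
    unfolding gap_iff_4[OF dominant] obstruction_arithmetic[OF A_eq] not_not .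
qed

end
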